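(* Assume H1 and that at least one of H2, H3 holds. Let $\bar\kappa > 1 \ge \underline{\kappa} > 1/2$. If H2 holds let $\bar\gamma < \min\{(2-1/\underline{\kappa})/L,\ 2/(\mathtt{m}+L)\}$, and if H3 holds let $\bar\gamma < \min\{(2-1/\underline{\kappa})/L,\ \eta/(2ML)\}$. Let $W = W_q$ for some $q\in\mathbb{N}^*$ if H2 holds, and $W = W_\alpha$ for some $\alpha < \min(\underline{\kappa}\eta/4, \eta/8)$ if H3 holds. Then for any $a\in(0,1]$ there exist $A_{2,a}\ge 0$ and $\rho_a\in(0,1)$ such that for any $\theta\in\Theta$, $\kappa\in[\underline{\kappa},\bar\kappa]$ and $\gamma\in(0,\bar\gamma]$, the kernels $R^{\kappa}_{\gamma,\theta}$ and $\bar R^{\kappa}_{\gamma,\theta}$ admit invariant probability measures $\pi_{\gamma,\theta}$ and $\bar\pi_{\gamma,\theta}$ respectively, and for any $x,y\in\mathbb{R}^d$ and $n\in\mathbb{N}$, $$\max\big(\|\delta_x (R^{\kappa}_{\gamma,\theta})^n - \pi_{\gamma,\theta}\|_{W^a},\ \|\delta_x (\bar R^{\kappa}_{\gamma,\theta})^n - \bar\pi_{\gamma,\theta}\|_{W^a}\big) \le A_{2,a}\rho_a^{\gamma n} W^a(x),$$ $$\max\big(\|\delta_x (R^{\kappa}_{\gamma,\theta})^n - \delta_y (R^{\kappa}_{\gamma,\theta})^n\|_{W^a},\ \|\delta_x (\bar R^{\kappa}_{\gamma,\theta})^n - \delta_y (\bar R^{\kappa}_{\gamma,\theta})^n\|_{W^a}\big)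 \le A_{2,a}\rho_a^{\gamma n} \{W^a(x)+W^a(y)\}.$$
   Context: Let $d,d_\Theta\ge1$ and $\Theta\subset\mathbb{R}^{d_\Theta}$ nonempty; $\|\cdot\|$ is the Euclidean norm. For a convex lower semicontinuous $U:\mathbb{R}^d\to\mathbb{R}$ and $\lambda>0$, $\mathrm{prox}^\lambda_U(x)=\arg\min_{\tilde x\in\mathbb{R}^d}\{U(\tilde x)+\|x-\tilde x\|^2/(2\lambda)\}$. A function $V$ is $\mathtt{m}$-convex ($\mathtt{m}\ge0$) if $V(tx+(1-t)y)\le tV(x)+(1-t)V(y)-(\mathtt{m}/2)t(1-t)\|x-y\|^2$ for all $x,y$, $t\in[0,1]$. H1: for every $\theta\in\Theta$ there are convex functions $V_\theta,\bar V_\theta,U_\theta,\bar U_\theta:\mathbb{R}^d\to[0,\infty)$ such that (a) $\pi_\theta(x)\propto\exp[-V_\theta(x)-U_\theta(x)]$, $\bar\pi_\theta(x)\propto\exp[-\bar V_\theta(x)-\bar U_\theta(x)]$ are probability densities and $\min(\inf_\theta\int e^{-V_\theta-U_\theta},\inf_\theta\int e^{-\bar V_\theta-\bar U_\theta})>0$; (b) $V_\theta,\bar V_\theta$ are continuously differentiable and there is $L\ge0$ with $\|\nabla V_\theta(x)-\nabla V_\theta(y)\|\le L\|x-y\|$ and the same for $\bar V_\theta$, for all $\theta,x,y$; moreover there are $R_{V,1},R_{V,2}\ge0$ such that for each $\theta$ there exist minimizers $x^*_\theta$ of $V_\theta$ and $\bar x^*_\theta$ of $\bar V_\theta$ with $\|x^*_\theta\|,\|\bar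 x^*_\theta\|\le R_{V,1}$ and $|V_\theta(x^*_\theta)|,|\bar V_\theta(\bar x^*_\theta)|\le R_{V,2}$; (c) there is $M\ge0$ such that $U_\theta,\bar U_\theta$ are $M$-Lipschitz for all $\theta$, and there are $R_{U,1},R_{U,2}\ge0$ such that for each $\theta$ there exist $x^\sharp_\theta,\bar x^\sharp_\theta$ with norms $\le R_{U,1}$ and $|U_\theta(x^\sharp_\theta)|,|\bar U_\theta(\bar x^\sharp_\theta)|\le R_{U,2}$. H2: there is $\mathtt{m}>0$ such that $V_\theta,\bar V_\theta$ are $\mathtt{m}$-convex for all $\theta$. H3: there are $\eta>0$, $c\ge0$ with $\min(U_\theta(x),\bar U_\theta(x))\ge\eta\|x\|-c$ for all $\theta,x$. MYULA kernels: for $\kappa,\gamma>0$, $\theta\in\Theta$, $R^\kappa_{\gamma,\theta}(x,\cdot)$ is the Gaussian law with mean $x-\gamma\nabla V_\theta(x)-\kappa^{-1}(x-\mathrm{prox}^{\gamma\kappa}_{U_\theta}(x))$ and covariance $2\gamma I_d$ (one step of $X_{k+1}=X_k-\gamma\nabla V_\theta(X_k)-\gamma\nabla U_\theta^{\gamma\kappa}(X_k)+\sqrt{2\gamma}Z_{k+1}$, $U^\lambda$ the Moreau–Yosida envelope); $\bar R^\kappa_{\gamma,\theta}$ is the same with $\bar V_\theta,\bar U_\theta$. Functions: $W_q(x)=1+\|x\|^{2q}$ ($q\in\mathbb{N}^*$), $W_\alpha(x)=\exp[\alpha\sqrt{1+\|x\|^2}]$ ($\alpha>0$). For $W\ge1$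 and a finite signed measure $\xi$, $\|\xi\|_W=\sup\{|\int f\,d\xi|: f \text{ measurable},\ \sup_x|f(x)|/W(x)\le1\}$. $\delta_x K^n$ is the law after $n$ steps of the kernel $K$ started at $x$. *)

theory Defs
  imports "HOL-Analysis.Analysis" "HOL-Probability.Probability"
begin

definition mconvex :: "real \<Rightarrow> ('d::real_normed_vector \<Rightarrow> real) \<Rightarrow> bool" where
  "mconvex m V \<longleftrightarrow> (\<forall>x y. \<forall>t\<in>{0..1::real}.
     V (t *\<^sub>R x + (1 - t) *\<^sub>R y) \<le> t * V x + (1 - t) * V y - (m / 2) * t * (1 - t) * (norm (x - y))\<^sup>2)"

text \<open>Proximal operator: the (unique, for convex lsc U) minimiser.\<close>
definition prox :: "real \<Rightarrow> ('d::real_normed_vector \<Rightarrow> real) \<Rightarrow> 'd \<Rightarrow> 'd" where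
  "prox lam U x = (ARG_MIN (\<lambda>z. U z + (norm (x - z))\<^sup>2 / (2 * lam)) z. True)"

definition gaussian :: "'d::euclidean_space \<Rightarrow> real \<Rightarrow> 'd measure" where
  "gaussian mu s = density lborel
     (\<lambda>y. ennreal ((2 * pi * s) powr (- real DIM('d) / 2) * exp (- (norm (y - mu))\<^sup>2 / (2 * s))))"

definition myula :: "('d::euclidean_space \<Rightarrow> 'd) \<Rightarrow> ('d \<Rightarrow> real) \<Rightarrow> real \<Rightarrow> real \<Rightarrow> 'd \<Rightarrow> 'd measure" where
  "myula gV U kappa gamma x =
     gaussian (x - gamma *\<^sub>R gV x - (1 / kappa) *\<^sub>R (x - prox (gamma * kappa) U x)) (2 * gamma)"

definition kiter :: "('d::euclidean_space \<Rightarrow> 'd measure) \<Rightarrow> nat \<Rightarrow> 'd \<Rightarrow> 'd measure" where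
  "kiter K n x = ((\<lambda>\<mu>. bind \<mu> K) ^^ n) (return borel x)"

definition invariant_prob :: "'d::euclidean_space measure \<Rightarrow> ('d \<Rightarrow> 'd measure) \<Rightarrow> bool" where
  "invariant_prob \<pi> K \<longleftrightarrow> prob_space \<pi> \<and> sets \<pi> = sets borel \<and> bind \<pi> K = \<pi>"

text \<open>W-norm of the signed measure mu - nu (mu, nu probability measures):
  supremum of |int f d(mu - nu)| over measurable f with |f| <= W.  We take the supremum
  over bounded such f, which gives the same value (monotone truncation) and avoids
  undefined integrals.\<close>
definition wnorm :: "('d::euclidean_space \<Rightarrow> real) \<Rightarrow> 'd measure \<Rightarrow> 'd measure \<Rightarrow> ereal" where
  "wnorm W \<mu> \<nu> = (SUP f \<in> {f. f \<in> borel_measurable borel \<and> bounded (range f) \<and> (\<forall>x. \<bar>f x\<bar> \<le> W x)}.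
      ereal \<bar>(\<integral>x. f x \<partial>\<mu>) - (\<integral>x. f x \<partial>\<nu>)\<bar>)"

definition Wq :: "nat \<Rightarrow> 'd::real_normed_vector \<Rightarrow> real" where
  "Wq q x = 1 + norm x ^ (2 * q)"

definition Walpha :: "real \<Rightarrow> 'd::real_normed_vector \<Rightarrow> real" where
  "Walpha \<alpha> x = exp (\<alpha> * sqrt (1 + (norm x)\<^sup>2))"

end

theory Submission
  imports Defs
begin

text \<open>The mean \<open>T\<close> of one MYULA step is nonexpansive, by the Baillon--Haddad theorem for \<open>V\<close> and firm
  nonexpansiveness of the proximal map. A log-Harnack inequality
  \<open>P\<^sup>n g x \<le> ln (P\<^sup>n (exp g) y) + (norm (x - y))\<^sup>2 / (4 \<gamma> n)\<close> then follows by induction on \<open>n\<close>, using only the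
  relative entropy of two Gaussians with equal covariance. For \<open>\<gamma> n \<ge> 1\<close> its error term no longer depends
  on \<open>\<gamma>\<close>, which gives a total variation bound below one on bounded sets, uniformly in the step size.
  Together with a drift \<open>P W \<le> (1 - c \<gamma>) W + b \<gamma>\<close>, the argument of Hairer and Mattingly applied to
  about \<open>1 / \<gamma>\<close> steps yields a contraction in a weighted oscillation seminorm. The invariant measure is the setwise
  limit of the laws started at \<open>0\<close>.\<close>

subsection \<open>Gaussian measures\<close>

text \<open>The constants must survive small \<open>\<gamma>\<close>, where one Gaussian step of
  variance \<open>2 * \<gamma>\<close> gives almost no overlap between distinct starting points.
  Hence the blocks of time length about one, and a smoothing estimate that does not lose a factor at
  every step. Smoothing uses nothing about the mean except nonexpansiveness. The gradient part of a
  step has cocoercivity constant \<open>\<gamma> * L\<close> and the proximal part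
  \<open>1 / \<kappa>\<close>; the requirement that they sum to at most 2 is the origin of the
  step-size bound \<open>(2 - 1 / kl) / L\<close>. H2 and H3 enter through the drift: strong
  convexity contracts the squared norm of the mean, while linear growth of \<open>U\<close> lowers
  it by a multiple of \<open>\<gamma> * norm x\<close>. The exponent \<open>a\<close> is treated at
  the level of the drift, which concavity transfers from \<open>W\<close> to
  \<open>W powr a\<close>; the ergodic argument then runs with \<open>W powr a\<close> as its
  weight. \<open>A\<close> and \<open>\<rho>\<close> are explicit in the drift constants, the
  largest step size and the radius of one sublevel set of the weight. None of these depends on
  \<open>\<theta>\<close>, \<open>\<kappa>\<close> or \<open>\<gamma>\<close>, which is where the
  uniformity comes from.\<close>

definition gauss_density :: "'d::euclidean_space \<Rightarrow> real \<Rightarrow> 'd \<Rightarrow> real" where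
  "gauss_density mu s y =
     (2 * pi * s) powr (- real DIM('d) / 2) * exp (- (norm (y - mu))\<^sup>2 / (2 * s))"

lemma gauss_density_measurable [measurable]: "gauss_density mu s \<in> borel_measurable borel"
  unfolding gauss_density_def by measurable

lemma gauss_density_nonneg [simp]: "gauss_density mu s y \<ge> 0"
  by (simp add: gauss_density_def)

lemma gaussian_eq_density: "gaussian mu s = density lborel (\<lambda>y. ennreal (gauss_density mu s y))"
  by (simp add: gaussian_def gauss_density_def)

lemma sets_gaussian [simp, measurable_cong]: "sets (gaussian mu s) = sets borel"
  by (simp add: gaussian_def)

lemma space_gaussian [simp]: "space (gaussian mu s) = UNIV"
  by (simp add: gaussian_def)

text \<open>Factorisation over coordinates reduces the normalisation to the one-dimensional
  \<open>normal_density\<close>, which is parametrised by the standard deviation, hence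
  \<open>sqrt s\<close>.\<close>

lemma gauss_density_prod:
  fixes mu :: "'d::euclidean_space"
  assumes "s > 0"
  shows "gauss_density mu s y = (\<Prod>b\<in>Basis. normal_density (mu \<bullet> b) (sqrt s) (y \<bullet> b))"
proof -
  have "(\<Prod>b\<in>(Basis::'d set). 1 / sqrt (2 * pi * s)) = (2 * pi * s) powr (- real DIM('d) / 2)"
  proof -
    have "1 / sqrt (2 * pi * s) = (2 * pi * s) powr (- (1/2))"
      using assms by (simp add: powr_half_sqrt powr_minus field_simps)
    then have "(\<Prod>b\<in>(Basis::'d set). 1 / sqrt (2 * pi * s)) = ((2 * pi * s) powr (- (1/2))) ^ DIM('d)"
      by simp
    also have "\<dots> = (2 * pi * s) powr (- real DIM('d) / 2)"
      using assms by (simp add: powr_powr powr_realpow[symmetric] mult.commute)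
    finally show ?thesis .
  qed
  moreover have "exp (- (norm (y - mu))\<^sup>2 / (2 * s))
      = (\<Prod>b\<in>Basis. exp (- (y \<bullet> b - mu \<bullet> b)\<^sup>2 / (2 * s)))"
  proof -
    have "(norm (y - mu))\<^sup>2 = (\<Sum>b\<in>Basis. (y \<bullet> b - mu \<bullet> b)\<^sup>2)"
      unfolding power2_norm_eq_inner
      by (subst euclidean_inner) (simp add: inner_diff_left power2_eq_square)
    then show ?thesis
      by (simp add: exp_sum[symmetric] sum_negf sum_divide_distrib)
  qed
  moreover have "(\<Prod>b\<in>Basis. normal_density (mu \<bullet> b) (sqrt s) (y \<bullet> b))
    = (\<Prod>b\<in>(Basis::'d set). 1 / sqrt (2 * pi * s)) * (\<Prod>b\<in>Basis. exp (- (y \<bullet> b - mu \<bullet> b)\<^sup>2 / (2 * s)))"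
    unfolding normal_density_def using assms by (subst prod.distrib[symmetric]) simp
  ultimately show ?thesis
    unfolding gauss_density_def by presburger
qed

lemma nn_integral_gauss_density:
  assumes "s > 0"
  shows "(\<integral>\<^sup>+y. ennreal (gauss_density mu s y) \<partial>lborel) = 1"
proof -
  have n: "(\<integral>\<^sup>+x. ennreal (normal_density m (sqrt s) x) \<partial>lborel) = 1" for m
    using assms by (subst nn_integral_eq_integral) auto
  have "(\<integral>\<^sup>+y. ennreal (gauss_density mu s y) \<partial>lborel)
      = (\<integral>\<^sup>+y. (\<Prod>b\<in>Basis. ennreal (normal_density (mu \<bullet> b) (sqrt s) (y \<bullet> b))) \<partial>lborel)"
    using assms by (simp add: gauss_density_prod prod_ennreal)
  also have "\<dots> = (\<Prod>b\<in>Basis. (\<integral>\<^sup>+x. ennreal (normal_density (mu \<bullet> b) (sqrt s) x) \<partial>lborel))"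
    by (rule nn_integral_lborel_prod) auto
  finally show ?thesis by (simp add: n)
qed

lemma prob_space_gaussian: "s > 0 \<Longrightarrow> prob_space (gaussian mu s)"
  by (rule prob_spaceI)
    (simp add: gaussian_eq_density emeasure_density nn_integral_gauss_density)

lemma measure_gaussian_UNIV [simp]: "s > 0 \<Longrightarrow> measure (gaussian mu s) UNIV = 1"
  using prob_space.prob_space[OF prob_space_gaussian, of s mu] by simp

lemma nn_integral_gaussian:
  "f \<in> borel_measurable borel \<Longrightarrow>
    (\<integral>\<^sup>+y. f y \<partial>gaussian mu s) = (\<integral>\<^sup>+y. ennreal (gauss_density mu s y) * f y \<partial>lborel)"
  unfolding gaussian_eq_density by (rule nn_integral_density) auto

text \<open>Gaussians with different means become functions of the same centred noise. This is the
  coupling used in the log-Harnack induction, and the way integrals of Lyapunov functions are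
  expanded around the mean.\<close>

lemma gaussian_translate: "gaussian mu s = distr (gaussian 0 s) borel (\<lambda>w. mu + w)"
proof -
  have "gaussian mu s = density (distr lborel borel ((+) mu)) (\<lambda>y. ennreal (gauss_density mu s y))"
    by (simp add: gaussian_eq_density lborel_distr_plus)
  also have "\<dots> = distr (density lborel (\<lambda>y. ennreal (gauss_density mu s (mu + y)))) borel ((+) mu)"
    by (subst density_distr) auto
  also have "(\<lambda>y. ennreal (gauss_density mu s (mu + y))) = (\<lambda>y. ennreal (gauss_density 0 s y))"
    by (simp add: gauss_density_def)
  finally show ?thesis by (simp add: gaussian_eq_density)
qed

text \<open>Reflection symmetry removes odd terms: linear functionals get mean zero, and even
  moments can be averaged over \<open>w\<close> and \<open>- w\<close>.\<close>

lemma gaussian_uminus: "distr (gaussian 0 s) borel uminus = gaussian 0 s"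
proof -
  have *: "gauss_density 0 s (- y) = gauss_density 0 s y" for y :: 'a
    by (simp add: gauss_density_def)
  have "distr (density lborel (\<lambda>y. ennreal (gauss_density (0::'a) s (- y)))) borel uminus
      = density (distr lborel borel uminus) (\<lambda>y. ennreal (gauss_density 0 s y))"
    by (subst density_distr) auto
  also have "distr lborel borel uminus = (lborel :: 'a measure)"
    using lborel_affine[of "-1" "0::'a"] by (simp add: density_1)
  finally show ?thesis unfolding gaussian_eq_density * .
qed

lemma nn_integral_gaussian_translate:
  "f \<in> borel_measurable borel \<Longrightarrow>
    (\<integral>\<^sup>+y. f y \<partial>gaussian mu s) = (\<integral>\<^sup>+w. f (mu + w) \<partial>gaussian 0 s)"
  by (subst gaussian_translate) (simp add: nn_integral_distr)

lemma integral_gaussian_translate: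
  fixes f :: "'d::euclidean_space \<Rightarrow> real"
  shows "f \<in> borel_measurable borel \<Longrightarrow>
    (\<integral>y. f y \<partial>gaussian mu s) = (\<integral>w. f (mu + w) \<partial>gaussian 0 s)"
  by (subst gaussian_translate) (simp add: integral_distr)

lemma nn_integral_gaussian_symm:
  "f \<in> borel_measurable borel \<Longrightarrow>
    (\<integral>\<^sup>+w. f w \<partial>gaussian 0 s) = (\<integral>\<^sup>+w. f (- w) \<partial>gaussian 0 s)"
  by (subst gaussian_uminus[symmetric]) (simp add: nn_integral_distr)

text \<open>Completing the square exhibits the integrand as a multiple of a Gaussian density of
  variance \<open>s / (1 - 2 s \<beta>)\<close>.\<close>
lemma gaussian_exp_quadratic:
  fixes a :: "'d::euclidean_space"
  assumes s: "s > 0" and b: "2 * s * \<beta> < 1"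
  shows "(\<integral>\<^sup>+w. ennreal (exp (a \<bullet> w + \<beta> * (norm w)\<^sup>2)) \<partial>gaussian 0 s)
    = ennreal ((1 - 2 * s * \<beta>) powr (- real DIM('d) / 2)
        * exp (s * (norm a)\<^sup>2 / (2 * (1 - 2 * s * \<beta>))))"
proof -
  define t where "t = 1 - 2 * s * \<beta>"
  define s' where "s' = s / t"
  define C where "C = t powr (- real DIM('d) / 2) * exp (s * (norm a)\<^sup>2 / (2 * t))"
  have t: "t > 0" and s': "s' > 0" using b s by (auto simp: t_def s'_def)
  have beta: "\<beta> = (1 - t) / (2 * s)" using s by (simp add: t_def)
  have "gauss_density 0 s w * exp (a \<bullet> w + \<beta> * (norm w)\<^sup>2) = C * gauss_density (s' *\<^sub>R a) s' w" for w
  proof -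
    have 1: "(2 * pi * s) powr (- real DIM('d) / 2)
        = t powr (- real DIM('d) / 2) * (2 * pi * s') powr (- real DIM('d) / 2)"
      using s t by (simp add: s'_def powr_mult[symmetric])
    have n: "(norm (w - s' *\<^sub>R a))\<^sup>2 = (norm w)\<^sup>2 - 2 * s' * (a \<bullet> w) + s'\<^sup>2 * (norm a)\<^sup>2"
      unfolding power2_norm_eq_inner
      by (simp add: inner_diff_left inner_diff_right inner_commute power2_eq_square algebra_simps)
    have 2: "- (norm (w - 0))\<^sup>2 / (2 * s) + (a \<bullet> w + \<beta> * (norm w)\<^sup>2)
        = s * (norm a)\<^sup>2 / (2 * t) + - (norm (w - s' *\<^sub>R a))\<^sup>2 / (2 * s')"
      unfolding n using s t by (simp add: s'_def beta field_simps power2_eq_square)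
    show ?thesis
      unfolding gauss_density_def C_def 1
      using arg_cong[OF 2, of exp] unfolding exp_add by (simp add: mult_ac)
  qed
  then have "(\<integral>\<^sup>+w. ennreal (exp (a \<bullet> w + \<beta> * (norm w)\<^sup>2)) \<partial>gaussian 0 s)
      = (\<integral>\<^sup>+w. ennreal C * ennreal (gauss_density (s' *\<^sub>R a) s' w) \<partial>lborel)"
    using t by (subst nn_integral_gaussian) (auto simp: ennreal_mult[symmetric] C_def)
  also have "\<dots> = ennreal C"
    using s' by (simp add: nn_integral_cmult nn_integral_gauss_density)
  finally show ?thesis by (simp add: C_def t_def)
qed

section \<open>Moments of centred Gaussians\<close>

lemma fact_power_le_exp:
  fixes t :: real assumes "t \<ge> 0" shows "t ^ j \<le> fact j * exp t"
proof -
  have "(\<Sum>n\<in>{j}. t ^ n /\<^sub>R fact n) \<le> (\<Sum>n. t ^ n /\<^sub>R fact n)"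
    using assms by (intro sum_le_suminf[OF summable_exp_generic]) auto
  then have "inverse (fact j) * t ^ j \<le> exp t"
    by (simp add: exp_def)
  then have "fact j * (inverse (fact j) * t ^ j) \<le> fact j * exp t"
    by (rule mult_left_mono) simp
  then show ?thesis by (subst (asm) mult.assoc[symmetric]) simp
qed

text \<open>The power is dominated by one term of the exponential series at
  \<open>(norm w)\<^sup>2 / (4 * s)\<close>. That exponent is half the critical one, so its
  exponential has a finite integral depending on the dimension only. The factor \<open>s ^ j\<close>
  is what matters later: for \<open>j >= 1\<close> and bounded \<open>s\<close> the moment is of
  order \<open>s\<close>.\<close>

lemma gaussian_even_moment:
  fixes j :: nat
  assumes s: "s > 0"
  shows "(\<integral>\<^sup>+w. ennreal (norm (w::'d::euclidean_space) ^ (2 * j)) \<partial>gaussian 0 s)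
    \<le> ennreal (fact j * (4 * s) ^ j * 2 ^ DIM('d))"
proof -
  have pw: "norm w ^ (2 * j) \<le> fact j * (4 * s) ^ j * exp (0 \<bullet> w + (1 / (4 * s)) * (norm w)\<^sup>2)" for w :: 'd
  proof -
    have "((norm w)\<^sup>2 / (4 * s)) ^ j \<le> fact j * exp ((norm w)\<^sup>2 / (4 * s))"
      using s by (intro fact_power_le_exp) auto
    then have "((norm w)\<^sup>2) ^ j \<le> fact j * (4 * s) ^ j * exp ((norm w)\<^sup>2 / (4 * s))"
      using s by (simp add: power_divide field_simps)
    then show ?thesis by (simp add: power_mult[symmetric])
  qed
  have "(\<integral>\<^sup>+w. ennreal (norm (w::'d) ^ (2 * j)) \<partial>gaussian 0 s)
      \<le> (\<integral>\<^sup>+w. ennreal (fact j * (4 * s) ^ j) * ennreal (exp (0 \<bullet> w + (1 / (4 * s)) * (norm (w::'d))\<^sup>2)) \<partial>gaussian 0 s)"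
    using pw s by (intro nn_integral_mono) (auto simp: ennreal_mult[symmetric] intro!: ennreal_leI)
  also have "\<dots> = ennreal (fact j * (4 * s) ^ j) * ennreal ((1/2) powr (- real DIM('d) / 2))"
    using s by (subst nn_integral_cmult, simp, subst gaussian_exp_quadratic) auto
  also have "\<dots> \<le> ennreal (fact j * (4 * s) ^ j * 2 ^ DIM('d))"
  proof -
    have "(1/2::real) powr (- real DIM('d) / 2) = 2 powr (real DIM('d) / 2)"
      by (simp add: powr_divide powr_minus field_simps)
    also have "\<dots> \<le> 2 powr (real DIM('d))" by (rule powr_mono) auto
    finally show ?thesis
      using s by (subst ennreal_mult[symmetric]) (auto intro!: ennreal_leI mult_left_mono simp: powr_realpow)
  qed
  finally show ?thesis .
qed

lemma gaussian_linear:
  fixes a :: "'d::euclidean_space"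
  assumes s: "s > 0"
  shows "integrable (gaussian 0 s) (\<lambda>w. a \<bullet> w)" and "(\<integral>w. a \<bullet> w \<partial>gaussian 0 s) = 0"
proof -
  show int: "integrable (gaussian 0 s) (\<lambda>w. a \<bullet> w)"
  proof (rule integrableI_bounded)
    have "(\<integral>\<^sup>+w. ennreal (norm (a \<bullet> w)) \<partial>gaussian 0 s)
      \<le> (\<integral>\<^sup>+w. ennreal (exp (a \<bullet> w + 0 * (norm w)\<^sup>2)) + ennreal (exp ((-a) \<bullet> w + 0 * (norm w)\<^sup>2)) \<partial>gaussian 0 s)"
    proof (intro nn_integral_mono)
      fix w
      have "\<bar>a \<bullet> w\<bar> \<le> exp (a \<bullet> w) + exp (- (a \<bullet> w))"
        using exp_ge_add_one_self[of "a \<bullet> w"] exp_ge_add_one_self[of "- (a \<bullet> w)"]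
          exp_gt_zero[of "a \<bullet> w"] exp_gt_zero[of "- (a \<bullet> w)"] by linarith
      then show "ennreal (norm (a \<bullet> w)) \<le> ennreal (exp (a \<bullet> w + 0 * (norm w)\<^sup>2)) + ennreal (exp ((-a) \<bullet> w + 0 * (norm w)\<^sup>2))"
        by (simp add: ennreal_plus[symmetric] ennreal_leI del: ennreal_plus)
    qed
    also have "\<dots> < \<infinity>"
      using s by (subst nn_integral_add, simp, simp, subst gaussian_exp_quadratic, simp, simp,
          subst gaussian_exp_quadratic) auto
    finally show "(\<integral>\<^sup>+w. ennreal (norm (a \<bullet> w)) \<partial>gaussian 0 s) < \<infinity>" .
  qed simp
  have "(\<integral>w. a \<bullet> w \<partial>gaussian 0 s) = (\<integral>w. a \<bullet> w \<partial>distr (gaussian 0 s) borel uminus)"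
    by (simp add: gaussian_uminus)
  also have "\<dots> = - (\<integral>w. a \<bullet> w \<partial>gaussian 0 s)"
    by (subst integral_distr) auto
  finally show "(\<integral>w. a \<bullet> w \<partial>gaussian 0 s) = 0" by simp
qed

lemma integrable_gaussian_bounded:
  fixes f :: "'d::euclidean_space \<Rightarrow> real"
  assumes "s > 0" "f \<in> borel_measurable borel" "bounded (range f)"
  shows "integrable (gaussian mu s) f"
proof -
  interpret prob_space "gaussian mu s" by (rule prob_space_gaussian[OF assms(1)])
  obtain B where "\<And>x. \<bar>f x\<bar> \<le> B" using assms(3) by (auto simp: bounded_iff)
  then show ?thesis using assms(2) by (intro integrable_const_bound[where B=B]) auto
qed

text \<open>The Gibbs variational inequality, a consequence of the tangent line \<open>exp t \<ge> exp k * (1 + t - k)\<close> at the mean \<open>k\<close> of the exponent.\<close>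
lemma gaussian_log_harnack:
  fixes v w :: "'d::euclidean_space"
  assumes s: "s > 0" and g[measurable]: "g \<in> borel_measurable borel" and bd: "bounded (range g)"
  shows "(\<integral>y. g y \<partial>gaussian w s) \<le> ln (\<integral>y. exp (g y) \<partial>gaussian v s) + (norm (w - v))\<^sup>2 / (2 * s)"
proof -
  interpret w: prob_space "gaussian w s" by (rule prob_space_gaussian[OF s])
  \<comment> \<open>\<open>l\<close> is the logarithm of the density of \<open>gaussian v s\<close>
    with respect to \<open>gaussian w s\<close>; its mean under \<open>gaussian w s\<close> is minus
    their relative entropy.\<close>
  define l where "l y = ((norm (y - w))\<^sup>2 - (norm (y - v))\<^sup>2) / (2 * s)" for y
  have l_eq: "l (w + z) = ((1 / s) *\<^sub>R (v - w)) \<bullet> z - (norm (w - v))\<^sup>2 / (2 * s)" for z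
  proof -
    have "(norm z)\<^sup>2 - (norm (w + z - v))\<^sup>2 = 2 * ((v - w) \<bullet> z) - (norm (w - v))\<^sup>2"
      unfolding power2_norm_eq_inner by (simp add: inner_simps inner_commute)
    then have "l (w + z) = (2 * ((v - w) \<bullet> z) - (norm (w - v))\<^sup>2) / (2 * s)"
      by (simp add: l_def)
    also have "\<dots> = (1 / s) * ((v - w) \<bullet> z) - (norm (w - v))\<^sup>2 / (2 * s)"
      by (simp add: diff_divide_distrib)
    finally show ?thesis by (simp only: inner_scaleR_left)
  qed
  have l_meas[measurable]: "l \<in> borel_measurable borel" unfolding l_def by measurable
  interpret z: prob_space "gaussian (0::'d) s" by (rule prob_space_gaussian[OF s])
  have int_l: "integrable (gaussian w s) l"
    unfolding gaussian_translate[of w]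
    by (subst integrable_distr_eq) (auto simp: l_eq intro!: gaussian_linear s)
  have E_l: "(\<integral>y. l y \<partial>gaussian w s) = - (norm (w - v))\<^sup>2 / (2 * s)"
    unfolding gaussian_translate[of w]
    by (subst integral_distr)
      (simp_all add: l_eq Bochner_Integration.integral_diff gaussian_linear[OF s] s del: inner_scaleR_left)
  have int_g: "integrable (gaussian w s) g" by (rule integrable_gaussian_bounded[OF s g bd])
  obtain B where B: "\<And>x. \<bar>g x\<bar> \<le> B" using bd by (auto simp: bounded_iff)
  have gB: "g y \<le> B" for y using B[of y] by linarith
  have bdexp: "bounded (range (\<lambda>y. exp (g y)))"
    by (intro boundedI[where B="exp B"]) (auto simp: gB)
  have int_e: "integrable (gaussian v s) (\<lambda>y. exp (g y))"
    by (rule integrable_gaussian_bounded[OF s _ bdexp]) simp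
  have dens: "gauss_density v s y = gauss_density w s y * exp (l y)" for y
    by (simp add: gauss_density_def l_def mult.assoc exp_add[symmetric] diff_divide_distrib)
  have vw: "gaussian v s = density (gaussian w s) (\<lambda>y. ennreal (exp (l y)))"
    unfolding gaussian_eq_density
    by (subst density_density_eq) (auto simp: dens ennreal_mult)
  have int_gl: "integrable (gaussian w s) (\<lambda>y. exp (g y + l y))"
    using int_e unfolding vw by (subst (asm) integrable_density) (auto simp: exp_add mult.commute)
  have eq: "(\<integral>y. exp (g y) \<partial>gaussian v s) = (\<integral>y. exp (g y + l y) \<partial>gaussian w s)"
    unfolding vw by (subst integral_density) (auto simp: exp_add mult.commute)
  define k where "k = (\<integral>y. g y \<partial>gaussian w s) - (norm (w - v))\<^sup>2 / (2 * s)"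
  have k: "(\<integral>y. g y + l y \<partial>gaussian w s) = k"
    using int_g int_l by (simp add: k_def E_l)
  have "exp k = (\<integral>y. exp k * (1 + (g y + l y) - k) \<partial>gaussian w s)"
  proof -
    have "(\<integral>y. exp k * (1 + (g y + l y) - k) \<partial>gaussian w s)
        = exp k * ((\<integral>y. (1 - k) + (g y + l y) \<partial>gaussian w s))"
      by (subst Bochner_Integration.integral_mult_right_zero[symmetric])
        (rule Bochner_Integration.integral_cong[OF refl], algebra)
    also have "(\<integral>y. (1 - k) + (g y + l y) \<partial>gaussian w s) = (1 - k) + (\<integral>y. g y + l y \<partial>gaussian w s)"
      using int_g int_l s by (subst Bochner_Integration.integral_add) auto
    finally show ?thesis using k by simp
  qed
  also have "\<dots> \<le> (\<integral>y. exp (g y + l y) \<partial>gaussian w s)"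
  proof (intro integral_mono int_gl)
    show "integrable (gaussian w s) (\<lambda>y. exp k * (1 + (g y + l y) - k))"
      by (intro integrable_mult_right Bochner_Integration.integrable_diff Bochner_Integration.integrable_add
          int_g int_l) simp_all
    fix y
    have "exp k * (1 + (g y + l y - k)) \<le> exp k * exp (g y + l y - k)"
      using exp_ge_add_one_self[of "g y + l y - k"] by (intro mult_left_mono) auto
    also have "exp k * exp (g y + l y - k) = exp (g y + l y)"
      by (subst exp_add[symmetric]) simp
    finally show "exp k * (1 + (g y + l y) - k) \<le> exp (g y + l y)"
      by (simp add: add_diff_eq)
  qed
  finally have "exp k \<le> (\<integral>y. exp (g y) \<partial>gaussian v s)" by (simp add: eq)
  then have "k \<le> ln (\<integral>y. exp (g y) \<partial>gaussian v s)"
    using less_le_trans[OF exp_gt_zero[of k]] by (subst ln_ge_iff) auto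
  then show ?thesis by (simp add: k_def)
qed

subsection \<open>Convexity and the mean of a MYULA step\<close>

text \<open>The descent lemma. Along the segment from \<open>x\<close> to \<open>z\<close>, the
  difference \<open>h\<close> between \<open>V\<close> and its quadratic upper bound is
  nonincreasing, because Cauchy-Schwarz and the Lipschitz bound make its derivative
  nonpositive.\<close>

lemma lipschitz_grad_upper:
  fixes V :: "'d::euclidean_space \<Rightarrow> real"
  assumes grad: "\<And>x. (V has_derivative (\<lambda>h. g x \<bullet> h)) (at x)"
    and lip: "\<And>x y. norm (g x - g y) \<le> L * norm (x - y)"
  shows "V z \<le> V x + g x \<bullet> (z - x) + L / 2 * (norm (z - x))\<^sup>2"
proof -
  define d where "d = z - x"
  define h where "h t = V (x + t *\<^sub>R d) - t * (g x \<bullet> d) - L * t\<^sup>2 / 2 * (norm d)\<^sup>2" for t :: real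
  have der: "(h has_real_derivative (g (x + t *\<^sub>R d) \<bullet> d - g x \<bullet> d - L * t * (norm d)\<^sup>2)) (at t)" for t
  proof -
    have "((\<lambda>t. V (x + t *\<^sub>R d)) has_derivative (\<lambda>k. g (x + t *\<^sub>R d) \<bullet> (k *\<^sub>R d))) (at t)"
      by (rule has_derivative_compose[where g=V and f="\<lambda>t. x + t *\<^sub>R d", OF _ grad])
        (auto intro!: derivative_eq_intros)
    then have "((\<lambda>t. V (x + t *\<^sub>R d)) has_real_derivative (g (x + t *\<^sub>R d) \<bullet> d)) (at t)"
      by (simp add: has_field_derivative_def mult_commute_abs)
    then show ?thesis
      unfolding h_def by (auto intro!: derivative_eq_intros simp: power2_eq_square)
  qed
  have "h 1 \<le> h 0"
  proof (rule DERIV_nonpos_imp_nonincreasing[of 0 1 h])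
    fix t :: real assume t: "0 \<le> t" "t \<le> 1"
    have "(g (x + t *\<^sub>R d) - g x) \<bullet> d \<le> norm (g (x + t *\<^sub>R d) - g x) * norm d"
      by (rule norm_cauchy_schwarz)
    also have "\<dots> \<le> (L * norm (t *\<^sub>R d)) * norm d"
      using lip[of "x + t *\<^sub>R d" x] by (intro mult_right_mono) auto
    also have "\<dots> = L * t * (norm d)\<^sup>2" using t by (simp add: power2_eq_square)
    finally have "g (x + t *\<^sub>R d) \<bullet> d - g x \<bullet> d - L * t * (norm d)\<^sup>2 \<le> 0"
      by (simp add: inner_diff_left)
    then show "\<exists>y. (h has_real_derivative y) (at t) \<and> y \<le> 0" using der by blast
  qed simp
  then show ?thesis by (simp add: h_def d_def)
qed

text \<open>Makes plain convexity the instance \<open>m = 0\<close> of the strongly convex lemmas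
  below.\<close>

lemma mconvex_0: "convex_on UNIV V \<Longrightarrow> mconvex 0 V"
  by (auto simp: mconvex_def convex_on_def)

text \<open>If the bound failed, the defect \<open>h\<close> of the \<open>m\<close>-convexity
  inequality along the segment from \<open>y\<close> to \<open>x\<close> would vanish at 0 with
  positive derivative, hence be positive just after 0, where \<open>m\<close>-convexity forces it to
  be nonpositive.\<close>

lemma mconvex_grad_lower:
  fixes V :: "'d::euclidean_space \<Rightarrow> real"
  assumes grad: "\<And>x. (V has_derivative (\<lambda>h. g x \<bullet> h)) (at x)" and mc: "mconvex m V"
  shows "V y + g y \<bullet> (x - y) + m / 2 * (norm (x - y))\<^sup>2 \<le> V x"
proof (rule ccontr)
  assume neg: "\<not> ?thesis"
  define d where "d = x - y"
  define h where "h t = V (y + t *\<^sub>R d) - t * V x - (1 - t) * V y + (m / 2) * t * (1 - t) * (norm d)\<^sup>2" for t :: real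
  have "((\<lambda>t. V (y + t *\<^sub>R d)) has_derivative (\<lambda>k. g (y + 0 *\<^sub>R d) \<bullet> (k *\<^sub>R d))) (at 0)"
    by (rule has_derivative_compose[where g=V and f="\<lambda>t. y + t *\<^sub>R d", OF _ grad])
      (auto intro!: derivative_eq_intros)
  then have "((\<lambda>t. V (y + t *\<^sub>R d)) has_real_derivative (g y \<bullet> d)) (at 0)"
    by (simp add: has_field_derivative_def mult_commute_abs)
  then have "(h has_real_derivative (g y \<bullet> d - V x + V y + m / 2 * (norm d)\<^sup>2)) (at 0)"
    unfolding h_def by (auto intro!: derivative_eq_intros)
  moreover have "0 < g y \<bullet> d - V x + V y + m / 2 * (norm d)\<^sup>2"
    using neg by (simp add: d_def)
  ultimately obtain e where e: "e > 0" "\<forall>t>0. t < e \<longrightarrow> h 0 < h (0 + t)"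
    using DERIV_pos_inc_right by blast
  define t where "t = min 1 (e / 2)"
  have t: "0 < t" "t < e" "t \<le> 1" using e by (auto simp: t_def)
  have "V (t *\<^sub>R x + (1 - t) *\<^sub>R y) \<le> t * V x + (1 - t) * V y - (m / 2) * t * (1 - t) * (norm d)\<^sup>2"
    using mc t unfolding mconvex_def d_def by auto
  moreover have "t *\<^sub>R x + (1 - t) *\<^sub>R y = y + t *\<^sub>R d" by (simp add: d_def algebra_simps)
  ultimately have "h t \<le> 0" by (simp add: h_def)
  moreover have "h 0 = 0" by (simp add: h_def)
  ultimately show False using e(2) t by auto
qed

lemma mconvex_grad_mono:
  fixes V :: "'d::euclidean_space \<Rightarrow> real"
  assumes grad: "\<And>x. (V has_derivative (\<lambda>h. g x \<bullet> h)) (at x)" and mc: "mconvex m V"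
  shows "m * (norm (x - y))\<^sup>2 \<le> (g x - g y) \<bullet> (x - y)"
  using mconvex_grad_lower[OF grad mc, of y x] mconvex_grad_lower[OF grad mc, of x y]
  by (simp add: norm_minus_commute inner_diff_left inner_diff_right)

text \<open>The Baillon--Haddad theorem: compare the upper quadratic bound at \<open>x\<close> with the tangent at \<open>y\<close>
  at the point \<open>x - (g x - g y) / L\<close>.\<close>
lemma grad_cocoercive:
  fixes V :: "'d::euclidean_space \<Rightarrow> real"
  assumes grad: "\<And>x. (V has_derivative (\<lambda>h. g x \<bullet> h)) (at x)"
    and lip: "\<And>x y. norm (g x - g y) \<le> L * norm (x - y)"
    and L: "L \<ge> 0" and cv: "convex_on UNIV V"
  shows "(norm (g x - g y))\<^sup>2 \<le> L * ((g x - g y) \<bullet> (x - y))"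
\<comment> \<open>The comparison point divides by \<open>L\<close>; for \<open>L = 0\<close> the
  gradient is constant.\<close>
proof (cases "L = 0")
  case True
  then show ?thesis using lip[of x y] by simp
next
  case False
  then have L: "L > 0" using L by simp
  note mc = mconvex_0[OF cv]
  \<comment> \<open>One-sided form: adding the two versions with \<open>x\<close> and
    \<open>y\<close> exchanged cancels the values of \<open>V\<close> and doubles the gain
    \<open>1 / (2 * L)\<close>.\<close>
  have half: "V y - V x + g y \<bullet> (x - y) \<le> - (norm (g x - g y))\<^sup>2 / (2 * L)" for x y
  proof -
    define D where "D = g x - g y"
    define z where "z = x - (1 / L) *\<^sub>R D"
    have "V z \<le> V x + g x \<bullet> (z - x) + L / 2 * (norm (z - x))\<^sup>2"
      by (rule lipschitz_grad_upper[OF grad lip])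
    moreover have "V y + g y \<bullet> (z - y) \<le> V z"
      using mconvex_grad_lower[OF grad mc, of y z] by simp
    moreover have "g y \<bullet> (z - y) = g y \<bullet> (x - y) - (g y \<bullet> D) / L"
      by (simp add: z_def inner_diff_right)
    moreover have "g x \<bullet> (z - x) = - (g x \<bullet> D) / L" by (simp add: z_def)
    moreover have "L / 2 * (norm (z - x))\<^sup>2 = (norm D)\<^sup>2 / (2 * L)"
      using L by (simp add: z_def power_divide field_simps power2_eq_square)
    moreover have "(g x \<bullet> D) / L - (g y \<bullet> D) / L = (norm D)\<^sup>2 / L"
      by (simp add: D_def diff_divide_distrib[symmetric] inner_diff_left[symmetric] power2_norm_eq_inner)
    moreover have "(norm D)\<^sup>2 / (2 * L) = (norm D)\<^sup>2 / L / 2" by simp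
    ultimately show ?thesis unfolding D_def[symmetric] minus_divide_left[symmetric] by linarith
  qed
  have "- ((g x - g y) \<bullet> (x - y)) \<le> - (norm (g x - g y))\<^sup>2 / L"
    using half[of x y] half[of y x]
    by (simp add: norm_minus_commute inner_diff_left inner_diff_right)
  then show ?thesis using L by (simp add: field_simps)
qed

section \<open>Proximal maps\<close>

lemma prox_is_min:
  fixes U :: "'d::euclidean_space \<Rightarrow> real"
  assumes lam: "lam > 0" and nonneg: "\<And>x. U x \<ge> 0" and cont: "continuous_on UNIV U"
  shows "U (prox lam U x) + (norm (x - prox lam U x))\<^sup>2 / (2 * lam) \<le> U z + (norm (x - z))\<^sup>2 / (2 * lam)"
proof -
  define F where "F z = U z + (norm (x - z))\<^sup>2 / (2 * lam)" for z
  \<comment> \<open>Outside the ball of this radius about \<open>x\<close> the quadratic term alone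
    exceeds \<open>F x\<close>, so the minimum over the compact ball is global.\<close>
  define r where "r = sqrt (2 * lam * F x)"
  have Fx: "F x \<ge> 0" using nonneg by (simp add: F_def)
  have "continuous_on (cball x r) F"
    unfolding F_def using lam by (intro continuous_intros continuous_on_subset[OF cont]) auto
  moreover have "cball x r \<noteq> {}" using Fx lam by (simp add: r_def not_less)
  ultimately have "\<exists>p\<in>cball x r. \<forall>z\<in>cball x r. F p \<le> F z"
    by (intro continuous_attains_inf) auto
  then obtain p where p: "p \<in> cball x r" "\<And>z. z \<in> cball x r \<Longrightarrow> F p \<le> F z"
    by blast
  have "F p \<le> F z" for z
  proof (cases "z \<in> cball x r")
    case False
    then have "r < norm (x - z)" by (simp add: dist_norm)
    then have "2 * lam * F x < (norm (x - z))\<^sup>2"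
      using power_strict_mono[of r "norm (x - z)" 2] Fx lam by (simp add: r_def)
    then have "F x < (norm (x - z))\<^sup>2 / (2 * lam)" using lam by (simp add: field_simps)
    also have "\<dots> \<le> F z" using nonneg by (simp add: F_def)
    finally have "F x \<le> F z" by simp
    moreover have "F p \<le> F x" using p(2)[of x] Fx lam by (auto simp: r_def)
    ultimately show ?thesis by simp
  qed (use p in auto)
  \<comment> \<open>\<open>prox\<close> is a Hilbert choice, so it inherits minimality only once
    some minimiser is known to exist.\<close>
  then have "is_arg_min F (\<lambda>_. True) p" by (auto simp: is_arg_min_linorder)
  then have "is_arg_min F (\<lambda>_. True) (arg_min F (\<lambda>_. True))"
    unfolding arg_min_def by (rule someI)
  moreover have "arg_min F (\<lambda>_. True) = prox lam U x" by (simp only: prox_def F_def[abs_def])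
  ultimately show ?thesis by (auto simp: is_arg_min_linorder F_def)
qed

text \<open>The optimality condition: \<open>(x - p) / lam\<close> is a subgradient of
  \<open>U\<close> at \<open>p\<close>. Minimality is tested at \<open>p + t (z - p)\<close>,
  convexity bounds \<open>U\<close> there, and division by \<open>t\<close> leaves the error
  \<open>t * N\<close>, which is made smaller than any given \<open>e\<close>.\<close>

lemma prox_subgradient:
  fixes U :: "'d::euclidean_space \<Rightarrow> real"
  assumes lam: "lam > 0" and nonneg: "\<And>x. U x \<ge> 0" and cont: "continuous_on UNIV U"
    and cv: "convex_on UNIV U" and p: "p = prox lam U x"
  shows "U p + (x - p) \<bullet> (z - p) / lam \<le> U z"
proof (rule field_le_epsilon)
  fix e :: real assume e: "e > 0"
  define N where "N = (norm (z - p))\<^sup>2 / (2 * lam)"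
  have N: "N \<ge> 0" using lam by (simp add: N_def)
  define t where "t = min 1 (e / (N + 1))"
  have t: "0 < t" "t \<le> 1" "t * N \<le> e"
  proof -
    show "0 < t" "t \<le> 1" using e N by (auto simp: t_def)
    have "t * N \<le> e / (N + 1) * N" using N by (intro mult_right_mono) (auto simp: t_def)
    also have "\<dots> \<le> e" using e N by (simp add: field_simps)
    finally show "t * N \<le> e" .
  qed
  define y where "y = p + t *\<^sub>R (z - p)"
  have "U p + (norm (x - p))\<^sup>2 / (2 * lam) \<le> U y + (norm (x - y))\<^sup>2 / (2 * lam)"
    unfolding p by (rule prox_is_min[OF lam nonneg cont])
  moreover have "U y \<le> (1 - t) * U p + t * U z"
    using convex_onD[OF cv, of t p z] t by (simp add: y_def algebra_simps)
  moreover have "(norm (x - y))\<^sup>2 / (2 * lam)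
      = (norm (x - p))\<^sup>2 / (2 * lam) - t * ((x - p) \<bullet> (z - p) / lam) + t * (t * N)"
  proof -
    have "(norm (x - y))\<^sup>2 = (norm (x - p))\<^sup>2 - 2 * t * ((x - p) \<bullet> (z - p)) + t\<^sup>2 * (norm (z - p))\<^sup>2"
    proof -
      have "(norm (e - t *\<^sub>R f))\<^sup>2 = (norm e)\<^sup>2 - 2 * t * (e \<bullet> f) + t\<^sup>2 * (norm f)\<^sup>2" for e f :: 'd
        unfolding power2_norm_eq_inner
        by (simp add: inner_diff_left inner_diff_right inner_commute power2_eq_square)
      from this[of "x - p" "z - p"] show ?thesis by (simp add: y_def diff_diff_eq)
    qed
    then show ?thesis using lam by (simp add: N_def field_simps power2_eq_square)
  qed
  ultimately have "0 \<le> t * (U z - U p - (x - p) \<bullet> (z - p) / lam + t * N)"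
    by (simp add: algebra_simps)
  then have "0 \<le> U z - U p - (x - p) \<bullet> (z - p) / lam + t * N"
    using t by (simp add: zero_le_mult_iff)
  then show "U p + (x - p) \<bullet> (z - p) / lam \<le> U z + e" using t by linarith
qed

text \<open>Adding the subgradient inequalities at the two proximal points gives monotonicity of the
  subdifferential. The bound is stated for \<open>x - prox\<close>, the increment that enters the
  mean, as cocoercivity with constant 1.\<close>

lemma prox_firm:
  fixes U :: "'d::euclidean_space \<Rightarrow> real"
  assumes lam: "lam > 0" and nonneg: "\<And>x. U x \<ge> 0" and cont: "continuous_on UNIV U"
    and cv: "convex_on UNIV U"
  shows "(norm ((x - prox lam U x) - (y - prox lam U y)))\<^sup>2
    \<le> ((x - prox lam U x) - (y - prox lam U y)) \<bullet> (x - y)"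
proof -
  define p q where "p = prox lam U x" and "q = prox lam U y"
  define D where "D = (x - p) - (y - q)"
  have "U p + (x - p) \<bullet> (q - p) / lam \<le> U q" "U q + (y - q) \<bullet> (p - q) / lam \<le> U p"
    using prox_subgradient[OF assms refl, of x q] prox_subgradient[OF assms refl, of y p] by (auto simp: p_def q_def)
  then have "((x - p) \<bullet> (q - p) + (y - q) \<bullet> (p - q)) / lam \<le> 0"
    by (simp add: add_divide_distrib)
  then have "(x - p) \<bullet> (q - p) + (y - q) \<bullet> (p - q) \<le> 0"
    using lam by (simp add: divide_le_0_iff)
  moreover have "(x - p) \<bullet> (q - p) + (y - q) \<bullet> (p - q) = - (D \<bullet> (p - q))"
    unfolding D_def by (simp add: inner_diff_left inner_diff_right)
  moreover have "D \<bullet> (x - y) = D \<bullet> D + D \<bullet> (p - q)"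
    unfolding inner_add_right[symmetric] by (simp add: D_def)
  ultimately show ?thesis
    by (simp add: D_def p_def q_def power2_norm_eq_inner)
qed

text \<open>The subgradient inequality is tested at \<open>z = x\<close>, where the Lipschitz bound
  on \<open>U\<close> lets one factor \<open>norm (x - p)\<close> cancel. Being linear in
  \<open>lam\<close>, the displacement contributes a force bounded by \<open>M\<close> whatever the
  step size.\<close>

lemma prox_dist:
  fixes U :: "'d::euclidean_space \<Rightarrow> real"
  assumes lam: "lam > 0" and nonneg: "\<And>x. U x \<ge> 0" and cv: "convex_on UNIV U"
    and lip: "\<And>x y. \<bar>U x - U y\<bar> \<le> M * norm (x - y)" and cont: "continuous_on UNIV U"
  shows "norm (x - prox lam U x) \<le> lam * M"
proof -
  define p where "p = prox lam U x"
  have "U p + (x - p) \<bullet> (x - p) / lam \<le> U x"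
    unfolding p_def by (rule prox_subgradient[OF lam nonneg cont cv refl])
  then have "(norm (x - p))\<^sup>2 / lam \<le> M * norm (x - p)"
    using lip[of x p] by (simp add: power2_norm_eq_inner)
  then have "norm (x - p) * norm (x - p) \<le> (lam * M) * norm (x - p)"
    using lam by (simp add: field_simps power2_eq_square)
  \<comment> \<open>Settles the case \<open>x = p\<close>; the sign of \<open>M\<close> is read off
    from the Lipschitz bound at a unit vector.\<close>
  moreover have "0 \<le> lam * M"
  proof -
    obtain b :: 'd where "b \<in> Basis" using nonempty_Basis by blast
    then show ?thesis using lip[of b 0] lam by simp
  qed
  ultimately show ?thesis
    unfolding p_def[symmetric] by (cases "x = p") (simp_all add: mult_le_cancel_right)
qed

section \<open>The mean of one MYULA step\<close>

definition myula_mean :: "('d::euclidean_space \<Rightarrow> 'd) \<Rightarrow> ('d \<Rightarrow> real) \<Rightarrow> real \<Rightarrow> real \<Rightarrow> 'd \<Rightarrow> 'd" where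
  "myula_mean gV U kappa gamma x =
     x - gamma *\<^sub>R gV x - (1 / kappa) *\<^sub>R (x - prox (gamma * kappa) U x)"

text \<open>Both increments are cocoercive, with constants adding up to at most two.\<close>
lemma nonexpansive_step:
  fixes a b d :: "'d::real_inner"
  assumes a: "(norm a)\<^sup>2 \<le> l * (a \<bullet> d)" and b: "(norm b)\<^sup>2 \<le> k * (b \<bullet> d)"
    and pos: "0 \<le> a \<bullet> d" "0 \<le> b \<bullet> d" and lk: "l \<ge> 0" "k \<ge> 0" "l + k \<le> 2"
  shows "norm (d - a - b) \<le> norm d"
proof -
  define A B where "A = a \<bullet> d" and "B = b \<bullet> d"
  \<comment> \<open>Bounding the cross term this way shows that cocoercivity constants add:
    \<open>a + b\<close> satisfies the hypothesis with \<open>l + k\<close>. A cocoercivity constant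
    of at most 2 is exactly what makes the expansion of \<open>(norm (d - a - b))\<^sup>2\<close>
    stay below \<open>(norm d)\<^sup>2\<close>.\<close>
  have "2 * (a \<bullet> b) \<le> l * B + k * A"
  proof (rule power2_le_imp_le)
    have "(2 * (a \<bullet> b))\<^sup>2 \<le> 4 * ((norm a)\<^sup>2 * (norm b)\<^sup>2)"
      using Cauchy_Schwarz_ineq[of a b] by (simp add: power2_norm_eq_inner power_mult_distrib)
    also have "\<dots> \<le> 4 * ((l * A) * (k * B))"
      using a b pos lk by (intro mult_left_mono mult_mono) (auto simp: A_def B_def)
    also have "\<dots> \<le> (l * B + k * A)\<^sup>2"
      using zero_le_power2[of "l * B - k * A"] by (simp add: power2_eq_square algebra_simps)
    finally show "(2 * (a \<bullet> b))\<^sup>2 \<le> (l * B + k * A)\<^sup>2" .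
    show "0 \<le> l * B + k * A" using pos lk by (simp add: A_def B_def)
  qed
  then have "(norm (a + b))\<^sup>2 \<le> (l + k) * (A + B)"
    using a b by (simp add: A_def B_def power2_norm_eq_inner inner_add_left inner_add_right inner_commute algebra_simps)
  also have "\<dots> \<le> 2 * (A + B)"
    using pos lk by (intro mult_right_mono) (auto simp: A_def B_def)
  finally have "(norm (d - a - b))\<^sup>2 \<le> (norm d)\<^sup>2"
    by (simp add: A_def B_def power2_norm_eq_inner inner_simps inner_commute algebra_simps)
  then show ?thesis by (rule power2_le_imp_le) simp
qed

text \<open>One pair of potentials at a fixed parameter. \<open>L\<close>, \<open>M\<close>,
  \<open>R1\<close> and \<open>u0\<close> will be common to all parameters and to both families, so
  every estimate in terms of them is uniform.\<close>

locale myula_potential =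
  fixes V U :: "'d::euclidean_space \<Rightarrow> real" and gV :: "'d \<Rightarrow> 'd" and L M R1 u0 :: real
  assumes convex_V: "convex_on UNIV V" and convex_U: "convex_on UNIV U"
    and nonneg_U: "U x \<ge> 0"
    and grad: "(V has_derivative (\<lambda>h. gV x \<bullet> h)) (at x)"
    and L_nonneg: "L \<ge> 0" and M_nonneg: "M \<ge> 0" and R1_nonneg: "R1 \<ge> 0"
    and lip_V: "norm (gV x - gV y) \<le> L * norm (x - y)"
    and lip_U: "\<bar>U x - U y\<bar> \<le> M * norm (x - y)"
    and min_V: "\<exists>xs. (\<forall>z. V xs \<le> V z) \<and> norm xs \<le> R1"
    and U_0: "U 0 \<le> u0"
begin

lemma cont_U: "continuous_on UNIV U"
proof (rule continuous_at_imp_continuous_on, rule ballI)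
  fix x
  have "((\<lambda>y. U y) \<longlongrightarrow> U x) (at x)"
  proof (rule Lim_transform_bound[where g="\<lambda>y. M * norm (y - x)", THEN LIM_zero_cancel])
    show "\<forall>\<^sub>F y in at x. norm (U y - U x) \<le> norm (M * norm (y - x))"
      using lip_U by (intro always_eventually) (auto intro: order_trans[OF _ abs_ge_self])
    show "((\<lambda>y. M * norm (y - x)) \<longlongrightarrow> 0) (at x)"
      by (auto intro!: tendsto_eq_intros)
  qed
  then show "isCont U x" by (simp add: isCont_def)
qed

text \<open>The gradient increment is cocoercive with constant \<open>\<gamma> * L\<close> by
  Baillon-Haddad, the proximal one with constant \<open>1 / \<kappa>\<close> by firm
  nonexpansiveness, and \<open>nonexpansive_step\<close> combines them.\<close>

lemma nonexpansive:
  assumes "\<gamma> > 0" "\<kappa> > 0" "\<gamma> * L + 1 / \<kappa> \<le> 2"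
  shows "norm (myula_mean gV U \<kappa> \<gamma> x - myula_mean gV U \<kappa> \<gamma> y) \<le> norm (x - y)"
proof -
  define D where "D = (x - prox (\<gamma> * \<kappa>) U x) - (y - prox (\<gamma> * \<kappa>) U y)"
  have lam: "\<gamma> * \<kappa> > 0" using assms by simp
  have D: "(norm D)\<^sup>2 \<le> D \<bullet> (x - y)"
    unfolding D_def by (rule prox_firm[OF lam nonneg_U cont_U convex_U])
  have G: "(norm (gV x - gV y))\<^sup>2 \<le> L * ((gV x - gV y) \<bullet> (x - y))"
    by (rule grad_cocoercive[OF grad lip_V L_nonneg convex_V])
  have G0: "0 \<le> (gV x - gV y) \<bullet> (x - y)"
    using mconvex_grad_mono[OF grad mconvex_0[OF convex_V], of x y] by simp
  have "norm ((x - y) - \<gamma> *\<^sub>R (gV x - gV y) - (1 / \<kappa>) *\<^sub>R D) \<le> norm (x - y)"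
  proof (rule nonexpansive_step[where l="\<gamma> * L" and k="1 / \<kappa>"])
    have "\<gamma>\<^sup>2 * (norm (gV x - gV y))\<^sup>2 \<le> \<gamma>\<^sup>2 * (L * ((gV x - gV y) \<bullet> (x - y)))"
      using G by (rule mult_left_mono) simp
    then show "(norm (\<gamma> *\<^sub>R (gV x - gV y)))\<^sup>2 \<le> \<gamma> * L * (\<gamma> *\<^sub>R (gV x - gV y) \<bullet> (x - y))"
      by (simp add: power_mult_distrib power2_eq_square mult_ac)
    have "(1 / \<kappa>)\<^sup>2 * (norm D)\<^sup>2 \<le> (1 / \<kappa>)\<^sup>2 * (D \<bullet> (x - y))"
      using D by (rule mult_left_mono) simp
    then show "(norm ((1 / \<kappa>) *\<^sub>R D))\<^sup>2 \<le> 1 / \<kappa> * ((1 / \<kappa>) *\<^sub>R D \<bullet> (x - y))"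
      by (simp add: power_divide power2_eq_square mult_ac)
    show "0 \<le> \<gamma> *\<^sub>R (gV x - gV y) \<bullet> (x - y)" using G0 assms by simp
    show "0 \<le> (1 / \<kappa>) *\<^sub>R D \<bullet> (x - y)" using order_trans[OF zero_le_power2 D] assms by simp
  qed (use assms L_nonneg in auto)
  moreover have "(x - y) - \<gamma> *\<^sub>R (gV x - gV y) - (1 / \<kappa>) *\<^sub>R D
      = myula_mean gV U \<kappa> \<gamma> x - myula_mean gV U \<kappa> \<gamma> y"
    by (simp add: myula_mean_def D_def algebra_simps)
  ultimately show ?thesis by simp
qed

text \<open>Common part of the two growth estimates; \<open>h\<close> is the dissipation caused by \<open>V\<close>, and \<open>g\<close> is the
  gradient of the Moreau--Yosida envelope of \<open>U\<close>, a subgradient of \<open>U\<close> at the proximal point \<open>p\<close>.\<close>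
lemma mean_norm:
  assumes gam: "0 < \<gamma>" "\<gamma> \<le> gb" and kap: "\<kappa> > 0" and gL: "\<gamma> * L \<le> 1"
  obtains xs h p g where
    "norm xs \<le> R1" "\<And>m. mconvex m V \<Longrightarrow> m * (norm (x - xs))\<^sup>2 \<le> h"
    "(norm (myula_mean gV U \<kappa> \<gamma> x))\<^sup>2
      \<le> (norm x)\<^sup>2 + \<gamma> * (- 2 * (x \<bullet> g) - h / 2 + 2 * (R1 + gb * M)\<^sup>2 * L + gb * M\<^sup>2)"
    "norm g \<le> M" "norm (x - p) \<le> \<gamma> * \<kappa> * M" "U p - U 0 \<le> x \<bullet> g" "0 \<le> h"
proof -
  obtain xs where xs: "\<And>z. V xs \<le> V z" "norm xs \<le> R1" using min_V by blast
  have "(\<lambda>h. gV xs \<bullet> h) = (\<lambda>h. 0)"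
    by (rule differential_zero_maxmin[OF _ open_UNIV grad]) (use xs in auto)
  then have g0: "gV xs = 0" by (metis inner_eq_zero_iff)
  have lam: "\<gamma> * \<kappa> > 0" using gam kap by simp
  define p where "p = prox (\<gamma> * \<kappa>) U x"
  define g where "g = (1 / (\<gamma> * \<kappa>)) *\<^sub>R (x - p)"
  define G where "G = gV x"
  define h where "h = G \<bullet> (x - xs)"
  have xp: "norm (x - p) \<le> \<gamma> * \<kappa> * M"
    unfolding p_def by (rule prox_dist[OF lam nonneg_U convex_U lip_U cont_U])
  have "norm g = norm (x - p) / (\<gamma> * \<kappa>)"
    using lam unfolding g_def norm_scaleR by simp
  then have gM: "norm g \<le> M"
    using xp lam by (simp add: pos_divide_le_eq mult.commute)
  have "U p + (x - p) \<bullet> (0 - p) / (\<gamma> * \<kappa>) \<le> U 0"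
    unfolding p_def by (rule prox_subgradient[OF lam nonneg_U cont_U convex_U refl])
  moreover have "(x - p) \<bullet> (0 - p) / (\<gamma> * \<kappa>) = - (g \<bullet> p)"
    by (simp add: g_def)
  moreover have "x \<bullet> g = g \<bullet> p + (norm (x - p))\<^sup>2 / (\<gamma> * \<kappa>)"
    by (simp add: g_def inner_commute power2_norm_eq_inner inner_diff_right inner_diff_left diff_divide_distrib add_divide_distrib)
  moreover have "(norm (x - p))\<^sup>2 / (\<gamma> * \<kappa>) \<ge> 0" using lam by simp
  ultimately have Up: "U p - U 0 \<le> x \<bullet> g" by linarith
  have hm: "m * (norm (x - xs))\<^sup>2 \<le> h" if "mconvex m V" for m
    using mconvex_grad_mono[OF grad that, of x xs] g0 by (simp add: h_def G_def)
  have h0: "0 \<le> h" using hm[OF mconvex_0[OF convex_V]] by simp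
  have Gh: "(norm G)\<^sup>2 \<le> L * h"
    using grad_cocoercive[OF grad lip_V L_nonneg convex_V, of x xs] g0 by (simp add: h_def G_def)
  \<comment> \<open>Collects the two sources of terms linear in \<open>norm G\<close>:
    \<open>R1\<close> from replacing the base point 0 by the minimiser \<open>xs\<close>, and
    \<open>gb * M\<close> from the cross term of \<open>(norm (G + g))\<^sup>2\<close>.
    Cocoercivity, in the form \<open>Gh\<close>, absorbs them into \<open>h / 2\<close> in
    \<open>BG\<close>.\<close>
  define Bd where "Bd = R1 + gb * M"
  have gb: "gb \<ge> 0" using gam by simp
  have Bd0: "Bd \<ge> 0" using R1_nonneg M_nonneg gb by (simp add: Bd_def)
  have BG: "2 * Bd * norm G \<le> h / 2 + 2 * Bd\<^sup>2 * L"
  proof (rule power2_le_imp_le)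
    have "(2 * Bd * norm G)\<^sup>2 \<le> 4 * Bd\<^sup>2 * (L * h)"
      using mult_left_mono[OF Gh, of "4 * Bd\<^sup>2"] by (simp add: power_mult_distrib)
    also have "\<dots> \<le> (h / 2 + 2 * Bd\<^sup>2 * L)\<^sup>2"
      using zero_le_power2[of "h / 2 - 2 * Bd\<^sup>2 * L"] by (simp add: power2_eq_square algebra_simps)
    finally show "(2 * Bd * norm G)\<^sup>2 \<le> (h / 2 + 2 * Bd\<^sup>2 * L)\<^sup>2" .
    show "0 \<le> h / 2 + 2 * Bd\<^sup>2 * L" using h0 L_nonneg by simp
  qed
  have mean: "myula_mean gV U \<kappa> \<gamma> x = x - \<gamma> *\<^sub>R (G + g)"
    using gam kap by (simp add: myula_mean_def G_def g_def p_def scaleR_add_right)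
  have "(norm (myula_mean gV U \<kappa> \<gamma> x))\<^sup>2
      = (norm x)\<^sup>2 + \<gamma> * (- 2 * (x \<bullet> G) - 2 * (x \<bullet> g) + \<gamma> * (norm (G + g))\<^sup>2)"
    unfolding mean power2_norm_eq_inner
    by (simp add: inner_diff_left inner_diff_right inner_add_left inner_add_right inner_commute algebra_simps)
  \<comment> \<open>Budget: the inner product with \<open>G\<close> supplies \<open>- 2 * h\<close>;
    one \<open>h\<close> pays for \<open>\<gamma> * (norm G)\<^sup>2\<close> because
    \<open>\<gamma> * L\<close> is at most 1, another \<open>h / 2\<close> for the linear terms, and
    \<open>- h / 2\<close> is left.\<close>
  moreover have "- 2 * (x \<bullet> G) - 2 * (x \<bullet> g) + \<gamma> * (norm (G + g))\<^sup>2
      \<le> - 2 * (x \<bullet> g) - h / 2 + 2 * Bd\<^sup>2 * L + gb * M\<^sup>2"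
  proof -
    have "\<bar>G \<bullet> xs\<bar> \<le> norm G * norm xs" by (rule Cauchy_Schwarz_ineq2)
    also have "\<dots> \<le> norm G * R1" using xs by (intro mult_left_mono) auto
    finally have 1: "- (x \<bullet> G) \<le> - h + R1 * norm G"
      by (simp add: h_def inner_diff_right inner_commute mult.commute)
    have "(norm (G + g))\<^sup>2 \<le> (norm G + M)\<^sup>2"
      using norm_triangle_ineq[of G g] gM by (intro power_mono) auto
    then have "\<gamma> * (norm (G + g))\<^sup>2 \<le> \<gamma> * (norm G + M)\<^sup>2"
      using gam by (intro mult_left_mono) auto
    also have "\<dots> = \<gamma> * (norm G)\<^sup>2 + \<gamma> * (2 * M * norm G + M\<^sup>2)"
      by (simp add: power2_eq_square algebra_simps)
    also have "\<dots> \<le> h + gb * (2 * M * norm G + M\<^sup>2)"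
    proof (rule add_mono)
      have "\<gamma> * (norm G)\<^sup>2 \<le> \<gamma> * (L * h)" using Gh gam by (intro mult_left_mono) auto
      also have "\<dots> \<le> 1 * h" unfolding mult.assoc[symmetric] using gL h0 by (intro mult_right_mono) auto
      finally show "\<gamma> * (norm G)\<^sup>2 \<le> h" by simp
      show "\<gamma> * (2 * M * norm G + M\<^sup>2) \<le> gb * (2 * M * norm G + M\<^sup>2)"
        using gam M_nonneg by (intro mult_right_mono) auto
    qed
    finally have 2: "\<gamma> * (norm (G + g))\<^sup>2 \<le> h + gb * (2 * M * norm G + M\<^sup>2)" .
    have 3: "2 * Bd * norm G = 2 * R1 * norm G + gb * (2 * M * norm G)"
      by (simp add: Bd_def algebra_simps)
    show ?thesis using 1 2 3 BG by (simp add: distrib_left)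
  qed
  ultimately have "(norm (myula_mean gV U \<kappa> \<gamma> x))\<^sup>2
      \<le> (norm x)\<^sup>2 + \<gamma> * (- 2 * (x \<bullet> g) - h / 2 + 2 * (R1 + gb * M)\<^sup>2 * L + gb * M\<^sup>2)"
    using gam unfolding Bd_def by (simp add: mult_left_mono)
  then show thesis using that[OF xs(2) hm _ gM xp Up h0] by blast
qed

text \<open>Here the restoring force comes from \<open>U\<close>: by convexity
  \<open>x \<bullet> g\<close> is at least \<open>U p - U 0\<close>, growth of \<open>U\<close>
  bounds this below by a multiple of \<open>norm p\<close>, and \<open>p\<close> stays within
  \<open>gb * kh * M\<close> of \<open>x\<close>. The dissipation \<open>h\<close> is merely
  nonnegative and is dropped.\<close>

lemma growth_linear:
  assumes gam: "0 < \<gamma>" "\<gamma> \<le> gb" and kap: "\<kappa> > 0" "\<kappa> \<le> kh" and gL: "\<gamma> * L \<le> 1"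
    and eta: "\<eta> > 0" "\<And>x. U x \<ge> \<eta> * norm x - c"
  shows "(norm (myula_mean gV U \<kappa> \<gamma> x))\<^sup>2 \<le> (norm x)\<^sup>2 - 2 * \<gamma> * \<eta> * norm x
    + \<gamma> * (2 * (\<eta> * (gb * kh * M) + \<bar>c\<bar> + u0) + 2 * (R1 + gb * M)\<^sup>2 * L + gb * M\<^sup>2)"
proof -
  obtain xs h p g where *: 
    "(norm (myula_mean gV U \<kappa> \<gamma> x))\<^sup>2
      \<le> (norm x)\<^sup>2 + \<gamma> * (- 2 * (x \<bullet> g) - h / 2 + 2 * (R1 + gb * M)\<^sup>2 * L + gb * M\<^sup>2)"
    "norm (x - p) \<le> \<gamma> * \<kappa> * M" "U p - U 0 \<le> x \<bullet> g" "0 \<le> h"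
    using mean_norm[OF gam kap(1) gL] by metis
  have "\<gamma> * \<kappa> * M \<le> gb * kh * M"
    using gam kap M_nonneg by (intro mult_right_mono mult_mono) auto
  then have "norm x - gb * kh * M \<le> norm p"
    using *(2) norm_triangle_ineq2[of x p] by linarith
  then have "\<eta> * (norm x - gb * kh * M) \<le> \<eta> * norm p" using eta by (intro mult_left_mono) auto
  then have "\<eta> * norm x - (\<eta> * (gb * kh * M) + \<bar>c\<bar> + u0) \<le> x \<bullet> g"
    using eta(2)[of p] *(3) U_0 by (simp add: right_diff_distrib)
  then have "- 2 * (x \<bullet> g) - h / 2 + 2 * (R1 + gb * M)\<^sup>2 * L + gb * M\<^sup>2 \<le> - 2 * (\<eta> * norm x)
    + (2 * (\<eta> * (gb * kh * M) + \<bar>c\<bar> + u0) + 2 * (R1 + gb * M)\<^sup>2 * L + gb * M\<^sup>2)"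
    using *(4) by (simp add: algebra_simps)
  from mult_left_mono[OF this, of \<gamma>] gam *(1)
  have "(norm (myula_mean gV U \<kappa> \<gamma> x))\<^sup>2 \<le> (norm x)\<^sup>2 + \<gamma> * (- 2 * (\<eta> * norm x)
    + (2 * (\<eta> * (gb * kh * M) + \<bar>c\<bar> + u0) + 2 * (R1 + gb * M)\<^sup>2 * L + gb * M\<^sup>2))"
    by linarith
  then show ?thesis by (subst (asm) distrib_left) (simp add: mult_ac)
qed

text \<open>Here the restoring force comes from \<open>V\<close>: \<open>h / 2\<close> supplies
  \<open>m / 4\<close> times the squared norm, up to a constant from moving the centre to
  \<open>xs\<close>. The bounded force \<open>g\<close> is absorbed by Young's inequality at the
  price of half of it, leaving \<open>m / 8\<close>.\<close>

lemma growth_quadratic: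
  assumes gam: "0 < \<gamma>" "\<gamma> \<le> gb" and kap: "\<kappa> > 0" and gL: "\<gamma> * L \<le> 1"
    and m: "m > 0" "mconvex m V"
  shows "(norm (myula_mean gV U \<kappa> \<gamma> x))\<^sup>2 \<le> (1 - m / 8 * \<gamma>) * (norm x)\<^sup>2
    + \<gamma> * (8 * M\<^sup>2 / m + m * R1\<^sup>2 / 2 + 2 * (R1 + gb * M)\<^sup>2 * L + gb * M\<^sup>2)"
proof -
  obtain xs h p g where *: "norm xs \<le> R1" "\<And>m. mconvex m V \<Longrightarrow> m * (norm (x - xs))\<^sup>2 \<le> h"
    "(norm (myula_mean gV U \<kappa> \<gamma> x))\<^sup>2
      \<le> (norm x)\<^sup>2 + \<gamma> * (- 2 * (x \<bullet> g) - h / 2 + 2 * (R1 + gb * M)\<^sup>2 * L + gb * M\<^sup>2)"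
    "norm g \<le> M"
    using mean_norm[OF gam kap(1) gL] by metis
  have "\<bar>x \<bullet> g\<bar> \<le> norm x * norm g" by (rule Cauchy_Schwarz_ineq2)
  also have "\<dots> \<le> norm x * M" using * by (intro mult_left_mono) auto
  finally have 1: "- 2 * (x \<bullet> g) \<le> 2 * M * norm x" by (simp add: mult.commute)
  have 2: "2 * M * norm x \<le> m / 8 * (norm x)\<^sup>2 + 8 * M\<^sup>2 / m"
  proof -
    have "0 \<le> (m * norm x - 8 * M)\<^sup>2" by simp
    then have "16 * m * M * norm x \<le> m\<^sup>2 * (norm x)\<^sup>2 + 64 * M\<^sup>2"
      by (simp add: power2_eq_square algebra_simps)
    then show ?thesis using m by (simp add: field_simps power2_eq_square)
  qed
  have "(norm x)\<^sup>2 \<le> (norm (x - xs) + R1)\<^sup>2"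
    using *(1) norm_triangle_sub[of x xs] by (intro power_mono) auto
  also have "\<dots> \<le> 2 * (norm (x - xs))\<^sup>2 + 2 * R1\<^sup>2"
    using zero_le_power2[of "norm (x - xs) - R1"] by (simp add: power2_eq_square algebra_simps)
  finally have "m * (norm x)\<^sup>2 \<le> 2 * h + m * (2 * R1\<^sup>2)"
    using *(2)[OF m(2)] mult_left_mono[of "(norm x)\<^sup>2" "2 * (norm (x - xs))\<^sup>2 + 2 * R1\<^sup>2" m] m(1)
    by (simp add: distrib_left)
  then have "- 2 * (x \<bullet> g) - h / 2 + 2 * (R1 + gb * M)\<^sup>2 * L + gb * M\<^sup>2 \<le> - (m / 8) * (norm x)\<^sup>2
    + (8 * M\<^sup>2 / m + m * R1\<^sup>2 / 2 + 2 * (R1 + gb * M)\<^sup>2 * L + gb * M\<^sup>2)"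
    using 1 2 by simp
  from mult_left_mono[OF this, of \<gamma>] gam *(3)
  have "(norm (myula_mean gV U \<kappa> \<gamma> x))\<^sup>2 \<le> (norm x)\<^sup>2 + \<gamma> * (- (m / 8) * (norm x)\<^sup>2
    + (8 * M\<^sup>2 / m + m * R1\<^sup>2 / 2 + 2 * (R1 + gb * M)\<^sup>2 * L + gb * M\<^sup>2))"
    by linarith
  also have "\<dots> = (1 - m / 8 * \<gamma>) * (norm x)\<^sup>2
    + \<gamma> * (8 * M\<^sup>2 / m + m * R1\<^sup>2 / 2 + 2 * (R1 + gb * M)\<^sup>2 * L + gb * M\<^sup>2)"
    by (subst distrib_left) (simp add: algebra_simps)
  finally show ?thesis .
qed

end

subsection \<open>Markov kernels and weighted contraction\<close>

text \<open>Test functions are kept bounded so that all integrals exist and operators are linear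
  without side conditions; \<open>wnorm\<close> takes its supremum over such functions as
  well.\<close>

definition bmf :: "('d::euclidean_space \<Rightarrow> real) set" where
  "bmf = {f. f \<in> borel_measurable borel \<and> bounded (range f)}"

lemma bmfI: "f \<in> borel_measurable borel \<Longrightarrow> (\<And>x. \<bar>f x\<bar> \<le> B) \<Longrightarrow> f \<in> bmf"
  by (auto simp: bmf_def bounded_iff)

lemma bmf_bound:
  assumes "f \<in> bmf" obtains B where "B \<ge> 0" "\<And>x. \<bar>f x\<bar> \<le> B"
proof -
  obtain B where "\<And>x. \<bar>f x\<bar> \<le> B" using assms by (auto simp: bmf_def bounded_iff)
  then show ?thesis using that[of B] abs_ge_zero order_trans by blast
qed

lemma bmf_const [simp]: "(\<lambda>_. c) \<in> bmf"
  by (rule bmfI[where B="\<bar>c\<bar>"]) auto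

lemma bmf_add: assumes "f \<in> bmf" "g \<in> bmf" shows "(\<lambda>x. f x + g x) \<in> bmf"
proof -
  obtain B C where B: "\<And>x. \<bar>f x\<bar> \<le> B" and C: "\<And>x. \<bar>g x\<bar> \<le> C" using assms by (metis bmf_bound)
  have "\<bar>f x + g x\<bar> \<le> B + C" for x using B[of x] C[of x] by linarith
  then show ?thesis using assms by (intro bmfI[where B="B + C"]) (auto simp: bmf_def)
qed

lemma bmf_cmult: assumes "f \<in> bmf" shows "(\<lambda>x. c * f x) \<in> bmf"
proof -
  obtain B where B: "\<And>x. \<bar>f x\<bar> \<le> B" using assms by (metis bmf_bound)
  have "\<bar>c * f x\<bar> \<le> \<bar>c\<bar> * B" for x using B[of x] by (simp add: abs_mult mult_left_mono)
  then show ?thesis using assms by (intro bmfI[where B="\<bar>c\<bar> * B"]) (auto simp: bmf_def)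
qed

lemma bmf_diff: "f \<in> bmf \<Longrightarrow> g \<in> bmf \<Longrightarrow> (\<lambda>x. f x - g x) \<in> bmf"
  using bmf_add[of f "\<lambda>x. -1 * g x"] bmf_cmult[of g "-1"] by simp

lemma bmf_exp: assumes "f \<in> bmf" shows "(\<lambda>x. exp (f x)) \<in> bmf"
proof -
  obtain B where B: "\<And>x. \<bar>f x\<bar> \<le> B" using assms by (metis bmf_bound)
  have "\<bar>exp (f x)\<bar> \<le> exp B" for x using B[of x] by simp
  then show ?thesis using assms by (intro bmfI[where B="exp B"]) (auto simp: bmf_def)
qed

lemma bmf_integrable:
  assumes "prob_space M" "sets M = sets borel" "f \<in> bmf"
  shows "integrable M f"
proof -
  interpret prob_space M by fact
  obtain B where "\<And>x. \<bar>f x\<bar> \<le> B" using assms by (metis bmf_bound)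
  moreover have "f \<in> borel_measurable M"
    using assms(3) by (simp add: measurable_cong_sets[OF assms(2) refl] bmf_def)
  ultimately show ?thesis by (intro integrable_const_bound[where B=B]) auto
qed

text \<open>Bridge between the two integrals: the drift controls the possibly unbounded
  \<open>W\<close> through the nonnegative integral, while test functions are integrated in the
  Bochner sense.\<close>

lemma integral_le_of_nn_drift:
  assumes M: "prob_space M" "sets M = sets borel" and f: "f \<in> bmf"
    and W[measurable]: "W \<in> borel_measurable borel" and W0: "\<And>x. W x \<ge> 0"
    and pq: "p \<ge> 0" "q \<ge> 0" and fW: "\<And>x. \<bar>f x\<bar> \<le> p * W x + q"
    and D: "D \<ge> 0" "(\<integral>\<^sup>+x. ennreal (W x) \<partial>M) \<le> ennreal D"
  shows "\<bar>\<integral>x. f x \<partial>M\<bar> \<le> p * D + q"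
proof -
  interpret prob_space M by fact
  note [measurable_cong] = M(2)
  have int: "integrable M f" by (rule bmf_integrable[OF M f])
  have "ennreal (\<integral>x. \<bar>f x\<bar> \<partial>M) = (\<integral>\<^sup>+x. ennreal \<bar>f x\<bar> \<partial>M)"
    using int by (subst nn_integral_eq_integral) auto
  also have "\<dots> \<le> (\<integral>\<^sup>+x. ennreal p * ennreal (W x) + ennreal q \<partial>M)"
    using fW W0 pq by (intro nn_integral_mono) (auto simp: ennreal_mult[symmetric] ennreal_plus[symmetric] intro!: ennreal_leI simp del: ennreal_plus)
  also have "\<dots> = ennreal p * (\<integral>\<^sup>+x. ennreal (W x) \<partial>M) + ennreal q"
    by (subst nn_integral_add) (auto simp: nn_integral_cmult emeasure_space_1)
  also have "\<dots> \<le> ennreal p * ennreal D + ennreal q"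
    using D by (intro add_right_mono mult_left_mono) auto
  also have "\<dots> = ennreal (p * D + q)"
    using pq D by (simp add: ennreal_mult)
  finally have "(\<integral>x. \<bar>f x\<bar> \<partial>M) \<le> p * D + q"
    using pq D by (subst (asm) ennreal_le_iff) auto
  then show ?thesis using integral_abs_bound[of M f] by linarith
qed

section \<open>Markov operators on bounded functions\<close>

definition kop :: "('d::euclidean_space \<Rightarrow> 'd measure) \<Rightarrow> ('d \<Rightarrow> real) \<Rightarrow> 'd \<Rightarrow> real" where
  "kop K f x = (\<integral>y. f y \<partial>K x)"

locale markov_kernel =
  fixes K :: "'d::euclidean_space \<Rightarrow> 'd measure"
  assumes K_measurable [measurable]: "K \<in> measurable borel (subprob_algebra borel)"
    and K_prob: "prob_space (K x)"
begin

lemma sets_K [simp]: "sets (K x) = sets borel"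
  using sets_kernel[OF K_measurable] by simp

lemma K_integrable: "f \<in> bmf \<Longrightarrow> integrable (K x) f"
  by (rule bmf_integrable[OF K_prob sets_K])

lemma K_UNIV: "measure (K x) UNIV = 1"
  using prob_space.prob_space[OF K_prob, of x] sets_eq_imp_space_eq[OF sets_K, of x] by simp

lemma kop_const [simp]: "kop K (\<lambda>_. c) = (\<lambda>_. c)"
  using sets_eq_imp_space_eq[OF sets_K] by (auto simp: kop_def K_UNIV)

lemma kop_add: "f \<in> bmf \<Longrightarrow> g \<in> bmf \<Longrightarrow> kop K (\<lambda>x. f x + g x) x = kop K f x + kop K g x"
  by (simp add: kop_def K_integrable)

lemma kop_diff: "f \<in> bmf \<Longrightarrow> g \<in> bmf \<Longrightarrow> kop K (\<lambda>x. f x - g x) x = kop K f x - kop K g x"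
  by (simp add: kop_def K_integrable)

lemma kop_cmult: "kop K (\<lambda>x. c * f x) x = c * kop K f x"
  by (simp add: kop_def)

lemma kop_mono: "f \<in> bmf \<Longrightarrow> g \<in> bmf \<Longrightarrow> (\<And>x. f x \<le> g x) \<Longrightarrow> kop K f x \<le> kop K g x"
  unfolding kop_def by (intro integral_mono K_integrable) auto

lemma kop_bmf:
  assumes "f \<in> bmf" shows "kop K f \<in> bmf"
proof -
  obtain B where B: "\<And>x. \<bar>f x\<bar> \<le> B" using assms by (metis bmf_bound)
  have "f x \<le> B" "- B \<le> f x" for x using B[of x] by linarith+
  then have "kop K f x \<le> kop K (\<lambda>_. B) x" "kop K (\<lambda>_. - B) x \<le> kop K f x" for x
    using assms by (auto intro!: kop_mono simp del: kop_const)
  then have "\<bar>kop K f x\<bar> \<le> B" for x by (simp add: abs_le_iff minus_le_iff)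
  moreover have "kop K f \<in> borel_measurable borel"
    unfolding kop_def using assms
    by (intro measurable_compose[OF K_measurable integral_measurable_subprob_algebra]) (auto simp: bmf_def)
  ultimately show ?thesis by (intro bmfI)
qed

lemma kop_pow_bmf: "f \<in> bmf \<Longrightarrow> (kop K ^^ n) f \<in> bmf"
  by (induction n) (auto intro: kop_bmf)

lemma kop_pow_const [simp]: "(kop K ^^ n) (\<lambda>_. c) = (\<lambda>_. c)"
  by (induction n) auto

lemma kop_pow_add:
  "f \<in> bmf \<Longrightarrow> g \<in> bmf \<Longrightarrow> (kop K ^^ n) (\<lambda>x. f x + g x) = (\<lambda>x. (kop K ^^ n) f x + (kop K ^^ n) g x)"
  by (induction n) (auto simp: kop_add kop_pow_bmf)

lemma kop_pow_cmult: "(kop K ^^ n) (\<lambda>x. c * f x) = (\<lambda>x. c * (kop K ^^ n) f x)"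
  by (induction n) (auto simp: kop_cmult)

lemma kop_pow_diff:
  "f \<in> bmf \<Longrightarrow> g \<in> bmf \<Longrightarrow> (kop K ^^ n) (\<lambda>x. f x - g x) = (\<lambda>x. (kop K ^^ n) f x - (kop K ^^ n) g x)"
  by (induction n) (auto simp: kop_diff kop_pow_bmf)

lemma kop_pow_mono:
  "f \<in> bmf \<Longrightarrow> g \<in> bmf \<Longrightarrow> (\<And>x. f x \<le> g x) \<Longrightarrow> (kop K ^^ n) f x \<le> (kop K ^^ n) g x"
  by (induction n arbitrary: x) (auto intro!: kop_mono kop_pow_bmf)

lemma prob_bind:
  assumes "prob_space \<mu>" "sets \<mu> = sets borel"
  shows "prob_space (bind \<mu> K)" "sets (bind \<mu> K) = sets borel"
    "f \<in> bmf \<Longrightarrow> (\<integral>x. f x \<partial>bind \<mu> K) = (\<integral>x. kop K f x \<partial>\<mu>)"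
proof -
  interpret prob_space \<mu> by fact
  have sp: "space \<mu> = UNIV" using sets_eq_imp_space_eq[OF assms(2)] by simp
  have K: "K \<in> measurable \<mu> (subprob_algebra borel)"
    by (simp add: measurable_cong_sets[OF assms(2) refl])
  show "prob_space (bind \<mu> K)" by (rule prob_space_bind[OF _ K]) (simp add: K_prob)
  show "sets (bind \<mu> K) = sets borel" by (rule sets_bind) (auto simp: sp)
  assume f: "f \<in> bmf"
  obtain B where B: "\<And>x. \<bar>f x\<bar> \<le> B" using f by (metis bmf_bound)
  show "(\<integral>x. f x \<partial>bind \<mu> K) = (\<integral>x. kop K f x \<partial>\<mu>)"
    unfolding kop_def
  proof (rule integral_bind[where K=borel and B=B and B'=1])
    show "AE x in \<mu>. emeasure (K x) (space (K x)) \<le> ennreal 1"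
      using prob_space.emeasure_space_1[OF K_prob] by simp
  qed (use f K sp in \<open>auto simp: bmf_def B finite_measure_axioms\<close>)
qed

lemma kiter_prob: "prob_space (kiter K n x)" and sets_kiter: "sets (kiter K n x) = sets borel"
proof -
  have "prob_space (kiter K n x) \<and> sets (kiter K n x) = sets borel"
  proof (induction n)
    case 0
    then show ?case by (simp add: kiter_def prob_space_return)
  next
    case (Suc n)
    then show ?case using prob_bind[of "kiter K n x"] by (simp add: kiter_def)
  qed
  then show "prob_space (kiter K n x)" "sets (kiter K n x) = sets borel" by auto
qed

text \<open>Duality between the evolution of laws and that of functions; it allows the ergodic
  estimates to be proved for powers of \<open>kop K\<close> alone.\<close>

lemma integral_kiter: "f \<in> bmf \<Longrightarrow> (\<integral>y. f y \<partial>kiter K n x) = (kop K ^^ n) f x"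
proof (induction n arbitrary: f)
  case 0
  then show ?case by (simp add: kiter_def integral_return bmf_def)
next
  case (Suc n)
  have "(\<integral>y. f y \<partial>kiter K (Suc n) x) = (\<integral>y. f y \<partial>bind (kiter K n x) K)" by (simp add: kiter_def)
  also have "\<dots> = (\<integral>y. kop K f y \<partial>kiter K n x)" by (rule prob_bind(3)[OF kiter_prob sets_kiter Suc.prems])
  also have "\<dots> = (kop K ^^ n) (kop K f) x" by (rule Suc.IH[OF kop_bmf[OF Suc.prems]])
  also have "\<dots> = (kop K ^^ Suc n) f x" by (simp add: funpow_swap1)
  finally show ?case .
qed

text \<open>Summing the one-step drift gives a geometric series with partial sums
  \<open>s * (1 - (1 - t) ^ n) / t\<close>. It is phrased for bounded functions dominated by
  \<open>p * W + q\<close> because \<open>W\<close> itself may be unbounded and so outside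
  \<open>bmf\<close>.\<close>

lemma drift_pow:
  assumes W[measurable]: "W \<in> borel_measurable borel" and W1: "\<And>x. W x \<ge> 0"
    and drift: "\<And>x. (\<integral>\<^sup>+y. ennreal (W y) \<partial>K x) \<le> ennreal ((1 - t) * W x + s)"
    and t: "0 < t" "t \<le> 1" and s: "s \<ge> 0"
    and f: "f \<in> bmf" "p \<ge> 0" "q \<ge> 0" "\<And>x. \<bar>f x\<bar> \<le> p * W x + q"
  shows "\<bar>(kop K ^^ n) f x\<bar> \<le> p * ((1 - t) ^ n * W x) + (p * (s / t) + q)"
proof -
  have "\<bar>(kop K ^^ n) f x\<bar> \<le> p * ((1 - t) ^ n * W x + s * (1 - (1 - t) ^ n) / t) + q"
  proof (induction n arbitrary: x)
    case (Suc n)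
    have "(1 - t) ^ n \<le> 1" using t by (intro power_le_one) auto
    then have q': "p * (s * (1 - (1 - t) ^ n) / t) + q \<ge> 0" using f t s by simp
    have "\<bar>(kop K ^^ Suc n) f x\<bar> = \<bar>\<integral>y. (kop K ^^ n) f y \<partial>K x\<bar>" by (simp add: kop_def)
    then have eq: "\<bar>(kop K ^^ Suc n) f x\<bar> = \<bar>\<integral>y. (kop K ^^ n) f y \<partial>K x\<bar>" .
    have W': "(1 - t) * W x + s \<ge> 0" using t s W1 by simp
    have "\<bar>\<integral>y. (kop K ^^ n) f y \<partial>K x\<bar> \<le> (p * (1 - t) ^ n) * ((1 - t) * W x + s) + (p * (s * (1 - (1 - t) ^ n) / t) + q)"
    proof (rule integral_le_of_nn_drift[OF K_prob sets_K kop_pow_bmf[OF f(1)] W W1 _ q' _ W' drift])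
      show "0 \<le> p * (1 - t) ^ n" using f t by simp
      show "\<bar>(kop K ^^ n) f y\<bar> \<le> p * (1 - t) ^ n * W y + (p * (s * (1 - (1 - t) ^ n) / t) + q)" for y
        using Suc.IH[of y] by (simp only: distrib_left mult.assoc add.assoc)
    qed
    also have "\<dots> = p * ((1 - t) ^ Suc n * W x + s * (1 - (1 - t) ^ Suc n) / t) + q"
    proof -
      have "s = s * t / t" using t by simp
      then have "(1 - t) ^ n * s + s * (1 - (1 - t) ^ n) / t = s * (1 - (1 - t) ^ Suc n) / t"
        using t by (simp add: field_simps)
      then have "p * ((1 - t) ^ n * s + s * (1 - (1 - t) ^ n) / t) = p * (s * (1 - (1 - t) ^ Suc n) / t)" by simp
      then show ?thesis by (simp add: distrib_left mult.assoc mult.left_commute)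
    qed
    finally show ?case unfolding eq .
  qed (use f in simp)
  also have "\<dots> \<le> p * ((1 - t) ^ n * W x + s / t) + q"
  proof -
    have "s * (1 - (1 - t) ^ n) / t \<le> s / t" using t s by (intro divide_right_mono) (auto simp: mult_left_le)
    then show ?thesis using f by (intro add_right_mono mult_left_mono) auto
  qed
  finally show ?thesis by (simp add: distrib_left)
qed

end

text \<open>One step of the Hairer--Mattingly argument: after centring, \<open>f\<close> splits into a bounded part, to which
  the minorisation applies, and a part dominated by \<open>\<beta> * W\<close>, to which the drift applies.\<close>
lemma weighted_contraction:
  fixes P :: "('d::euclidean_space \<Rightarrow> real) \<Rightarrow> 'd \<Rightarrow> real" and W :: "'d \<Rightarrow> real"
  assumes W0: "\<And>x. W x \<ge> 0"
    and P_add: "\<And>f g x. f \<in> bmf \<Longrightarrow> g \<in> bmf \<Longrightarrow> P (\<lambda>x. f x + g x) x = P f x + P g x"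
    and P_const: "\<And>c x. P (\<lambda>_. c) x = c"
    and lam: "0 < l" "l < 1" and Kb: "Kb \<ge> 0"
    and drift: "\<And>f p q x. f \<in> bmf \<Longrightarrow> p \<ge> 0 \<Longrightarrow> q \<ge> 0 \<Longrightarrow> (\<And>x. \<bar>f x\<bar> \<le> p * W x + q)
        \<Longrightarrow> \<bar>P f x\<bar> \<le> p * (l * W x + Kb) + q"
    and eps: "0 < \<epsilon>" "\<epsilon> \<le> 1"
    and minor: "\<And>f C x y. f \<in> bmf \<Longrightarrow> C \<ge> 0 \<Longrightarrow> (\<And>x. \<bar>f x\<bar> \<le> C) \<Longrightarrow> W x + W y \<le> 2 * (2 * Kb + 1) / (1 - l)
        \<Longrightarrow> \<bar>P f x - P f y\<bar> \<le> 2 * (1 - \<epsilon>) * C"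
    and beta: "\<beta> = \<epsilon> / (2 * (Kb + 1))" and delta: "\<delta> = min ((1 - l) / 2) (\<beta> / 2)"
    and f: "f \<in> bmf" and C: "C \<ge> 0" and osc: "\<And>x y. \<bar>f x - f y\<bar> \<le> C * (2 + \<beta> * W x + \<beta> * W y)"
  shows "\<bar>P f x - P f y\<bar> \<le> C * (1 - \<delta>) * (2 + \<beta> * W x + \<beta> * W y)"
proof -
  have b0: "\<beta> > 0" using eps Kb by (simp add: beta)
  \<comment> \<open>\<open>\<beta>\<close> is so small that the additive drift constant costs at
    most \<open>\<epsilon>\<close> out of the \<open>2 * \<epsilon>\<close> gained from the
    minorisation.\<close>
  have bK: "2 * \<beta> * Kb \<le> \<epsilon>" and be: "\<beta> \<le> \<epsilon> / 2" using eps Kb by (auto simp: beta field_simps)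
  have d: "0 < \<delta>" "\<delta> \<le> (1 - l) / 2" "2 * \<delta> \<le> \<beta>" "2 * \<delta> \<le> \<epsilon>"
    using lam b0 be eps by (auto simp: delta min_def)
  obtain B where B: "\<And>x. \<bar>f x\<bar> \<le> B" using f by (metis bmf_bound)
  \<comment> \<open>The optimal centring constant: with it, the bound on oscillations becomes the
    pointwise bound \<open>gW\<close>, with no loss in \<open>C\<close>.\<close>
  define c where "c = (INF x. C * (1 + \<beta> * W x) - f x)"
  have bdd: "bdd_below (range (\<lambda>x. C * (1 + \<beta> * W x) - f x))"
  proof (rule bdd_belowI[where m="- B"])
    fix z assume "z \<in> range (\<lambda>x. C * (1 + \<beta> * W x) - f x)"
    then obtain x where z: "z = C * (1 + \<beta> * W x) - f x" by blast
    have "0 \<le> C * (1 + \<beta> * W x)" using C b0 W0 by simp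
    then show "- B \<le> z" using B[of x] unfolding z by linarith
  qed
  define g where "g x = f x + c" for x
  have gW: "\<bar>g x\<bar> \<le> C * (1 + \<beta> * W x)" for x
  proof -
    have "c \<le> C * (1 + \<beta> * W x) - f x" unfolding c_def by (rule cINF_lower[OF bdd]) simp
    moreover have "- (C * (1 + \<beta> * W x)) - f x \<le> c" unfolding c_def
    proof (rule cINF_greatest)
      fix z
      have "f z - f x \<le> C * (2 + \<beta> * W z + \<beta> * W x)" using osc[of z x] by linarith
      then show "- (C * (1 + \<beta> * W x)) - f x \<le> C * (1 + \<beta> * W z) - f z" by (simp add: algebra_simps)
    qed simp
    ultimately show ?thesis by (simp add: g_def abs_le_iff)
  qed
  have g: "g \<in> bmf" unfolding g_def by (intro bmf_add f bmf_const)
  have Pfg: "P f x - P f y = P g x - P g y"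
    using P_add[OF f bmf_const[of c]] P_const by (simp add: g_def[abs_def])
  define S where "S = W x + W y"
  have S: "S \<ge> 0" using W0[of x] W0[of y] by (simp add: S_def)
  have "\<bar>P g x - P g y\<bar> \<le> C * ((1 - \<delta>) * (2 + \<beta> * S))"
  proof (cases "S \<le> 2 * (2 * Kb + 1) / (1 - l)")
    case True
    \<comment> \<open>Truncation at level \<open>C\<close>: what exceeds it is bounded by
      \<open>C * \<beta> * W\<close>, with no constant term left.\<close>
    define g1 where "g1 x = max (- C) (min C (g x))" for x
    define g2 where "g2 x = g x - g1 x" for x
    have g1: "g1 \<in> bmf" using g C by (intro bmfI[where B=C]) (auto simp: g1_def[abs_def] abs_le_iff bmf_def)
    have g2: "g2 \<in> bmf" unfolding g2_def by (intro bmf_diff g g1)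
    have 1: "\<bar>P g1 x - P g1 y\<bar> \<le> 2 * (1 - \<epsilon>) * C"
      using True C by (intro minor[OF g1]) (auto simp: S_def g1_def abs_le_iff)
    have "\<bar>g2 x\<bar> \<le> (C * \<beta>) * W x + 0" for x
    proof -
      have "0 \<le> C * \<beta> * W x" using C b0 W0 by simp
      moreover have "\<bar>g x\<bar> \<le> C + C * \<beta> * W x" using gW[of x] by (simp add: algebra_simps)
      ultimately show ?thesis using C unfolding g2_def g1_def by (auto simp: abs_le_iff min_def max_def)
    qed
    then have 2: "\<bar>P g2 x\<bar> \<le> (C * \<beta>) * (l * W x + Kb) + 0" for x
      using C b0 by (intro drift[OF g2]) auto
    have "P g z = P g1 z + P g2 z" for z
      using P_add[OF g1 g2, of z] by (simp add: g2_def)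
    then have "\<bar>P g x - P g y\<bar> \<le> 2 * (1 - \<epsilon>) * C + ((C * \<beta>) * (l * W x + Kb) + (C * \<beta>) * (l * W y + Kb))"
      using 1 2[of x] 2[of y] by simp
    also have "\<dots> = C * (2 - 2 * \<epsilon> + (l * (\<beta> * S) + 2 * \<beta> * Kb))"
      by (simp add: S_def algebra_simps)
    also have "\<dots> \<le> C * ((1 - \<delta>) * (2 + \<beta> * S))"
    proof (rule mult_left_mono[OF _ C])
      have "l * (\<beta> * S) \<le> (1 - \<delta>) * (\<beta> * S)"
        using d lam b0 S by (intro mult_right_mono) auto
      then show "2 - 2 * \<epsilon> + (l * (\<beta> * S) + 2 * \<beta> * Kb) \<le> (1 - \<delta>) * (2 + \<beta> * S)"
        using bK d by (simp add: algebra_simps)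
    qed
    finally show ?thesis .
  next
    \<comment> \<open>Far out no minorisation is available, but the drift alone lowers the weight
      enough.\<close>
    case False
    have "\<bar>P g z\<bar> \<le> (C * \<beta>) * (l * W z + Kb) + C" for z
      using C b0 gW by (intro drift[OF g]) (auto simp: algebra_simps)
    from this[of x] this[of y]
    have "\<bar>P g x - P g y\<bar> \<le> C * (2 + (2 * \<beta> * Kb + l * (\<beta> * S)))"
      by (simp add: S_def algebra_simps)
    also have "\<dots> \<le> C * ((1 - \<delta>) * (2 + \<beta> * S))"
    proof (rule mult_left_mono[OF _ C])
      \<comment> \<open>The summand 1 in the level leaves a surplus \<open>\<beta>\<close>, which
        covers the loss \<open>2 * \<delta>\<close> on the constant part of the weight.\<close>
      have "2 * Kb + 1 \<le> S * ((1 - l) / 2)" using False lam by (simp add: field_simps)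
      also have "\<dots> \<le> S * (1 - l - \<delta>)" using d S by (intro mult_left_mono) auto
      finally have "\<beta> * (2 * Kb + 1) \<le> \<beta> * (S * (1 - l - \<delta>))" using b0 by simp
      then show "2 + (2 * \<beta> * Kb + l * (\<beta> * S)) \<le> (1 - \<delta>) * (2 + \<beta> * S)"
        using d by (simp add: algebra_simps)
    qed
    finally show ?thesis .
  qed
  then show ?thesis unfolding Pfg S_def by (simp add: algebra_simps)
qed

text \<open>The error \<open>e n\<close> is the same for all sets, so \<open>p A\<close> exceeds the
  mass under a single \<open>\<mu> N\<close> by at most \<open>e N\<close>. Continuity at the empty
  set, hence countable additivity, is inherited from that one measure; no Vitali-Hahn-Saks argument
  enters.\<close>

lemma setwise_limit_measure:
  fixes \<mu> :: "nat \<Rightarrow> 'd::euclidean_space measure"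
  assumes prob: "\<And>n. prob_space (\<mu> n)" and sets: "\<And>n. sets (\<mu> n) = sets borel"
    and e: "e \<longlonglongrightarrow> 0"
    and cauchy: "\<And>A n m. A \<in> sets borel \<Longrightarrow> \<bar>measure (\<mu> n) A - measure (\<mu> (n + m)) A\<bar> \<le> e n"
  shows "\<exists>\<pi>. prob_space \<pi> \<and> sets \<pi> = sets borel \<and>
    (\<forall>A\<in>sets borel. (\<lambda>n. measure (\<mu> n) A) \<longlonglongrightarrow> measure \<pi> A)"
proof -
  define p where "p A = lim (\<lambda>n. measure (\<mu> n) A)" for A
  have sp: "space (\<mu> n) = UNIV" for n using sets_eq_imp_space_eq[OF sets[of n]] by simp
  have lim: "(\<lambda>n. measure (\<mu> n) A) \<longlonglongrightarrow> p A" if A: "A \<in> sets borel" for A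
  proof -
    have "Cauchy (\<lambda>n. measure (\<mu> n) A)"
    proof (rule CauchyI)
      fix r :: real assume "0 < r"
      then have "\<forall>\<^sub>F n in sequentially. e n < r / 2" using e by (auto dest!: order_tendstoD(2)[where a="r/2"])
      then obtain N where N: "\<And>n. n \<ge> N \<Longrightarrow> e n < r / 2" by (auto simp: eventually_sequentially)
      have "norm (measure (\<mu> m) A - measure (\<mu> n) A) < r" if "m \<ge> N" "n \<ge> N" for m n
        using cauchy[OF A, of N "m - N"] cauchy[OF A, of N "n - N"] N[of N] that by simp
      then show "\<exists>N. \<forall>m\<ge>N. \<forall>n\<ge>N. norm (measure (\<mu> m) A - measure (\<mu> n) A) < r" by blast
    qed
    then show ?thesis unfolding p_def by (simp add: Cauchy_convergent convergent_LIMSEQ_iff[symmetric])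
  qed
  have p_le: "p A \<le> e n + measure (\<mu> n) A" if A: "A \<in> sets borel" for A n
  proof (rule LIMSEQ_le_const2[OF lim[OF A]])
    show "\<exists>N. \<forall>m\<ge>N. measure (\<mu> m) A \<le> e n + measure (\<mu> n) A"
    proof (intro exI[of _ n] allI impI)
      fix m assume "n \<le> m"
      then show "measure (\<mu> m) A \<le> e n + measure (\<mu> n) A" using cauchy[OF A, of n "m - n"] by simp
    qed
  qed
  have p0: "p A \<ge> 0" if "A \<in> sets borel" for A
    by (rule LIMSEQ_le_const[OF lim[OF that]]) auto
  have add: "p (A \<union> B) = p A + p B" if A: "A \<in> sets borel" and B: "B \<in> sets borel" and AB: "A \<inter> B = {}" for A B
  proof (rule LIMSEQ_unique)
    show "(\<lambda>n. measure (\<mu> n) (A \<union> B)) \<longlonglongrightarrow> p (A \<union> B)" using A B by (intro lim) auto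
    have "measure (\<mu> n) (A \<union> B) = measure (\<mu> n) A + measure (\<mu> n) B" for n
    proof -
      interpret prob_space "\<mu> n" by (rule prob)
      show ?thesis using A B AB by (intro finite_measure_Union) (auto simp: sets)
    qed
    then show "(\<lambda>n. measure (\<mu> n) (A \<union> B)) \<longlonglongrightarrow> p A + p B"
      using tendsto_add[OF lim[OF A] lim[OF B]] by simp
  qed
  interpret B: sigma_algebra UNIV "sets (borel :: 'd measure)"
    using sets.sigma_algebra_axioms[of "borel :: 'd measure"] by simp
  have emp: "p {} = 0" using lim[of "{}"] by (simp add: LIMSEQ_const_iff)
  have ca: "countably_additive (sets borel) (\<lambda>A. ennreal (p A))"
  proof (rule B.empty_continuous_imp_countably_additive)
    show "positive (sets borel) (\<lambda>A. ennreal (p A))" by (simp add: positive_def emp)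
    show "additive (sets borel) (\<lambda>A. ennreal (p A))"
      by (auto simp: additive_def add p0)
    fix A :: "nat \<Rightarrow> 'd set"
    assume A: "range A \<subseteq> sets borel" "decseq A" "(\<Inter>i. A i) = {}"
    have "(\<lambda>i. p (A i)) \<longlonglongrightarrow> 0"
    proof (rule LIMSEQ_I)
      fix r :: real assume r: "0 < r"
      then have "\<forall>\<^sub>F n in sequentially. e n < r / 2" using e by (auto dest!: order_tendstoD(2)[where a="r/2"])
      then obtain N where N: "e N < r / 2" by (auto simp: eventually_sequentially)
      interpret prob_space "\<mu> N" by (rule prob)
      have "(\<lambda>i. measure (\<mu> N) (A i)) \<longlonglongrightarrow> measure (\<mu> N) (\<Inter>i. A i)"
        using A by (intro finite_Lim_measure_decseq) (auto simp: sets)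
      then have "\<forall>\<^sub>F i in sequentially. measure (\<mu> N) (A i) < r / 2"
        using r A by (auto dest!: order_tendstoD(2)[where a="r/2"])
      then obtain j where j: "\<And>i. i \<ge> j \<Longrightarrow> measure (\<mu> N) (A i) < r / 2" by (auto simp: eventually_sequentially)
      have "norm (p (A i) - 0) < r" if "i \<ge> j" for i
        using p_le[of "A i" N] p0[of "A i"] j[OF that] N A(1) by auto
      then show "\<exists>no. \<forall>n\<ge>no. norm (p (A n) - 0) < r" by blast
    qed
    then show "(\<lambda>i. ennreal (p (A i))) \<longlonglongrightarrow> 0" using tendsto_ennrealI by fastforce
  qed simp
  define \<pi> where "\<pi> = measure_of UNIV (sets borel) (\<lambda>A. ennreal (p A))"
  have s\<pi>: "sets \<pi> = sets (borel :: 'd measure)"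
    unfolding \<pi>_def by (simp add: B.sets_measure_of_eq)
  have em: "emeasure \<pi> A = ennreal (p A)" if "A \<in> sets borel" for A
    unfolding \<pi>_def
    by (rule emeasure_measure_of_sigma[OF B.sigma_algebra_axioms _ ca that]) (simp add: positive_def emp)
  have "p UNIV = 1"
  proof (rule LIMSEQ_unique[OF lim])
    have "measure (\<mu> n) UNIV = 1" for n using prob_space.prob_space[OF prob, of n] by (simp add: sp)
    then show "(\<lambda>n. measure (\<mu> n) UNIV) \<longlonglongrightarrow> 1" by simp
  qed simp
  then have "prob_space \<pi>"
    by (intro prob_spaceI) (simp add: sets_eq_imp_space_eq[OF s\<pi>] em)
  moreover have "measure \<pi> A = p A" if "A \<in> sets borel" for A
    using em[OF that] p0[OF that] by (simp add: measure_def)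
  ultimately show ?thesis using s\<pi> lim by auto
qed

text \<open>Bounded functions are uniform limits of the simple functions \<open>floor (k * f) / k\<close>.\<close>
lemma setwise_limit_integral:
  fixes \<mu> :: "nat \<Rightarrow> 'd::euclidean_space measure"
  assumes prob: "\<And>n. prob_space (\<mu> n)" and sets: "\<And>n. sets (\<mu> n) = sets borel"
    and \<pi>: "prob_space \<pi>" "sets \<pi> = sets borel"
    and lim: "\<And>A. A \<in> sets borel \<Longrightarrow> (\<lambda>n. measure (\<mu> n) A) \<longlonglongrightarrow> measure \<pi> A"
    and f: "f \<in> bmf"
  shows "(\<lambda>n. \<integral>x. f x \<partial>\<mu> n) \<longlonglongrightarrow> (\<integral>x. f x \<partial>\<pi>)"
proof (rule LIMSEQ_I)
  fix r :: real assume r: "0 < r"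
  obtain B where B: "\<And>x. \<bar>f x\<bar> \<le> B" using f by (metis bmf_bound)
  obtain k :: nat where k: "k > 0" "1 / real k < r / 3"
    using r by (metis nat_approx_posE zero_less_divide_iff zero_less_numeral zero_less_Suc)
  define J where "J = \<lceil>real k * B\<rceil> + 1"
  define A where "A j = {x. \<lfloor>real k * f x\<rfloor> = j}" for j
  define g where "g x = (\<Sum>j\<in>{-J..J}. (of_int j / real k) * indicator (A j) x)" for x
  have Am[measurable]: "A j \<in> sets borel" for j
    using f unfolding A_def by (auto simp: bmf_def)
  have g_eq: "g x = of_int \<lfloor>real k * f x\<rfloor> / real k" for x
  proof -
    have "f x \<le> B" "- B \<le> f x" using B[of x] by linarith+
    then have "real k * f x \<le> real k * B" "real k * (- B) \<le> real k * f x"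
      by (intro mult_left_mono; simp)+
    then have "\<lfloor>real k * f x\<rfloor> \<le> J" "- J \<le> \<lfloor>real k * f x\<rfloor>"
      unfolding J_def mult_minus_right by linarith+
    then have "\<lfloor>real k * f x\<rfloor> \<in> {-J..J}" by simp
    then have "g x = (\<Sum>j\<in>{\<lfloor>real k * f x\<rfloor>}. (of_int j / real k) * indicator (A j) x)"
      unfolding g_def by (intro sum.mono_neutral_right) (auto simp: A_def)
    then show ?thesis by (simp add: A_def)
  qed
  have fg: "\<bar>f x - g x\<bar> \<le> 1 / real k" for x
  proof -
    have "f x - g x = (real k * f x - of_int \<lfloor>real k * f x\<rfloor>) / real k"
      using k by (simp add: g_eq field_simps)
    moreover have "\<bar>real k * f x - of_int \<lfloor>real k * f x\<rfloor>\<bar> \<le> 1" by linarith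
    ultimately show ?thesis using k by (simp add: divide_right_mono)
  qed
  have gb: "g \<in> bmf"
  proof (rule bmfI)
    show "g \<in> borel_measurable borel" unfolding g_def by measurable
    show "\<bar>g x\<bar> \<le> B + 1 / real k" for x using fg[of x] B[of x] by linarith
  qed
  have int_g: "(\<integral>x. g x \<partial>M) = (\<Sum>j\<in>{-J..J}. (of_int j / real k) * measure M (A j))"
    and int_fg: "\<bar>(\<integral>x. f x \<partial>M) - (\<integral>x. g x \<partial>M)\<bar> \<le> 1 / real k"
    if M: "prob_space M" "sets M = sets borel" for M
  proof -
    interpret prob_space M by fact
    have "A j \<in> sets M" for j using Am M by simp
    then show "(\<integral>x. g x \<partial>M) = (\<Sum>j\<in>{-J..J}. (of_int j / real k) * measure M (A j))"
      unfolding g_def by (subst Bochner_Integration.integral_sum) (auto simp: emeasure_eq_measure)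
    have "(\<integral>x. f x \<partial>M) - (\<integral>x. g x \<partial>M) = (\<integral>x. f x - g x \<partial>M)"
      using bmf_integrable[OF M f] bmf_integrable[OF M gb] by simp
    also have "\<bar>\<dots>\<bar> \<le> (\<integral>x. \<bar>f x - g x\<bar> \<partial>M)" by (rule integral_abs_bound)
    also have "\<dots> \<le> (\<integral>x. 1 / real k \<partial>M)"
      using fg bmf_integrable[OF M f] bmf_integrable[OF M gb] by (intro integral_mono) auto
    finally show "\<bar>(\<integral>x. f x \<partial>M) - (\<integral>x. g x \<partial>M)\<bar> \<le> 1 / real k" by (simp add: prob_space)
  qed
  have "(\<lambda>n. \<integral>x. g x \<partial>\<mu> n) \<longlonglongrightarrow> (\<integral>x. g x \<partial>\<pi>)"
    unfolding int_g[OF prob sets] int_g[OF \<pi>] by (intro tendsto_sum tendsto_mult tendsto_const lim Am)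
  then obtain N where N: "\<And>n. n \<ge> N \<Longrightarrow> \<bar>(\<integral>x. g x \<partial>\<mu> n) - (\<integral>x. g x \<partial>\<pi>)\<bar> < r / 3"
    using r LIMSEQ_D[of _ _ "r / 3"] by (metis divide_pos_pos real_norm_def zero_less_numeral)
  have "norm ((\<integral>x. f x \<partial>\<mu> n) - (\<integral>x. f x \<partial>\<pi>)) < r" if "n \<ge> N" for n
    using N[OF that] int_fg[OF prob sets, of n] int_fg[OF \<pi>] k by (simp only: real_norm_def)
  then show "\<exists>N. \<forall>n\<ge>N. norm ((\<integral>x. f x \<partial>\<mu> n) - (\<integral>x. f x \<partial>\<pi>)) < r" by blast
qed

subsection \<open>Log-Harnack inequality\<close>

lemma gaussian_kernel:
  fixes T :: "'d::euclidean_space \<Rightarrow> 'd"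
  assumes T[measurable]: "T \<in> borel_measurable borel" and s: "s > 0"
  shows "markov_kernel (\<lambda>x. gaussian (T x) s)"
proof (rule markov_kernel.intro)
  show "prob_space (gaussian (T x) s)" for x by (rule prob_space_gaussian[OF s])
  show "(\<lambda>x. gaussian (T x) s) \<in> borel \<rightarrow>\<^sub>M subprob_algebra borel"
  proof (rule measurable_subprob_algebra)
    show "subprob_space (gaussian (T x) s)" for x
      by (rule prob_space_imp_subprob_space[OF prob_space_gaussian[OF s]])
    fix A :: "'d set" assume A[measurable]: "A \<in> sets borel"
    have "emeasure (gaussian (T x) s) A
        = (\<integral>\<^sup>+y. ennreal (gauss_density (T x) s y) * indicator A y \<partial>lborel)" for x
      unfolding gaussian_eq_density by (subst emeasure_density) auto
    then show "(\<lambda>x. emeasure (gaussian (T x) s) A) \<in> borel_measurable borel"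
      unfolding gauss_density_def by simp
  qed simp
qed

lemma nonexpansive_measurable:
  fixes T :: "'d::euclidean_space \<Rightarrow> 'd"
  assumes "\<And>x y. norm (T x - T y) \<le> norm (x - y)"
  shows "T \<in> borel_measurable borel"
proof (rule borel_measurable_continuous_onI)
  have "1-lipschitz_on UNIV T" using assms by (intro lipschitz_onI) (auto simp: dist_norm)
  then show "continuous_on UNIV T" by (rule lipschitz_on_continuous_on)
qed

text \<open>The log-Harnack inequality for the iterates. In the induction step the starting point \<open>T x\<close> is first moved
  to the point \<open>w\<close> on the segment towards \<open>T y\<close>; translating the noise handles \<open>T x\<close> and \<open>w\<close>, and the
  one-step inequality handles \<open>w\<close> and \<open>T y\<close>. The position of \<open>w\<close> optimises the sum of the two costs.\<close>
lemma log_harnack_iterate: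
  fixes T :: "'d::euclidean_space \<Rightarrow> 'd"
  assumes T: "\<And>x y. norm (T x - T y) \<le> norm (x - y)" and s: "s > 0" and g: "g \<in> bmf"
  defines "K \<equiv> (\<lambda>x. gaussian (T x) s)"
  shows "(kop K ^^ Suc n) g x \<le> ln ((kop K ^^ Suc n) (\<lambda>z. exp (g z)) y)
    + (norm (x - y))\<^sup>2 / (2 * s * real (Suc n))"
proof (induction n arbitrary: x y)
  case 0
  have "kop K g x \<le> ln (kop K (\<lambda>z. exp (g z)) y) + (norm (T x - T y))\<^sup>2 / (2 * s)"
    unfolding kop_def K_def by (rule gaussian_log_harnack[OF s]) (use g in \<open>auto simp: bmf_def\<close>)
  also have "(norm (T x - T y))\<^sup>2 / (2 * s) \<le> (norm (x - y))\<^sup>2 / (2 * s)"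
    using s T by (intro divide_right_mono power_mono) auto
  finally show ?case by simp
next
  case (Suc n)
  interpret markov_kernel K
    unfolding K_def by (rule gaussian_kernel[OF nonexpansive_measurable[OF T] s])
  define N where "N = real (Suc n)"
  have N: "N > 0" by (simp add: N_def)
  define F where "F = (kop K ^^ Suc n) g"
  define E where "E = (kop K ^^ Suc n) (\<lambda>z. exp (g z))"
  have F: "F \<in> bmf" unfolding F_def by (intro kop_pow_bmf g)
  have E: "E \<in> bmf" unfolding E_def by (intro kop_pow_bmf bmf_exp g)
  obtain B where B: "\<And>x. \<bar>g x\<bar> \<le> B" using g by (metis bmf_bound)
  have gB: "g x \<le> B" "- B \<le> g x" for x using B[of x] by linarith+
  \<comment> \<open>The two-sided bound on \<open>E\<close> makes \<open>ln (E x)\<close> a bounded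
    function, so the one-step inequality can be applied to it and returns the integral of
    \<open>E\<close>.\<close>
  have Elo: "exp (- B) \<le> E x" for x
    using kop_pow_mono[OF bmf_const[of "exp (- B)"] bmf_exp[OF g]] gB
    by (auto simp add: E_def simp del: funpow.simps)
  have Eup: "E x \<le> exp B" for x
    using kop_pow_mono[OF bmf_exp[OF g] bmf_const[of "exp B"]] gB
    by (auto simp add: E_def simp del: funpow.simps)
  have Epos: "E x > 0" for x using Elo[of x] exp_gt_zero[of "- B"] by linarith
  have lnE: "(\<lambda>x. ln (E x)) \<in> bmf"
  proof (rule bmfI)
    show "(\<lambda>x. ln (E x)) \<in> borel_measurable borel" using E by (auto simp: bmf_def)
    fix x
    have "ln (E x) \<le> B" using Eup[of x] Epos[of x] ln_mono[of "E x" "exp B"] by simp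
    moreover have "- B \<le> ln (E x)" using Elo[of x] Epos[of x] ln_mono[of "exp (- B)" "E x"] by simp
    ultimately show "\<bar>ln (E x)\<bar> \<le> B" by simp
  qed
  define u v where "u = T x" and "v = T y"
  \<comment> \<open>The costs are \<open>(norm (u - w))\<^sup>2 / N\<close> and
    \<open>(norm (w - v))\<^sup>2\<close>; on the segment their sum is least when the distances are
    in ratio \<open>N\<close> to 1, and its value \<open>(norm (u - v))\<^sup>2 / (N + 1)\<close> is
    the cost for one more step.\<close>
  define w where "w = u + (N / (N + 1)) *\<^sub>R (v - u)"
  have uw: "norm (u - w) = N / (N + 1) * norm (u - v)" 
    using N by (simp add: w_def norm_minus_commute[of v u])
  have "w - v = (1 / (N + 1)) *\<^sub>R (u - v)"
  proof -
    have "w - v = (1 - N / (N + 1)) *\<^sub>R (u - v)" by (simp add: w_def algebra_simps)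
    also have "1 - N / (N + 1) = 1 / (N + 1)" using N by (simp add: field_simps)
    finally show ?thesis .
  qed
  then have wv: "norm (w - v) = 1 / (N + 1) * norm (u - v)" using N by simp
  have bmf_shift: "(\<lambda>z. f (c + z)) \<in> bmf" if "f \<in> bmf" for f and c :: 'd
    using that by (auto simp: bmf_def bounded_iff)
  have int: "integrable (gaussian 0 s) f" if "f \<in> bmf" for f :: "'d \<Rightarrow> real"
    by (rule bmf_integrable[OF prob_space_gaussian[OF s] sets_gaussian that])
  have "(\<integral>z. F z \<partial>gaussian u s) = (\<integral>z. F (u + z) \<partial>gaussian 0 s)"
    using F by (intro integral_gaussian_translate) (simp add: bmf_def)
  also have "\<dots> \<le> (\<integral>z. ln (E (w + z)) + (norm (u - w))\<^sup>2 / (2 * s * N) \<partial>gaussian 0 s)"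
  proof (rule integral_mono)
    show "integrable (gaussian 0 s) (\<lambda>z. F (u + z))" by (intro int bmf_shift F)
    show "integrable (gaussian 0 s) (\<lambda>z. ln (E (w + z)) + (norm (u - w))\<^sup>2 / (2 * s * N))"
      by (intro int bmf_add bmf_const bmf_shift[OF lnE])
    show "F (u + z) \<le> ln (E (w + z)) + (norm (u - w))\<^sup>2 / (2 * s * N)" for z
      using Suc.IH[of "u + z" "w + z"] by (simp add: F_def E_def N_def del: funpow.simps)
  qed
  also have "\<dots> = (\<integral>z. ln (E z) \<partial>gaussian w s) + (norm (u - w))\<^sup>2 / (2 * s * N)"
  proof -
    have "(\<integral>z. ln (E z) \<partial>gaussian w s) = (\<integral>z. ln (E (w + z)) \<partial>gaussian 0 s)"
      using lnE by (intro integral_gaussian_translate) (simp add: bmf_def)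
    then show ?thesis
      using s by (subst Bochner_Integration.integral_add) (auto intro!: int bmf_shift[OF lnE])
  qed
  also have "(\<integral>z. ln (E z) \<partial>gaussian w s) \<le> ln (\<integral>z. exp (ln (E z)) \<partial>gaussian v s) + (norm (w - v))\<^sup>2 / (2 * s)"
    by (rule gaussian_log_harnack[OF s]) (use lnE in \<open>auto simp: bmf_def\<close>)
  also have "(\<integral>z. exp (ln (E z)) \<partial>gaussian v s) = (\<integral>z. E z \<partial>gaussian v s)" using Epos by simp
  finally have "(\<integral>z. F z \<partial>gaussian u s) \<le> ln (\<integral>z. E z \<partial>gaussian v s)
      + ((norm (w - v))\<^sup>2 / (2 * s) + (norm (u - w))\<^sup>2 / (2 * s * N))" by simp
  also have "(norm (w - v))\<^sup>2 / (2 * s) + (norm (u - w))\<^sup>2 / (2 * s * N) = (norm (u - v))\<^sup>2 / (2 * s * (N + 1))"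
  proof -
    have "(1 / (N + 1))\<^sup>2 + (N / (N + 1))\<^sup>2 / N = (1 + N) / (N + 1)\<^sup>2"
      using N by (simp add: power_divide add_divide_distrib) (simp add: power2_eq_square)
    also have "\<dots> = 1 / (N + 1)" using N by (simp add: power2_eq_square add.commute[of 1])
    finally have *: "(1 / (N + 1))\<^sup>2 + (N / (N + 1))\<^sup>2 / N = 1 / (N + 1)" .
    have "(norm (w - v))\<^sup>2 / (2 * s) + (norm (u - w))\<^sup>2 / (2 * s * N)
        = ((1 / (N + 1))\<^sup>2 + (N / (N + 1))\<^sup>2 / N) * ((norm (u - v))\<^sup>2 / (2 * s))"
      unfolding uw wv power_mult_distrib distrib_right by (simp add: mult_ac)
    then show ?thesis unfolding * by (simp add: mult_ac)
  qed
  also have "(norm (u - v))\<^sup>2 / (2 * s * (N + 1)) \<le> (norm (x - y))\<^sup>2 / (2 * s * (N + 1))"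
    using s T N unfolding u_def v_def by (intro divide_right_mono power_mono) auto
  finally have "(\<integral>z. F z \<partial>gaussian u s) \<le> ln (\<integral>z. E z \<partial>gaussian v s) + (norm (x - y))\<^sup>2 / (2 * s * (N + 1))"
    by simp
  moreover have "(\<integral>z. F z \<partial>gaussian u s) = (kop K ^^ Suc (Suc n)) g x"
    by (simp add: F_def kop_def K_def u_def)
  moreover have "(\<integral>z. E z \<partial>gaussian v s) = (kop K ^^ Suc (Suc n)) (\<lambda>z. exp (g z)) y"
    by (simp add: E_def kop_def K_def v_def)
  ultimately show ?case by (simp add: N_def add.commute)
qed

text \<open>Rescale \<open>f\<close> to \<open>\<phi>\<close> with values in the unit interval and
  apply log-Harnack to \<open>\<theta> * \<phi>\<close>. Convexity of \<open>exp\<close> gives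
  \<open>\<theta> * p <= exp \<theta> * q + D\<close> for the two expectations of
  \<open>\<phi>\<close>. With \<open>\<theta> = D + 1\<close> this excludes \<open>p\<close> near 1
  together with \<open>q\<close> near 0, and \<open>\<epsilon>\<close> is the threshold solving
  \<open>\<theta> * (1 - \<epsilon>) = exp \<theta> * \<epsilon> + D\<close>.\<close>

lemma tv_bound_of_log_harnack:
  fixes T :: "'d::euclidean_space \<Rightarrow> 'd"
  assumes T: "\<And>x y. norm (T x - T y) \<le> norm (x - y)" and s: "s > 0" and n: "n > 0"
    and D: "(norm (x - y))\<^sup>2 / (2 * s * real n) \<le> D" and eps: "\<epsilon> = 1 / (D + 1 + exp (D + 1))"
    and f: "f \<in> bmf" "C \<ge> 0" "\<And>x. \<bar>f x\<bar> \<le> C"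
  defines "K \<equiv> (\<lambda>x. gaussian (T x) s)"
  shows "(kop K ^^ n) f x - (kop K ^^ n) f y \<le> 2 * (1 - \<epsilon>) * C"
proof (cases "C = 0")
  case True
  then have "f = (\<lambda>_. 0)" using f(3) by auto
  interpret markov_kernel K
    unfolding K_def by (rule gaussian_kernel[OF nonexpansive_measurable[OF T] s])
  show ?thesis unfolding \<open>f = _\<close> using True by simp
next
  case False
  then have C: "C > 0" using f by simp
  interpret markov_kernel K
    unfolding K_def by (rule gaussian_kernel[OF nonexpansive_measurable[OF T] s])
  have D0: "D \<ge> 0" using order_trans[OF _ D, of 0] s by simp
  define \<phi> where "\<phi> z = 1 / 2 + 1 / (2 * C) * f z" for z
  have \<phi>: "\<phi> \<in> bmf" unfolding \<phi>_def by (intro bmf_add bmf_cmult f bmf_const)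
  have \<phi>01: "0 \<le> \<phi> z" "\<phi> z \<le> 1" for z
  proof -
    have "- C \<le> f z" "f z \<le> C" using f(3)[of z] by linarith+
    then show "0 \<le> \<phi> z" "\<phi> z \<le> 1" using C by (auto simp: \<phi>_def field_simps)
  qed
  define p where "p = (kop K ^^ n) \<phi> x"
  define q where "q = (kop K ^^ n) \<phi> y"
  define \<theta> where "\<theta> = D + 1"
  have \<theta>: "\<theta> > 0" using D0 by (simp add: \<theta>_def)
  have q0: "0 \<le> q" using kop_pow_mono[OF bmf_const[of 0] \<phi>] \<phi>01 by (simp add: q_def)
  have p1: "p \<le> 1" using kop_pow_mono[OF \<phi> bmf_const[of 1]] \<phi>01 by (simp add: p_def)
  have "(kop K ^^ n) (\<lambda>z. \<theta> * \<phi> z) x \<le> ln ((kop K ^^ n) (\<lambda>z. exp (\<theta> * \<phi> z)) y) + (norm (x - y))\<^sup>2 / (2 * s * real n)"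
    using log_harnack_iterate[OF T s bmf_cmult[OF \<phi>, of \<theta>], of "n - 1" x y] n
    by (simp add: K_def del: funpow.simps)
  moreover have "(kop K ^^ n) (\<lambda>z. exp (\<theta> * \<phi> z)) y \<le> (kop K ^^ n) (\<lambda>z. 1 + (exp \<theta> - 1) * \<phi> z) y"
  proof (rule kop_pow_mono)
    show "(\<lambda>z. exp (\<theta> * \<phi> z)) \<in> bmf" by (intro bmf_exp bmf_cmult \<phi>)
    show "(\<lambda>z. 1 + (exp \<theta> - 1) * \<phi> z) \<in> bmf" by (intro bmf_add bmf_cmult \<phi> bmf_const)
    fix z
    have "exp ((1 - \<phi> z) *\<^sub>R 0 + \<phi> z *\<^sub>R \<theta>) \<le> (1 - \<phi> z) * exp 0 + \<phi> z * exp \<theta>"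
      using \<phi>01 by (intro convex_onD[OF exp_convex]) auto
    then show "exp (\<theta> * \<phi> z) \<le> 1 + (exp \<theta> - 1) * \<phi> z" by (simp add: algebra_simps)
  qed
  moreover have "0 < (kop K ^^ n) (\<lambda>z. exp (\<theta> * \<phi> z)) y"
  proof -
    have "(kop K ^^ n) (\<lambda>_. 1) y \<le> (kop K ^^ n) (\<lambda>z. exp (\<theta> * \<phi> z)) y"
      using \<phi>01 \<theta> by (intro kop_pow_mono bmf_exp bmf_cmult \<phi> bmf_const) auto
    then show ?thesis by simp
  qed
  moreover have "(kop K ^^ n) (\<lambda>z. 1 + (exp \<theta> - 1) * \<phi> z) y = 1 + (exp \<theta> - 1) * q"
    by (subst kop_pow_add) (auto intro: bmf_cmult \<phi> simp: kop_pow_cmult q_def)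
  ultimately have "\<theta> * p \<le> ln (1 + (exp \<theta> - 1) * q) + D"
    using D by (simp add: kop_pow_cmult p_def) (smt (verit) ln_mono)
  also have "ln (1 + (exp \<theta> - 1) * q) \<le> (exp \<theta> - 1) * q"
    using q0 \<theta> by (intro ln_add_one_self_le_self) auto
  also have "\<dots> \<le> exp \<theta> * q" using q0 by (simp add: algebra_simps)
  finally have main: "\<theta> * p \<le> exp \<theta> * q + D" by simp
  have "p - q \<le> 1 - \<epsilon>"
  proof (rule ccontr)
    assume "\<not> p - q \<le> 1 - \<epsilon>"
    then have p: "p > 1 - \<epsilon>" and q: "q < \<epsilon>" using p1 q0 by auto
    have "\<theta> * (1 - \<epsilon>) < \<theta> * p" using p \<theta> by simp
    moreover have "exp \<theta> * q < exp \<theta> * \<epsilon>" using q by simp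
    ultimately have "\<theta> * (1 - \<epsilon>) < exp \<theta> * \<epsilon> + D" using main by linarith
    then have "1 < \<epsilon> * (D + 1 + exp (D + 1))" by (simp add: \<theta>_def algebra_simps)
    moreover have "D + 1 + exp (D + 1) > 0" using D0 by (simp add: add_pos_pos)
    ultimately show False by (simp add: eps)
  qed
  moreover have "(kop K ^^ n) \<phi> z = 1 / 2 + 1 / (2 * C) * (kop K ^^ n) f z" for z
    unfolding \<phi>_def by (simp only: kop_pow_add[OF bmf_const bmf_cmult[OF f(1)]] kop_pow_cmult kop_pow_const)
  ultimately have "1 / (2 * C) * ((kop K ^^ n) f x - (kop K ^^ n) f y) \<le> 1 - \<epsilon>"
    by (simp add: p_def q_def right_diff_distrib)
  then show ?thesis using C by (simp add: field_simps)
qed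

subsection \<open>Uniform geometric ergodicity\<close>

text \<open>Origin of the constants. \<open>\<epsilon>\<close> is the total variation gap belonging
  to log-Harnack cost \<open>r\<^sup>2\<close>. In \<open>A\<close>, the factor
  \<open>(1 + b / c) / \<beta>\<close> turns the bound by \<open>W\<close>, after the
  \<open>n mod N\<close> leftover steps, into a weighted oscillation; \<open>2 + \<beta>\<close>
  returns from the weight \<open>2 + \<beta> * W x + \<beta> * W y\<close> to
  \<open>W x + W y\<close>; \<open>1 / (1 - \<delta>)\<close> pays for rounding down the number of
  blocks. The exponent in \<open>\<rho>\<close> reflects that a block lasts at most time
  \<open>1 + gb\<close>.\<close>

lemma gaussian_mean_kernel_contraction:
  fixes T :: "'d::euclidean_space \<Rightarrow> 'd" and W :: "'d \<Rightarrow> real"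
  assumes W[measurable]: "W \<in> borel_measurable borel" and W1: "\<And>x. W x \<ge> 1"
    and level: "\<And>x. W x \<le> 2 * (2 * (b / c) + 1) / (1 - exp (- c)) \<Longrightarrow> norm x \<le> r"
    and c: "c > 0" "c * gb \<le> 1" and b: "b \<ge> 0" and gam: "0 < \<gamma>" "\<gamma> \<le> gb"
    and T: "\<And>x y. norm (T x - T y) \<le> norm (x - y)"
    and drift: "\<And>x. (\<integral>\<^sup>+y. ennreal (W y) \<partial>gaussian (T x) (2 * \<gamma>)) \<le> ennreal ((1 - c * \<gamma>) * W x + b * \<gamma>)"
    and eps: "\<epsilon> = 1 / (r\<^sup>2 + 1 + exp (r\<^sup>2 + 1))"
    and beta: "\<beta> = \<epsilon> / (2 * (b / c + 1))" and delta: "\<delta> = min ((1 - exp (- c)) / 2) (\<beta> / 2)"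
    and A: "A = (1 + b / c) / \<beta> * (2 + \<beta>) / (1 - \<delta>)" and rho: "\<rho> = (1 - \<delta>) powr (1 / (1 + gb))"
    and f: "f \<in> bmf" "\<And>x. \<bar>f x\<bar> \<le> W x"
  defines "K \<equiv> (\<lambda>x. gaussian (T x) (2 * \<gamma>))"
  shows "\<bar>(kop K ^^ n) f x - (kop K ^^ n) f y\<bar> \<le> A * \<rho> powr (\<gamma> * real n) * (W x + W y)"
proof -
  interpret markov_kernel K
    unfolding K_def by (rule gaussian_kernel[OF nonexpansive_measurable[OF T]]) (use gam in simp)
  define K0 where "K0 = b / c"
  have K0: "K0 \<ge> 0" using b c by (simp add: K0_def)
  have W0: "W x \<ge> 0" for x using W1[of x] by linarith
  have cg: "0 < c * \<gamma>" "c * \<gamma> \<le> 1" "0 \<le> b * \<gamma>" "b * \<gamma> / (c * \<gamma>) = K0"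
    using c gam b order_trans[OF mult_left_mono[of \<gamma> gb c] c(2)] by (auto simp: K0_def)
  have X: "r\<^sup>2 + 1 + exp (r\<^sup>2 + 1) \<ge> 1"
    using zero_le_power2[of r] exp_gt_zero[of "r\<^sup>2 + 1"] by linarith
  have eps01: "0 < \<epsilon>" "\<epsilon> \<le> 1"
  proof -
    show "0 < \<epsilon>" unfolding eps by (rule divide_pos_pos) (use X in linarith)+
    show "\<epsilon> \<le> 1" unfolding eps by (subst divide_le_eq_1_pos) (use X in linarith)+
  qed
  have b0: "\<beta> > 0" using eps01 K0 by (simp add: beta K0_def[symmetric])
  have "\<delta> \<le> (1 - exp (- c)) / 2" unfolding delta by (rule min.cobounded1)
  then have d: "0 < \<delta>" "\<delta> < 1"
  proof -
    show "0 < \<delta>" using b0 c(1) by (simp add: delta)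
    have "\<delta> \<le> 1 / 2" by (rule order_trans[OF \<open>\<delta> \<le> _\<close>]) simp
    then show "\<delta> < 1" by linarith
  qed
  \<comment> \<open>Block length: the elapsed time \<open>\<gamma> * N\<close> lies between 1 and
    \<open>1 + gb\<close>, which frees the block constants of \<open>\<gamma>\<close>.\<close>
  define N where "N = nat \<lceil>1 / \<gamma>\<rceil>"
  have N1: "1 / \<gamma> \<le> real N" and N2: "real N \<le> 1 / \<gamma> + 1"
    using gam unfolding N_def by (auto simp: real_nat_ceiling_ge)
  have N0: "N > 0" using gam N1 by (cases N) auto
  have gN: "1 \<le> \<gamma> * real N" using N1 gam by (simp add: field_simps)
  define P where "P = kop K ^^ N"
  have driftK: "(\<integral>\<^sup>+y. ennreal (W y) \<partial>K x) \<le> ennreal ((1 - c * \<gamma>) * W x + b * \<gamma>)" for x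
    unfolding K_def by (rule drift)
  note dp = drift_pow[OF W W0 driftK cg(1,2,3), unfolded cg(4)]
  have P_drift: "\<bar>P f x\<bar> \<le> p * (exp (- c) * W x + K0) + q"
    if f: "f \<in> bmf" "p \<ge> 0" "q \<ge> 0" "\<And>x. \<bar>f x\<bar> \<le> p * W x + q" for f p q x
  proof -
    have "(1 - c * \<gamma>) ^ N \<le> exp (- (c * \<gamma>)) ^ N"
      using exp_ge_add_one_self[of "- (c * \<gamma>)"] cg by (intro power_mono) auto
    also have "\<dots> = exp (- (c * (\<gamma> * real N)))" by (simp add: exp_of_nat_mult[symmetric] mult_ac)
    also have "\<dots> \<le> exp (- c)" using gN c by simp
    finally have "(1 - c * \<gamma>) ^ N * W x \<le> exp (- c) * W x" using W0 by (intro mult_right_mono) auto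
    then have "p * ((1 - c * \<gamma>) ^ N * W x) \<le> p * (exp (- c) * W x)" using f by (intro mult_left_mono) auto
    then show ?thesis using dp[OF f, of N x] by (simp add: P_def distrib_left)
  qed
  have P_minor: "\<bar>P f x - P f y\<bar> \<le> 2 * (1 - \<epsilon>) * C"
    if f: "f \<in> bmf" "C \<ge> 0" "\<And>x. \<bar>f x\<bar> \<le> C" and S: "W x + W y \<le> 2 * (2 * K0 + 1) / (1 - exp (- c))" for f C x y
  proof -
    have x: "norm x \<le> r" "norm y \<le> r"
      using S W0[of x] W0[of y] by (auto intro!: level simp: K0_def)
    have r: "r \<ge> 0" using x(1) norm_ge_zero[of x] by linarith
    \<comment> \<open>The diameter \<open>2 * r\<close> and the denominator
      \<open>4 * \<gamma> * N\<close>, at least 4, give log-Harnack cost at most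
      \<open>r\<^sup>2\<close>.\<close>
    have "norm (x - y) \<le> 2 * r" using norm_triangle_ineq4[of x y] x by linarith
    then have "(norm (x - y))\<^sup>2 \<le> (2 * r)\<^sup>2" by (intro power_mono) auto
    also have "\<dots> \<le> r\<^sup>2 * (2 * (2 * \<gamma>) * real N)"
      using mult_left_mono[OF gN, of "4 * r\<^sup>2"] by (simp add: power_mult_distrib mult_ac)
    finally have D: "(norm (x - y))\<^sup>2 / (2 * (2 * \<gamma>) * real N) \<le> r\<^sup>2"
      using gam N0 by (simp add: pos_divide_le_eq)
    then have D': "(norm (y - x))\<^sup>2 / (2 * (2 * \<gamma>) * real N) \<le> r\<^sup>2" by (simp add: norm_minus_commute)
    have s: "2 * \<gamma> > 0" using gam by simp
    show ?thesis
      using tv_bound_of_log_harnack[OF T s N0 D eps f] tv_bound_of_log_harnack[OF T s N0 D' eps f]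
      unfolding P_def K_def by (simp add: abs_le_iff)
  qed
  have P_add: "P (\<lambda>x. f x + g x) x = P f x + P g x" if "f \<in> bmf" "g \<in> bmf" for f g x
    unfolding P_def by (simp add: kop_pow_add that)
  have contr: "\<bar>P f x - P f y\<bar> \<le> C * (1 - \<delta>) * (2 + \<beta> * W x + \<beta> * W y)"
    if "f \<in> bmf" "C \<ge> 0" "\<And>x y. \<bar>f x - f y\<bar> \<le> C * (2 + \<beta> * W x + \<beta> * W y)" for f C x y
    using c delta by (intro weighted_contraction[where W=W and P=P and Kb=K0 and \<epsilon>=\<epsilon> and l="exp (- c)" and \<beta>=\<beta> and \<delta>=\<delta>, OF W0 P_add _ _ _ K0 P_drift eps01 P_minor _ _ that])
      (auto simp: P_def beta K0_def)
  have Pbmf: "(P ^^ k) f \<in> bmf" if "f \<in> bmf" for k f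
    by (induction k) (auto simp: P_def intro: kop_pow_bmf that)
  have contr_pow: "\<bar>(P ^^ k) f x - (P ^^ k) f y\<bar> \<le> C * (1 - \<delta>) ^ k * (2 + \<beta> * W x + \<beta> * W y)"
    if f: "f \<in> bmf" and C: "C \<ge> 0" "\<And>x y. \<bar>f x - f y\<bar> \<le> C * (2 + \<beta> * W x + \<beta> * W y)" for f C x y k
  proof (induction k arbitrary: x y)
    case (Suc k)
    have "\<bar>P ((P ^^ k) f) x - P ((P ^^ k) f) y\<bar> \<le> (C * (1 - \<delta>) ^ k) * (1 - \<delta>) * (2 + \<beta> * W x + \<beta> * W y)"
      using Suc C d by (intro contr Pbmf f) auto
    then show ?case by (simp add: mult_ac)
  qed (use C in simp)
  define k j where "k = n div N" and "j = n mod N"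
  have n: "n = N * k + j" by (simp add: k_def j_def)
  define g where "g = (kop K ^^ j) f"
  have g: "g \<in> bmf" unfolding g_def by (intro kop_pow_bmf f)
  have gW: "\<bar>g x\<bar> \<le> (1 + K0) * W x" for x
  proof -
    have "\<bar>g x\<bar> \<le> 1 * ((1 - c * \<gamma>) ^ j * W x) + (1 * K0 + 0)"
      unfolding g_def using f by (intro dp) auto
    also have "\<dots> \<le> 1 * W x + K0 * W x"
      using W0[of x] W1[of x] K0 cg mult_left_mono[OF W1[of x] K0]
      by (intro add_mono) (auto intro!: mult_left_le_one_le power_le_one)
    finally show ?thesis by (simp add: distrib_right)
  qed
  have osc: "\<bar>g x - g y\<bar> \<le> (1 + K0) / \<beta> * (2 + \<beta> * W x + \<beta> * W y)" for x y
  proof -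
    have "\<bar>g x - g y\<bar> \<le> (1 + K0) * (W x + W y)" using gW[of x] gW[of y] by (simp add: distrib_left)
    also have "\<dots> = (1 + K0) / \<beta> * (\<beta> * W x + \<beta> * W y)" using b0 by (simp add: field_simps)
    also have "\<dots> \<le> (1 + K0) / \<beta> * (2 + \<beta> * W x + \<beta> * W y)"
      using K0 b0 by (intro mult_left_mono) auto
    finally show ?thesis .
  qed
  have Peq: "(P ^^ k) h = (kop K ^^ (N * k)) h" for h unfolding P_def by (simp add: funpow_mult mult.commute)
  have "(kop K ^^ n) f = (P ^^ k) g"
    unfolding n funpow_add o_def g_def Peq ..
  then have "\<bar>(kop K ^^ n) f x - (kop K ^^ n) f y\<bar> \<le> (1 + K0) / \<beta> * (1 - \<delta>) ^ k * (2 + \<beta> * W x + \<beta> * W y)"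
    using contr_pow[OF g _ osc] K0 b0 by simp
  also have "\<dots> \<le> (1 + K0) / \<beta> * (\<rho> powr (\<gamma> * real n) / (1 - \<delta>)) * ((2 + \<beta>) * (W x + W y))"
  proof (intro mult_mono)
    have "real n \<le> real N * (real k + 1)"
    proof -
      have "n \<le> N * (k + 1)" using n mod_less_divisor[OF N0, of n] by (simp add: j_def)
      then have "real n \<le> real (N * (k + 1))" by (rule of_nat_mono)
      then show ?thesis by (simp add: distrib_left)
    qed
    also have "\<dots> \<le> ((1 + gb) / \<gamma>) * (real k + 1)"
    proof (rule mult_right_mono)
      have "1 / \<gamma> + 1 = (1 + \<gamma>) / \<gamma>" using gam by (simp add: field_simps)
      also have "\<dots> \<le> (1 + gb) / \<gamma>" using gam by (intro divide_right_mono) auto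
      finally show "real N \<le> (1 + gb) / \<gamma>" using N2 by linarith
    qed simp
    finally have "\<gamma> * real n / (1 + gb) - 1 \<le> real k" using gam by (simp add: field_simps)
    then have "(1 - \<delta>) powr real k \<le> (1 - \<delta>) powr (\<gamma> * real n / (1 + gb) - 1)"
      using d by (intro powr_mono') auto
    also have "\<dots> = \<rho> powr (\<gamma> * real n) / (1 - \<delta>)"
      using d by (simp add: rho powr_powr powr_diff)
    finally show "(1 - \<delta>) ^ k \<le> \<rho> powr (\<gamma> * real n) / (1 - \<delta>)" using d by (simp add: powr_realpow)
    show "2 + \<beta> * W x + \<beta> * W y \<le> (2 + \<beta>) * (W x + W y)"
      using W1[of x] W1[of y] by (simp add: algebra_simps)
  qed (use K0 b0 d W0 in auto)
  also have "\<dots> = A * \<rho> powr (\<gamma> * real n) * (W x + W y)" by (simp add: A K0_def)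
  finally show ?thesis .
qed

section \<open>Invariant measures and convergence in the weighted norm\<close>

lemma wnorm_le:
  assumes "\<And>f. f \<in> bmf \<Longrightarrow> (\<And>x. \<bar>f x\<bar> \<le> W x) \<Longrightarrow> \<bar>(\<integral>x. f x \<partial>\<mu>) - (\<integral>x. f x \<partial>\<nu>)\<bar> \<le> B"
  shows "wnorm W \<mu> \<nu> \<le> ereal B"
  unfolding wnorm_def using assms by (intro SUP_least) (auto simp: bmf_def)

context markov_kernel
begin

text \<open>Integrating the two-point contraction against the law after \<open>m\<close> further
  steps, and bounding that law by the drift, compares \<open>n\<close> with \<open>n + m\<close>
  steps from one point. This makes the laws Cauchy uniformly over sets, and letting \<open>m\<close>
  grow gives the distance to the limit.\<close>

lemma invariant_measure_exists:
  assumes W[measurable]: "W \<in> borel_measurable borel" and W1: "\<And>x. W x \<ge> 1"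
    and drift: "\<And>x. (\<integral>\<^sup>+y. ennreal (W y) \<partial>K x) \<le> ennreal ((1 - t) * W x + s)"
    and t: "0 < t" "t \<le> 1" and s: "s \<ge> 0" and A: "A \<ge> 0" and r: "0 < r" "r < 1"
    and contr: "\<And>f n x y. f \<in> bmf \<Longrightarrow> (\<And>x. \<bar>f x\<bar> \<le> W x)
      \<Longrightarrow> \<bar>(kop K ^^ n) f x - (kop K ^^ n) f y\<bar> \<le> A * r ^ n * (W x + W y)"
  shows "\<exists>\<pi>. invariant_prob \<pi> K
    \<and> (\<forall>x n. wnorm W (kiter K n x) \<pi> \<le> ereal (A * (2 + s / t) * r ^ n * W x))
    \<and> (\<forall>x y n. wnorm W (kiter K n x) (kiter K n y) \<le> ereal (A * r ^ n * (W x + W y)))"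
proof -
  have W0: "W x \<ge> 0" for x using W1[of x] by linarith
  have st: "s / t \<ge> 0" using s t by simp
  have shift: "\<bar>(kop K ^^ n) f x - (kop K ^^ (n + m)) f x\<bar> \<le> A * (2 + s / t) * r ^ n * W x"
    if f: "f \<in> bmf" "\<And>x. \<bar>f x\<bar> \<le> W x" for f n m x
  proof -
    define p where "p = A * r ^ n"
    have p: "p \<ge> 0" using A r by (simp add: p_def)
    \<comment> \<open>Centred at the starting point, so that its \<open>m\<close>-step expectation
      from \<open>x\<close> is the difference of the iterates \<open>n + m\<close> and
      \<open>n\<close>.\<close>
    define h where "h y = (kop K ^^ n) f y - (kop K ^^ n) f x" for y
    have h: "h \<in> bmf" unfolding h_def by (intro bmf_diff kop_pow_bmf f bmf_const)
    have hW: "\<bar>h y\<bar> \<le> p * W y + p * W x" for y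
      using contr[OF f, of n y x] by (simp add: h_def p_def distrib_left)
    have "\<bar>(kop K ^^ m) h x\<bar> \<le> p * ((1 - t) ^ m * W x) + (p * (s / t) + p * W x)"
      using p W0 by (intro drift_pow[OF W W0 drift t s h p _ hW]) auto
    also have "\<dots> \<le> p * W x + (p * (s / t * W x) + p * W x)"
    proof -
      have "(1 - t) ^ m * W x \<le> 1 * W x" using t W0 by (intro mult_right_mono power_le_one) auto
      moreover have "s / t * 1 \<le> s / t * W x" using W1 st by (intro mult_left_mono) auto
      ultimately show ?thesis using p by (intro add_mono mult_left_mono) auto
    qed
    also have "\<dots> = A * (2 + s / t) * r ^ n * W x" by (simp add: p_def algebra_simps)
    also have "(kop K ^^ m) h x = (kop K ^^ (n + m)) f x - (kop K ^^ n) f x"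
      unfolding h_def
      by (subst kop_pow_diff) (auto intro: kop_pow_bmf f simp: add.commute[of n] funpow_add)
    finally show ?thesis by (simp add: abs_minus_commute)
  qed
  define \<mu> where "\<mu> n = kiter K n 0" for n
  have ind: "indicator B \<in> bmf" if "B \<in> sets borel" for B :: "'d set"
    using that by (intro bmfI[where B=1]) (auto simp: indicator_def)
  have indW: "\<bar>indicator B x\<bar> \<le> W x" for B and x :: 'd
    using W1[of x] by (auto simp: indicator_def)
  have meas: "measure (kiter K n x) B = (kop K ^^ n) (indicator B) x" if "B \<in> sets borel" for B n x
    using integral_kiter[OF ind[OF that], of n x] that by (simp add: sets_kiter)
  have e: "(\<lambda>n. A * (2 + s / t) * r ^ n * W 0) \<longlonglongrightarrow> 0"
    using r by (auto intro!: tendsto_eq_intros LIMSEQ_power_zero)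
  have \<mu>: "prob_space (\<mu> n)" "sets (\<mu> n) = sets borel" for n
    by (auto simp: \<mu>_def kiter_prob sets_kiter)
  have cau: "\<bar>measure (\<mu> n) B - measure (\<mu> (n + m)) B\<bar> \<le> A * (2 + s / t) * r ^ n * W 0"
    if "B \<in> sets borel" for B n m
    unfolding \<mu>_def meas[OF that] by (rule shift[OF ind[OF that] indW])
  obtain \<pi> where \<pi>: "prob_space \<pi>" "sets \<pi> = sets borel"
    and lim: "\<And>B. B \<in> sets borel \<Longrightarrow> (\<lambda>n. measure (\<mu> n) B) \<longlonglongrightarrow> measure \<pi> B"
    using setwise_limit_measure[OF \<mu> e cau] by blast
  have lim_int: "(\<lambda>n. (kop K ^^ n) f 0) \<longlonglongrightarrow> (\<integral>x. f x \<partial>\<pi>)" if "f \<in> bmf" for f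
    using setwise_limit_integral[OF kiter_prob sets_kiter \<pi> lim[unfolded \<mu>_def] that]
    by (simp add: integral_kiter[OF that])
  have lim_int': "(\<lambda>n. (kop K ^^ n) f x) \<longlonglongrightarrow> (\<integral>x. f x \<partial>\<pi>)"
    if f: "f \<in> bmf" "\<And>x. \<bar>f x\<bar> \<le> W x" for f x
  proof -
    have "(\<lambda>n. (kop K ^^ n) f x - (kop K ^^ n) f 0) \<longlonglongrightarrow> 0"
    proof (rule Lim_null_comparison)
      show "\<forall>\<^sub>F n in sequentially. norm ((kop K ^^ n) f x - (kop K ^^ n) f 0) \<le> A * r ^ n * (W x + W 0)"
        using contr[OF f] by (intro always_eventually) auto
      show "(\<lambda>n. A * r ^ n * (W x + W 0)) \<longlonglongrightarrow> 0"
        using r by (auto intro!: tendsto_eq_intros LIMSEQ_power_zero)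
    qed
    from tendsto_add[OF this lim_int[OF f(1)]] show ?thesis by simp
  qed
  have "invariant_prob \<pi> K"
    unfolding invariant_prob_def
  proof (intro conjI \<pi>)
    show "\<pi> \<bind> K = \<pi>"
    proof (rule measure_eqI)
      show "sets (\<pi> \<bind> K) = sets \<pi>" using prob_bind(2)[OF \<pi>] \<pi> by simp
      fix B assume "B \<in> sets (\<pi> \<bind> K)"
      then have B: "B \<in> sets borel" using prob_bind(2)[OF \<pi>] by simp
      have "measure (\<pi> \<bind> K) B = (\<integral>x. indicator B x \<partial>(\<pi> \<bind> K))"
        using B prob_bind(2)[OF \<pi>] by simp
      also have "\<dots> = (\<integral>x. kop K (indicator B) x \<partial>\<pi>)" by (rule prob_bind(3)[OF \<pi> ind[OF B]])
      \<comment> \<open>Both sides are limits of one sequence up to a shift of the index. Setwise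
        convergence, unlike weak convergence, applies to the merely measurable function
        \<open>kop K (indicator B)\<close>.\<close>
      also have "\<dots> = (\<integral>x. indicator B x \<partial>\<pi>)"
      proof (rule LIMSEQ_unique)
        show "(\<lambda>n. (kop K ^^ n) (kop K (indicator B)) 0) \<longlonglongrightarrow> (\<integral>x. kop K (indicator B) x \<partial>\<pi>)"
          by (rule lim_int[OF kop_bmf[OF ind[OF B]]])
        have "(\<lambda>n. (kop K ^^ Suc n) (indicator B) 0) \<longlonglongrightarrow> (\<integral>x. indicator B x \<partial>\<pi>)"
          by (rule LIMSEQ_Suc[OF lim_int[OF ind[OF B]]])
        then show "(\<lambda>n. (kop K ^^ n) (kop K (indicator B)) 0) \<longlonglongrightarrow> (\<integral>x. indicator B x \<partial>\<pi>)"
          by (simp add: funpow_swap1)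
      qed
      also have "\<dots> = measure \<pi> B" using B \<pi> by simp
      finally have "measure (\<pi> \<bind> K) B = measure \<pi> B" .
      then show "emeasure (\<pi> \<bind> K) B = emeasure \<pi> B"
        using prob_space.finite_measure[OF \<pi>(1)] prob_space.finite_measure[OF prob_bind(1)[OF \<pi>]]
        by (simp add: finite_measure.emeasure_eq_measure)
    qed
  qed
  moreover have "wnorm W (kiter K n x) \<pi> \<le> ereal (A * (2 + s / t) * r ^ n * W x)" for n x
  proof (rule wnorm_le)
    fix f assume f: "f \<in> bmf" "\<And>x. \<bar>f x\<bar> \<le> W x"
    have "(\<lambda>m. \<bar>(kop K ^^ n) f x - (kop K ^^ (m + n)) f x\<bar>) \<longlonglongrightarrow> \<bar>(kop K ^^ n) f x - (\<integral>x. f x \<partial>\<pi>)\<bar>"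
      by (intro tendsto_intros LIMSEQ_ignore_initial_segment lim_int'[OF f])
    then have "\<bar>(kop K ^^ n) f x - (\<integral>x. f x \<partial>\<pi>)\<bar> \<le> A * (2 + s / t) * r ^ n * W x"
      by (rule LIMSEQ_le_const2) (use shift[OF f, of n x] in \<open>auto simp: add.commute[of n]\<close>)
    then show "\<bar>(\<integral>x. f x \<partial>kiter K n x) - (\<integral>x. f x \<partial>\<pi>)\<bar> \<le> A * (2 + s / t) * r ^ n * W x"
      by (simp add: integral_kiter[OF f(1)])
  qed
  moreover have "wnorm W (kiter K n x) (kiter K n y) \<le> ereal (A * r ^ n * (W x + W y))" for n x y
    by (rule wnorm_le) (use contr in \<open>auto simp: integral_kiter\<close>)
  ultimately show ?thesis by blast
qed

end

definition geom_ergodic :: "('d::euclidean_space \<Rightarrow> real) \<Rightarrow> real \<Rightarrow> real \<Rightarrow> ('d \<Rightarrow> 'd measure) \<Rightarrow> bool" where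
  "geom_ergodic W A r K \<longleftrightarrow> (\<exists>\<pi>. invariant_prob \<pi> K
    \<and> (\<forall>x n. wnorm W (kiter K n x) \<pi> \<le> ereal (A * r ^ n * W x))
    \<and> (\<forall>x y n. wnorm W (kiter K n x) (kiter K n y) \<le> ereal (A * r ^ n * (W x + W y))))"

text \<open>The order of quantifiers is the content: \<open>A\<close> and \<open>\<rho>\<close> are
  fixed from \<open>W\<close>, \<open>c\<close>, \<open>b\<close> and \<open>gb\<close> before the
  mean map and the step size are chosen.\<close>

lemma uniform_ergodicity:
  fixes W :: "'d::euclidean_space \<Rightarrow> real"
  assumes W[measurable]: "W \<in> borel_measurable borel" and W1: "\<And>x. W x \<ge> 1"
    and level: "\<And>R. \<exists>r. \<forall>x. W x \<le> R \<longrightarrow> norm x \<le> r"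
    and c: "c > 0" "c * gb \<le> 1" and b: "b \<ge> 0" and gb: "gb > 0"
  shows "\<exists>A\<ge>0. \<exists>\<rho>\<in>{0<..<1::real}. \<forall>T \<gamma>. 0 < \<gamma> \<and> \<gamma> \<le> gb \<and> (\<forall>x y. norm (T x - T y) \<le> norm (x - y))
      \<and> (\<forall>x. (\<integral>\<^sup>+y. ennreal (W y) \<partial>gaussian (T x) (2 * \<gamma>)) \<le> ennreal ((1 - c * \<gamma>) * W x + b * \<gamma>))
    \<longrightarrow> geom_ergodic W A (\<rho> powr \<gamma>) (\<lambda>x. gaussian (T x) (2 * \<gamma>))"
proof -
  obtain r where r: "\<And>x. W x \<le> 2 * (2 * (b / c) + 1) / (1 - exp (- c)) \<Longrightarrow> norm x \<le> r"
    using level by blast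
  define \<epsilon> where "\<epsilon> = 1 / (r\<^sup>2 + 1 + exp (r\<^sup>2 + 1))"
  define \<beta> where "\<beta> = \<epsilon> / (2 * (b / c + 1))"
  define \<delta> where "\<delta> = min ((1 - exp (- c)) / 2) (\<beta> / 2)"
  define A where "A = (1 + b / c) / \<beta> * (2 + \<beta>) / (1 - \<delta>)"
  define \<rho> where "\<rho> = (1 - \<delta>) powr (1 / (1 + gb))"
  have K0: "b / c \<ge> 0" using b c by simp
  have "\<epsilon> > 0" unfolding \<epsilon>_def by (intro divide_pos_pos add_nonneg_pos add_nonneg_nonneg) auto
  then have b0: "\<beta> > 0" using K0 by (simp add: \<beta>_def)
  have "\<delta> \<le> (1 - exp (- c)) / 2" unfolding \<delta>_def by (rule min.cobounded1)
  then have d: "0 < \<delta>" "\<delta> < 1"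
  proof -
    show "0 < \<delta>" using b0 c(1) by (simp add: \<delta>_def)
    have "\<delta> \<le> 1 / 2" by (rule order_trans[OF \<open>\<delta> \<le> _\<close>]) simp
    then show "\<delta> < 1" by linarith
  qed
  have A: "A \<ge> 0" using K0 b0 d by (simp add: A_def)
  have rho0: "\<rho> > 0" using d by (simp add: \<rho>_def)
  have rho1: "\<rho> < 1"
    using d gb powr_less_mono2[of "1 / (1 + gb)" "1 - \<delta>" 1] by (simp add: \<rho>_def)
  \<comment> \<open>The factor \<open>2 + b / c\<close> is the price of replacing the second
    starting point by the invariant measure; the larger constant serves both bounds.\<close>
  define A' where "A' = A * (2 + b / c)"
  have AA: "A \<le> A'" unfolding A'_def using A K0 mult_left_mono[of 1 "2 + b / c" A] by simp
  show ?thesis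
  proof (intro exI[of _ A'] conjI bexI[of _ \<rho>] allI impI)
    show "A' \<ge> 0" using A AA by linarith
    show "\<rho> \<in> {0<..<1}" using rho0 rho1 by simp
    fix T :: "'d \<Rightarrow> 'd" and \<gamma> :: real
    assume asm: "0 < \<gamma> \<and> \<gamma> \<le> gb \<and> (\<forall>x y. norm (T x - T y) \<le> norm (x - y))
      \<and> (\<forall>x. (\<integral>\<^sup>+y. ennreal (W y) \<partial>gaussian (T x) (2 * \<gamma>)) \<le> ennreal ((1 - c * \<gamma>) * W x + b * \<gamma>))"
    then have gam: "0 < \<gamma>" "\<gamma> \<le> gb" and T: "\<And>x y. norm (T x - T y) \<le> norm (x - y)"
      and drift: "\<And>x. (\<integral>\<^sup>+y. ennreal (W y) \<partial>gaussian (T x) (2 * \<gamma>)) \<le> ennreal ((1 - c * \<gamma>) * W x + b * \<gamma>)"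
      by auto
    define K where "K = (\<lambda>x. gaussian (T x) (2 * \<gamma>))"
    interpret markov_kernel K
      unfolding K_def by (rule gaussian_kernel[OF nonexpansive_measurable[OF T]]) (use gam in simp)
    have pw: "\<rho> powr (\<gamma> * real n) = (\<rho> powr \<gamma>) ^ n" for n
      using rho0 by (simp add: powr_powr[symmetric] powr_realpow)
    have cg: "0 < c * \<gamma>" "c * \<gamma> \<le> 1" "0 \<le> b * \<gamma>" "b * \<gamma> / (c * \<gamma>) = b / c"
      using c gam b order_trans[OF mult_left_mono[of \<gamma> gb c] c(2)] by auto
    have rg: "0 < \<rho> powr \<gamma>" "\<rho> powr \<gamma> < 1"
      using rho0 rho1 gam powr_less_mono2[of \<gamma> \<rho> 1] by auto
    have contr: "\<bar>(kop K ^^ n) f x - (kop K ^^ n) f y\<bar> \<le> A * (\<rho> powr \<gamma>) ^ n * (W x + W y)"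
      if "f \<in> bmf" "\<And>x. \<bar>f x\<bar> \<le> W x" for f n x y
      using gaussian_mean_kernel_contraction[OF W W1 r c b gam T drift \<epsilon>_def \<beta>_def \<delta>_def A_def \<rho>_def that, of n x y]
      unfolding K_def pw by simp
    have driftK: "(\<integral>\<^sup>+y. ennreal (W y) \<partial>K x) \<le> ennreal ((1 - c * \<gamma>) * W x + b * \<gamma>)" for x
      unfolding K_def by (rule drift)
    obtain \<pi> where \<pi>: "invariant_prob \<pi> K"
      "\<And>x n. wnorm W (kiter K n x) \<pi> \<le> ereal (A * (2 + b / c) * (\<rho> powr \<gamma>) ^ n * W x)"
      "\<And>x y n. wnorm W (kiter K n x) (kiter K n y) \<le> ereal (A * (\<rho> powr \<gamma>) ^ n * (W x + W y))"
      using invariant_measure_exists[OF W W1 driftK cg(1,2,3) A rg contr] unfolding cg(4) by blast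
    have "A * (\<rho> powr \<gamma>) ^ n * (W x + W y) \<le> A' * (\<rho> powr \<gamma>) ^ n * (W x + W y)" for n x y
      using AA W1[of x] W1[of y] by (intro mult_right_mono) auto
    then show "geom_ergodic W A' (\<rho> powr \<gamma>) (\<lambda>x. gaussian (T x) (2 * \<gamma>))"
      using \<pi> unfolding geom_ergodic_def K_def[symmetric] A'_def[symmetric]
      by (meson ereal_less_eq(3) order_trans)
  qed
qed

subsection \<open>Drift of the Lyapunov functions\<close>

text \<open>Turns a decay factor whose exponent is proportional to \<open>\<gamma>\<close> into
  \<open>1 - c * \<gamma>\<close>, with \<open>c\<close> uniform while the exponent stays
  bounded.\<close>

lemma exp_neg_le: "(z::real) \<ge> 0 \<Longrightarrow> exp (- z) \<le> 1 - z / (1 + z)"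
proof -
  assume z: "z \<ge> 0"
  have "exp (- z) = 1 / exp z" by (simp add: exp_minus field_simps)
  also have "\<dots> \<le> 1 / (1 + z)" using z exp_ge_add_one_self[of z] by (intro divide_left_mono) auto
  also have "\<dots> = 1 - z / (1 + z)" using z by (simp add: field_simps)
  finally show ?thesis .
qed

lemma exp_le_linear: "(z::real) \<le> H \<Longrightarrow> 0 \<le> z \<Longrightarrow> exp z \<le> 1 + z * exp H"
proof -
  assume z: "z \<le> H" "0 \<le> z"
  have "exp z * (1 - z) \<le> exp z * exp (- z)"
    using exp_ge_add_one_self[of "- z"] by (intro mult_left_mono) auto
  then have "exp z \<le> 1 + z * exp z" by (simp add: exp_minus algebra_simps)
  also have "z * exp z \<le> z * exp H" using z by (intro mult_left_mono) auto
  finally show ?thesis by simp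
qed

section \<open>The exponential Lyapunov function\<close>

lemma Walpha_measurable [measurable]: "Walpha \<alpha> \<in> borel_measurable borel"
  unfolding Walpha_def by measurable

text \<open>The square root is linearised by \<open>sqrt z \<le> B / 2 + z / (2 * B)\<close>, which makes the integral explicit.\<close>
lemma Walpha_gaussian:
  fixes u :: "'d::euclidean_space" and \<alpha> \<gamma> B :: real
  assumes a: "\<alpha> > 0" and g: "\<gamma> > 0" and B: "B > 0" "4 * \<gamma> * \<alpha> \<le> B"
  shows "(\<integral>\<^sup>+y. ennreal (Walpha \<alpha> y) \<partial>gaussian u (2 * \<gamma>))
    \<le> ennreal (exp (\<alpha> * (B / 2 + (1 + (norm u)\<^sup>2) / (2 * B)) + 2 * real DIM('d) * \<gamma> * \<alpha> / B
        + 2 * \<gamma> * \<alpha>\<^sup>2 * (norm u)\<^sup>2 / B\<^sup>2))"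
proof -
  define E0 where "E0 = \<alpha> * (B / 2 + (1 + (norm u)\<^sup>2) / (2 * B))"
  define v where "v = (\<alpha> / B) *\<^sub>R u"
  define \<beta> where "\<beta> = \<alpha> / (2 * B)"
  define t where "t = 2 * (2 * \<gamma>) * \<beta>"
  have t: "t = 2 * \<gamma> * \<alpha> / B" by (simp add: t_def \<beta>_def)
  \<comment> \<open>The lower bound on \<open>B\<close> keeps \<open>t\<close> away from the
    critical value 1, at which the Gaussian integral diverges.\<close>
  have t01: "0 < t" "t \<le> 1 / 2" using a g B by (auto simp: t field_simps)
  have pw: "Walpha \<alpha> (u + w) \<le> exp E0 * exp (v \<bullet> w + \<beta> * (norm w)\<^sup>2)" for w
  proof -
    have "sqrt (1 + (norm (u + w))\<^sup>2) \<le> B / 2 + (1 + (norm (u + w))\<^sup>2) / (2 * B)"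
    proof -
      define z where "z = sqrt (1 + (norm (u + w))\<^sup>2)"
      have z2: "z\<^sup>2 = 1 + (norm (u + w))\<^sup>2" by (simp add: z_def)
      have "0 \<le> (z - B)\<^sup>2" by simp
      then have "2 * B * z \<le> B\<^sup>2 + z\<^sup>2" by (simp add: power2_eq_square algebra_simps)
      then have "z \<le> B / 2 + z\<^sup>2 / (2 * B)" using B by (simp add: field_simps power2_eq_square)
      then show ?thesis unfolding z2 by (simp add: z_def)
    qed
    also have "\<dots> = (B / 2 + (1 + (norm u)\<^sup>2) / (2 * B)) + (u \<bullet> w) / B + (norm w)\<^sup>2 / (2 * B)"
    proof -
      have "(norm (u + w))\<^sup>2 = (norm u)\<^sup>2 + 2 * (u \<bullet> w) + (norm w)\<^sup>2"
        unfolding power2_norm_eq_inner by (simp add: inner_add_left inner_add_right inner_commute)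
      then show ?thesis using B by (simp add: field_simps)
    qed
    finally have "\<alpha> * sqrt (1 + (norm (u + w))\<^sup>2)
        \<le> \<alpha> * ((B / 2 + (1 + (norm u)\<^sup>2) / (2 * B)) + (u \<bullet> w) / B + (norm w)\<^sup>2 / (2 * B))"
      using a by (intro mult_left_mono) auto
    also have "\<dots> = E0 + (v \<bullet> w + \<beta> * (norm w)\<^sup>2)"
      by (simp add: E0_def v_def \<beta>_def distrib_left)
    finally show ?thesis by (simp add: Walpha_def exp_add[symmetric])
  qed
  have "(\<integral>\<^sup>+y. ennreal (Walpha \<alpha> y) \<partial>gaussian u (2 * \<gamma>))
      = (\<integral>\<^sup>+w. ennreal (Walpha \<alpha> (u + w)) \<partial>gaussian 0 (2 * \<gamma>))"
    by (rule nn_integral_gaussian_translate) simp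
  also have "\<dots> \<le> (\<integral>\<^sup>+w. ennreal (exp E0) * ennreal (exp (v \<bullet> w + \<beta> * (norm w)\<^sup>2)) \<partial>gaussian 0 (2 * \<gamma>))"
    using pw by (intro nn_integral_mono) (auto simp: ennreal_mult[symmetric] intro!: ennreal_leI)
  also have "\<dots> = ennreal (exp E0) * ennreal ((1 - t) powr (- real DIM('d) / 2)
      * exp (2 * \<gamma> * (norm v)\<^sup>2 / (2 * (1 - t))))"
    using g t01 unfolding t_def by (subst nn_integral_cmult, simp, subst gaussian_exp_quadratic) auto
  also have "\<dots> \<le> ennreal (exp E0) * ennreal (exp (real DIM('d) * t) * exp (2 * \<gamma> * (norm v)\<^sup>2))"
  proof (intro mult_left_mono ennreal_leI mult_mono)
    \<comment> \<open>For \<open>t <= 1 / 2\<close> one has \<open>exp (- 2 t) <= 1 - t\<close>, so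
      the determinant factor costs only a term linear in \<open>t\<close>, hence in
      \<open>\<gamma>\<close>, in the exponent.\<close>
    have "t * t \<le> 1 / 2 * t" using t01 by (intro mult_right_mono) auto
    then have "1 \<le> (1 - t) * (1 + 2 * t)" by (simp add: algebra_simps)
    also have "\<dots> \<le> (1 - t) * exp (2 * t)"
      using t01 exp_ge_add_one_self[of "2 * t"] by (intro mult_left_mono) auto
    finally have "exp (- (2 * t)) \<le> 1 - t" by (simp add: exp_minus field_simps)
    then have "(1 - t) powr (- real DIM('d) / 2) \<le> exp (- (2 * t)) powr (- real DIM('d) / 2)"
      by (intro powr_mono2') auto
    also have "\<dots> = exp (real DIM('d) * t)" by (simp add: powr_def)
    finally show "(1 - t) powr (- real DIM('d) / 2) \<le> exp (real DIM('d) * t)" .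
    have "2 * \<gamma> * (norm v)\<^sup>2 / (2 * (1 - t)) \<le> 2 * \<gamma> * (norm v)\<^sup>2 / 1"
      using t01 g by (intro divide_left_mono) auto
    then show "exp (2 * \<gamma> * (norm v)\<^sup>2 / (2 * (1 - t))) \<le> exp (2 * \<gamma> * (norm v)\<^sup>2)" by simp
  qed auto
  also have "\<dots> = ennreal (exp (E0 + real DIM('d) * t + 2 * \<gamma> * (norm v)\<^sup>2))"
    by (simp add: ennreal_mult[symmetric] exp_add)
  also have "2 * \<gamma> * (norm v)\<^sup>2 = 2 * \<gamma> * \<alpha>\<^sup>2 * (norm u)\<^sup>2 / B\<^sup>2"
    by (simp add: v_def power_mult_distrib power_divide)
  finally show ?thesis by (simp add: E0_def t mult_ac)
qed

text \<open>Linearising the root at \<open>B = A\<close>, its value at \<open>x\<close>, yields the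
  exponent \<open>\<alpha> * A + \<gamma> * \<alpha> * (2 * \<alpha> - \<eta> + Q / A)\<close>. The
  term \<open>2 * \<alpha>\<close> is the cost of the noise; since
  \<open>8 * \<alpha> < \<eta>\<close>, the bracket is at most \<open>- \<eta> / 2\<close> as soon
  as \<open>Q / A <= \<eta> / 4\<close>.\<close>

lemma Walpha_drift:
  fixes \<alpha> \<eta> C gb :: real
  assumes a: "\<alpha> > 0" "8 * \<alpha> < \<eta>" and C: "C \<ge> 0" and gb: "gb > 0"
  shows "\<exists>c>0. \<exists>b\<ge>0. c * gb \<le> 1 \<and> (\<forall>(u::'d::euclidean_space) (x::'d) \<gamma>. 0 < \<gamma> \<longrightarrow> \<gamma> \<le> gb \<longrightarrow>
      (norm u)\<^sup>2 \<le> (norm x)\<^sup>2 - 2 * \<gamma> * \<eta> * norm x + \<gamma> * C \<longrightarrow>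
      (\<integral>\<^sup>+y. ennreal (Walpha \<alpha> y) \<partial>gaussian u (2 * \<gamma>)) \<le> ennreal ((1 - c * \<gamma>) * Walpha \<alpha> x + b * \<gamma>))"
proof -
  define d where "d = real DIM('d)"
  have eta: "\<eta> > 0" using a by linarith
  \<comment> \<open>The extra \<open>2 * \<eta>\<close> comes from replacing \<open>norm x\<close>
    by the smooth \<open>A\<close>, which is at most \<open>1 + norm x\<close>.\<close>
  define C' where "C' = C + 2 * \<eta>"
  define Q where "Q = C' / 2 + 2 * d + 2 * \<alpha> * gb * C'"
  \<comment> \<open>Beyond \<open>K\<close> the correction \<open>Q / A\<close> is at most
    \<open>\<eta> / 4\<close>, and \<open>B = A\<close> is admissible for every step size up to
    \<open>gb\<close>.\<close>
  define K where "K = max 1 (max (4 * Q / \<eta>) (4 * gb * \<alpha>))"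
  define zb where "zb = gb * \<alpha> * \<eta> / 2"
  define c where "c = (\<alpha> * \<eta> / 2) / (1 + zb)"
  define H where "H = \<alpha> * (2 * \<alpha> + Q)"
  define E3 where "E3 = exp (\<alpha> * (K / 2 + (K\<^sup>2 + gb * C') / (2 * K)) + 2 * d * gb * \<alpha> / K
        + 2 * gb * \<alpha>\<^sup>2 * (K\<^sup>2 + gb * C') / K\<^sup>2)"
  define b where "b = c * exp (\<alpha> * K) + exp (\<alpha> * K) * (H * exp (gb * H)) + 4 * \<alpha> * E3"
  have C': "C' > 0" using C eta by (simp add: C'_def)
  have d0: "d \<ge> 0" by (simp add: d_def)
  have Q: "Q \<ge> 0" using C' d0 a gb by (simp add: Q_def)
  have K: "K \<ge> 1" "4 * Q \<le> \<eta> * K" "4 * gb * \<alpha> \<le> K"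
  proof -
    show "K \<ge> 1" "4 * gb * \<alpha> \<le> K" by (auto simp: K_def)
    have "4 * Q / \<eta> \<le> K" by (simp add: K_def)
    then show "4 * Q \<le> \<eta> * K" using eta by (simp add: field_simps)
  qed
  have zb: "zb > 0" using gb a eta by (simp add: zb_def)
  have c: "c > 0" using a eta zb by (simp add: c_def)
  have "c * gb = zb / (1 + zb)" by (simp add: c_def zb_def)
  then have cgb: "c * gb \<le> 1" using zb by simp
  have H: "H \<ge> 0" using a Q by (simp add: H_def)
  have E3: "E3 > 0" by (simp add: E3_def)
  have b: "b \<ge> 0" using c H a E3 by (simp add: b_def)
  have main: "(\<integral>\<^sup>+y. ennreal (Walpha \<alpha> y) \<partial>gaussian u (2 * \<gamma>)) \<le> ennreal ((1 - c * \<gamma>) * Walpha \<alpha> x + b * \<gamma>)"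
    if g: "0 < \<gamma>" "\<gamma> \<le> gb" and u: "(norm u)\<^sup>2 \<le> (norm x)\<^sup>2 - 2 * \<gamma> * \<eta> * norm x + \<gamma> * C" for u x :: 'd and \<gamma>
  proof -
    define A where "A = sqrt (1 + (norm x)\<^sup>2)"
    have A2: "A\<^sup>2 = 1 + (norm x)\<^sup>2" by (simp add: A_def)
    have A1: "A \<ge> 1" by (simp add: A_def)
    have "A \<le> 1 + norm x" unfolding A_def
      by (rule real_le_lsqrt) (auto simp: power2_eq_square algebra_simps)
    then have "2 * \<gamma> * \<eta> * A \<le> 2 * \<gamma> * \<eta> * (1 + norm x)" using g eta by (intro mult_left_mono) auto
    then have u1: "1 + (norm u)\<^sup>2 \<le> A\<^sup>2 - 2 * \<gamma> * \<eta> * A + \<gamma> * C'"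
      using u unfolding A2 C'_def by (simp add: algebra_simps)
    have gC: "\<gamma> * C' \<le> gb * C'" using g C' by (intro mult_right_mono) auto
    have "0 \<le> 2 * \<gamma> * \<eta> * A" using g eta A1 by simp
    then have u3: "1 + (norm u)\<^sup>2 \<le> A\<^sup>2 + gb * C'" using u1 gC by linarith
    then have u2: "(norm u)\<^sup>2 \<le> A\<^sup>2 + gb * C'" by linarith
    have W: "Walpha \<alpha> x = exp (\<alpha> * A)" by (simp add: Walpha_def A_def)
    have cg: "0 \<le> 1 - c * \<gamma>"
      using cgb c g mult_left_mono[of \<gamma> gb c] by linarith
    have near: "(\<integral>\<^sup>+y. ennreal (Walpha \<alpha> y) \<partial>gaussian u (2 * \<gamma>))
        \<le> ennreal (exp (\<alpha> * A + \<gamma> * \<alpha> * (2 * \<alpha> - \<eta> + Q / A)))" if "4 * \<gamma> * \<alpha> \<le> A"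
    proof -
      have "\<alpha> * (A / 2 + (1 + (norm u)\<^sup>2) / (2 * A)) \<le> \<alpha> * (A - \<gamma> * \<eta> + \<gamma> * (C' / 2) / A)"
      proof (rule mult_left_mono)
        have "(1 + (norm u)\<^sup>2) / (2 * A) \<le> (A\<^sup>2 - 2 * \<gamma> * \<eta> * A + \<gamma> * C') / (2 * A)"
          using u1 A1 by (intro divide_right_mono) auto
        also have "\<dots> = A / 2 - \<gamma> * \<eta> + \<gamma> * (C' / 2) / A"
          using A1 by (simp add: field_simps power2_eq_square)
        finally show "A / 2 + (1 + (norm u)\<^sup>2) / (2 * A) \<le> A - \<gamma> * \<eta> + \<gamma> * (C' / 2) / A" by simp
      qed (use a in simp)
      moreover have "2 * \<gamma> * \<alpha>\<^sup>2 * (norm u)\<^sup>2 / A\<^sup>2 \<le> 2 * \<gamma> * \<alpha>\<^sup>2 * (1 + gb * C' / A)"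
      proof -
        have "(norm u)\<^sup>2 / A\<^sup>2 \<le> (A\<^sup>2 + gb * C') / A\<^sup>2" using u2 by (intro divide_right_mono) auto
        also have "\<dots> = 1 + gb * C' / A\<^sup>2" using A1 by (simp add: add_divide_distrib)
        also have "gb * C' / A\<^sup>2 \<le> gb * C' / A"
          using A1 gb C' by (intro divide_left_mono) (auto simp: power2_eq_square)
        finally have "(2 * \<gamma> * \<alpha>\<^sup>2) * ((norm u)\<^sup>2 / A\<^sup>2) \<le> (2 * \<gamma> * \<alpha>\<^sup>2) * (1 + gb * C' / A)"
          using g by (intro mult_left_mono) auto
        then show ?thesis by simp
      qed
      moreover have "\<alpha> * (A - \<gamma> * \<eta> + \<gamma> * (C' / 2) / A) + 2 * d * \<gamma> * \<alpha> / A + 2 * \<gamma> * \<alpha>\<^sup>2 * (1 + gb * C' / A)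
          = \<alpha> * A + \<gamma> * \<alpha> * (2 * \<alpha> - \<eta> + Q / A)"
        using A1 by (simp add: Q_def field_simps power2_eq_square)
      ultimately have "\<alpha> * (A / 2 + (1 + (norm u)\<^sup>2) / (2 * A)) + 2 * d * \<gamma> * \<alpha> / A
          + 2 * \<gamma> * \<alpha>\<^sup>2 * (norm u)\<^sup>2 / A\<^sup>2 \<le> \<alpha> * A + \<gamma> * \<alpha> * (2 * \<alpha> - \<eta> + Q / A)" by linarith
      then show ?thesis
        using A1
        by (intro order_trans[OF Walpha_gaussian[OF a(1) g(1) _ that]] ennreal_leI) (auto simp: d_def)
    qed
    \<comment> \<open>For large \<open>A\<close> the exponent is negative. For bounded
      \<open>A\<close> and small \<open>\<gamma>\<close> the weight grows by a term of order
      \<open>\<gamma>\<close>. In the last case \<open>B = A\<close> may be inadmissible, but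
      \<open>\<gamma>\<close> is bounded below, so the constant bound \<open>E3\<close> obtained
      with \<open>B = K\<close> is itself at most a multiple of \<open>\<gamma>\<close>.\<close>
    consider "A \<ge> K" | "A < K" "4 * \<gamma> * \<alpha> \<le> 1" | "A < K" "4 * \<gamma> * \<alpha> > 1" by linarith
    then show ?thesis
    proof cases
      case 1
      have "4 * \<gamma> * \<alpha> \<le> 4 * gb * \<alpha>" using g a by simp
      then have gA: "4 * \<gamma> * \<alpha> \<le> A" using K 1 by linarith
      have "4 * Q \<le> \<eta> * A" using K(2) mult_left_mono[OF 1, of \<eta>] eta by linarith
      then have "Q / A \<le> \<eta> / 4" using A1 by (simp add: field_simps)
      then have "2 * \<alpha> - \<eta> + Q / A \<le> - (\<eta> / 2)" using a by linarith
      then have "\<gamma> * \<alpha> * (2 * \<alpha> - \<eta> + Q / A) \<le> \<gamma> * \<alpha> * (- (\<eta> / 2))" using g a by (intro mult_left_mono) auto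
      then have "exp (\<alpha> * A + \<gamma> * \<alpha> * (2 * \<alpha> - \<eta> + Q / A)) \<le> Walpha \<alpha> x * exp (- (\<gamma> * \<alpha> * \<eta> / 2))"
        by (simp add: W exp_add[symmetric])
      also have "\<dots> \<le> Walpha \<alpha> x * (1 - c * \<gamma>)"
      proof (rule mult_left_mono)
        define z where "z = \<gamma> * \<alpha> * \<eta> / 2"
        have z: "0 \<le> z" "z \<le> zb" using g a eta by (auto simp: z_def zb_def)
        have "exp (- z) \<le> 1 - z / (1 + z)" by (rule exp_neg_le[OF z(1)])
        also have "\<dots> \<le> 1 - z / (1 + zb)" using z by (intro diff_left_mono divide_left_mono) auto
        also have "z / (1 + zb) = c * \<gamma>" by (simp add: c_def z_def)
        finally show "exp (- (\<gamma> * \<alpha> * \<eta> / 2)) \<le> 1 - c * \<gamma>" by (simp add: z_def)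
      qed (simp add: Walpha_def)
      also have "\<dots> \<le> (1 - c * \<gamma>) * Walpha \<alpha> x + b * \<gamma>" using b g by simp
      finally show ?thesis by (rule order_trans[OF near[OF gA] ennreal_leI])
    next
      case 2
      then have gA: "4 * \<gamma> * \<alpha> \<le> A" using A1 by linarith
      have "Q / A \<le> Q / 1" using A1 Q by (intro divide_left_mono) auto
      then have "2 * \<alpha> - \<eta> + Q / A \<le> 2 * \<alpha> + Q" using eta by simp
      then have "\<gamma> * \<alpha> * (2 * \<alpha> - \<eta> + Q / A) \<le> \<gamma> * \<alpha> * (2 * \<alpha> + Q)" using g a by (intro mult_left_mono) auto
      then have "exp (\<alpha> * A + \<gamma> * \<alpha> * (2 * \<alpha> - \<eta> + Q / A)) \<le> Walpha \<alpha> x * exp (\<gamma> * H)"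
        by (simp add: W exp_add[symmetric] H_def mult_ac)
      also have "\<dots> \<le> Walpha \<alpha> x * (1 + \<gamma> * H * exp (gb * H))"
        using g H by (intro mult_left_mono exp_le_linear mult_right_mono) (auto simp: Walpha_def)
      also have "\<dots> = (1 - c * \<gamma>) * Walpha \<alpha> x + (c * Walpha \<alpha> x + Walpha \<alpha> x * (H * exp (gb * H))) * \<gamma>"
        by (simp add: algebra_simps)
      also have "\<dots> \<le> (1 - c * \<gamma>) * Walpha \<alpha> x + b * \<gamma>"
      proof -
        have WK: "Walpha \<alpha> x \<le> exp (\<alpha> * K)" using 2 a by (simp add: W)
        have "c * Walpha \<alpha> x + Walpha \<alpha> x * (H * exp (gb * H)) \<le> c * exp (\<alpha> * K) + exp (\<alpha> * K) * (H * exp (gb * H))"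
          using WK c H by (intro add_mono mult_left_mono mult_right_mono) auto
        also have "\<dots> \<le> b" using a E3 by (simp add: b_def)
        finally show ?thesis using g by (intro add_left_mono mult_right_mono) auto
      qed
      finally show ?thesis by (rule order_trans[OF near[OF gA] ennreal_leI])
    next
      case 3
      have gK: "4 * \<gamma> * \<alpha> \<le> K"
      proof -
        have "4 * \<gamma> * \<alpha> \<le> 4 * gb * \<alpha>" using g a by simp
        then show ?thesis using K by linarith
      qed
      have AK: "A\<^sup>2 \<le> K\<^sup>2" using 3 A1 by (intro power_mono) auto
      have u4: "1 + (norm u)\<^sup>2 \<le> K\<^sup>2 + gb * C'" "(norm u)\<^sup>2 \<le> K\<^sup>2 + gb * C'" using u3 u2 AK by linarith+
      have "exp (\<alpha> * (K / 2 + (1 + (norm u)\<^sup>2) / (2 * K)) + 2 * d * \<gamma> * \<alpha> / K + 2 * \<gamma> * \<alpha>\<^sup>2 * (norm u)\<^sup>2 / K\<^sup>2) \<le> E3"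
        unfolding E3_def exp_le_cancel_iff
      proof (intro add_mono)
        have "K / 2 + (1 + (norm u)\<^sup>2) / (2 * K) \<le> K / 2 + (K\<^sup>2 + gb * C') / (2 * K)"
          using u4 K(1) by (intro add_left_mono divide_right_mono) auto
        then show "\<alpha> * (K / 2 + (1 + (norm u)\<^sup>2) / (2 * K)) \<le> \<alpha> * (K / 2 + (K\<^sup>2 + gb * C') / (2 * K))"
          using a by (intro mult_left_mono) auto
        show "2 * d * \<gamma> * \<alpha> / K \<le> 2 * d * gb * \<alpha> / K"
          using g a d0 K(1) by (intro divide_right_mono mult_right_mono mult_left_mono) auto
        have "2 * \<gamma> * \<alpha>\<^sup>2 * (norm u)\<^sup>2 \<le> 2 * gb * \<alpha>\<^sup>2 * (norm u)\<^sup>2"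
          using g by (intro mult_right_mono) auto
        also have "\<dots> \<le> 2 * gb * \<alpha>\<^sup>2 * (K\<^sup>2 + gb * C')"
          using u4(2) gb by (intro mult_left_mono) auto
        finally show "2 * \<gamma> * \<alpha>\<^sup>2 * (norm u)\<^sup>2 / K\<^sup>2 \<le> 2 * gb * \<alpha>\<^sup>2 * (K\<^sup>2 + gb * C') / K\<^sup>2"
          by (rule divide_right_mono) simp
      qed
      also have "\<dots> \<le> E3 * (4 * \<gamma> * \<alpha>)" using 3 E3 by simp
      also have "\<dots> \<le> b * \<gamma>" 
      proof -
        have "4 * \<alpha> * E3 \<le> b" using c H by (simp add: b_def)
        from mult_right_mono[OF this, of \<gamma>] g show ?thesis by (simp add: mult_ac)
      qed
      also have "\<dots> \<le> (1 - c * \<gamma>) * Walpha \<alpha> x + b * \<gamma>" using cg by (simp add: Walpha_def)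
      finally show ?thesis
        using K(1) by (intro order_trans[OF Walpha_gaussian[OF a(1) g(1) _ gK]] ennreal_leI) (auto simp: d_def)
    qed
  qed
  show ?thesis by (rule exI[of _ c], rule conjI[OF c], rule exI[of _ b], intro conjI allI impI b cgb main)
qed

section \<open>The polynomial Lyapunov function\<close>

lemma Wq_measurable [measurable]: "Wq q \<in> borel_measurable borel"
  unfolding Wq_def by measurable

text \<open>To be read with \<open>r = (norm u)\<^sup>2\<close>, \<open>s = (norm w)\<^sup>2\<close>
  and \<open>t = 2 * (u \<bullet> w)\<close>, so that \<open>r + s + t\<close> and
  \<open>r + s - t\<close> are the squared norms of \<open>u + w\<close> and \<open>u - w\<close>.
  Symmetrising cancels the first order in \<open>w\<close>. The difference is carried along in the
  induction because the sum at the next exponent contains \<open>t\<close> times it, which is of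
  order \<open>t\<^sup>2\<close> and hence of order \<open>s\<close>.\<close>

lemma symmetric_power_sum:
  "\<exists>k e. k \<ge> 0 \<and> e \<ge> 0 \<and> (\<forall>r s t :: real. r \<ge> 0 \<longrightarrow> s \<ge> 0 \<longrightarrow> t\<^sup>2 \<le> 4 * r * s \<longrightarrow>
      (r + s + t) ^ Suc n + (r + s - t) ^ Suc n \<le> 2 * r ^ Suc n + k * s * (r + s) ^ n
    \<and> \<bar>(r + s + t) ^ Suc n - (r + s - t) ^ Suc n\<bar> \<le> e * \<bar>t\<bar> * (r + s) ^ n)"
proof (induction n)
  case 0
  show ?case by (intro exI[of _ 2]) auto
next
  case (Suc n)
  then obtain k e where ke: "k \<ge> 0" "e \<ge> 0"
    and IH: "\<And>r s t :: real. r \<ge> 0 \<Longrightarrow> s \<ge> 0 \<Longrightarrow> t\<^sup>2 \<le> 4 * r * s \<Longrightarrow>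
      (r + s + t) ^ Suc n + (r + s - t) ^ Suc n \<le> 2 * r ^ Suc n + k * s * (r + s) ^ n
    \<and> \<bar>(r + s + t) ^ Suc n - (r + s - t) ^ Suc n\<bar> \<le> e * \<bar>t\<bar> * (r + s) ^ n" by metis
  show ?case
  proof (rule exI[of _ "k + 2 + 4 * e"], rule exI[of _ "e + 2 * 2 ^ Suc n"], intro conjI allI impI)
    fix r s t :: real assume rs: "r \<ge> 0" "s \<ge> 0" and t2: "t\<^sup>2 \<le> 4 * r * s"
    define a where "a = r + s"
    define S where "S = (a + t) ^ Suc n + (a - t) ^ Suc n"
    define D where "D = (a + t) ^ Suc n - (a - t) ^ Suc n"
    have a: "a \<ge> 0" "r \<le> a" using rs by (auto simp: a_def)
    have "t\<^sup>2 \<le> a\<^sup>2" using t2 zero_le_power2[of "r - s"] by (simp add: a_def power2_eq_square algebra_simps)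
    then have ta: "\<bar>t\<bar> \<le> a" using a by (simp add: abs_le_square_iff[symmetric])
    have S: "S \<le> 2 * r ^ Suc n + k * s * a ^ n" and D: "\<bar>D\<bar> \<le> e * \<bar>t\<bar> * a ^ n"
      using IH[OF rs t2] unfolding S_def D_def a_def by auto
    have aS: "a * S \<le> 2 * r ^ Suc (Suc n) + (k + 2) * s * a ^ Suc n"
    proof -
      have "a * S \<le> a * (2 * r ^ Suc n + k * s * a ^ n)" using S a by (intro mult_left_mono) auto
      also have "\<dots> = 2 * r ^ Suc (Suc n) + 2 * s * r ^ Suc n + k * s * a ^ Suc n"
        by (simp add: a_def algebra_simps)
      also have "2 * s * r ^ Suc n \<le> 2 * s * a ^ Suc n" using rs a by (intro mult_left_mono power_mono) auto
      finally show ?thesis by (simp add: algebra_simps)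
    qed
    have "t * D \<le> \<bar>t\<bar> * \<bar>D\<bar>" by (metis abs_ge_self abs_mult)
    also have "\<dots> \<le> \<bar>t\<bar> * (e * \<bar>t\<bar> * a ^ n)" using D by (intro mult_left_mono) auto
    also have "\<dots> = e * a ^ n * t\<^sup>2" by (simp add: power2_eq_square)
    also have "\<dots> \<le> e * a ^ n * (4 * a * s)"
    proof (rule mult_left_mono)
      have "4 * r * s \<le> 4 * a * s" using a rs by (intro mult_right_mono) auto
      then show "t\<^sup>2 \<le> 4 * a * s" using t2 by linarith
    qed (use ke a in simp)
    finally have tD: "t * D \<le> 4 * e * s * a ^ Suc n" by (simp add: mult_ac)
    have "(a + t) ^ Suc (Suc n) + (a - t) ^ Suc (Suc n) = a * S + t * D"
      by (simp add: S_def D_def algebra_simps)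
    then show "(r + s + t) ^ Suc (Suc n) + (r + s - t) ^ Suc (Suc n)
        \<le> 2 * r ^ Suc (Suc n) + (k + 2 + 4 * e) * s * (r + s) ^ Suc n"
      using aS tD unfolding a_def[symmetric] by (simp add: distrib_right)
    have "\<bar>(a + t) ^ Suc n\<bar> \<le> (2 * a) ^ Suc n" "\<bar>(a - t) ^ Suc n\<bar> \<le> (2 * a) ^ Suc n"
      unfolding power_abs[of _ "Suc n"] using ta by (intro power_mono; simp)+
    then have "\<bar>S\<bar> \<le> 2 * 2 ^ Suc n * a ^ Suc n" unfolding S_def power_mult_distrib by linarith
    then have tS: "\<bar>t * S\<bar> \<le> \<bar>t\<bar> * (2 * 2 ^ Suc n * a ^ Suc n)" by (simp add: abs_mult mult_left_mono)
    have aD: "\<bar>a * D\<bar> \<le> a * (e * \<bar>t\<bar> * a ^ n)" using D a by (simp add: abs_mult mult_left_mono)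
    have "(a + t) ^ Suc (Suc n) - (a - t) ^ Suc (Suc n) = a * D + t * S"
      by (simp add: S_def D_def algebra_simps)
    then have "\<bar>(a + t) ^ Suc (Suc n) - (a - t) ^ Suc (Suc n)\<bar> \<le> a * (e * \<bar>t\<bar> * a ^ n) + \<bar>t\<bar> * (2 * 2 ^ Suc n * a ^ Suc n)"
      using tS aD by linarith
    then show "\<bar>(r + s + t) ^ Suc (Suc n) - (r + s - t) ^ Suc (Suc n)\<bar> \<le> (e + 2 * 2 ^ Suc n) * \<bar>t\<bar> * (r + s) ^ Suc n"
      unfolding a_def[symmetric] by (simp add: algebra_simps)
  qed (use ke in auto)
qed

lemma power_sum_le: "(a::real) \<ge> 0 \<Longrightarrow> b \<ge> 0 \<Longrightarrow> (a + b) ^ n \<le> 2 ^ n * (a ^ n + b ^ n)"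
proof -
  assume ab: "a \<ge> 0" "b \<ge> 0"
  have "(a + b) ^ n \<le> (2 * max a b) ^ n" using ab by (intro power_mono) auto
  also have "\<dots> = 2 ^ n * max (a ^ n) (b ^ n)"
    using ab power_mono[of a b n] power_mono[of b a n] by (auto simp: power_mult_distrib max_def)
  also have "\<dots> \<le> 2 ^ n * (a ^ n + b ^ n)" using ab by (intro mult_left_mono) auto
  finally show ?thesis .
qed

text \<open>Pairing \<open>w\<close> with \<open>- w\<close> makes the excess over the power of
  \<open>norm u\<close> of order \<open>\<gamma>\<close> rather than of order
  \<open>sqrt \<gamma>\<close>, as a drift condition needs.\<close>

lemma gaussian_shifted_even_moment:
  fixes gb :: real
  shows "\<exists>k\<ge>0. \<forall>(u::'d::euclidean_space) \<gamma>. 0 < \<gamma> \<longrightarrow> \<gamma> \<le> gb \<longrightarrow>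
    (\<integral>\<^sup>+y. ennreal (norm y ^ (2 * Suc n)) \<partial>gaussian u (2 * \<gamma>))
      \<le> ennreal (((norm u)\<^sup>2) ^ Suc n + \<gamma> * (k * (1 + ((norm u)\<^sup>2) ^ n)))"
proof -
  obtain k where k: "k \<ge> 0" and sym: "\<And>r s t :: real. r \<ge> 0 \<Longrightarrow> s \<ge> 0 \<Longrightarrow> t\<^sup>2 \<le> 4 * r * s \<Longrightarrow>
      (r + s + t) ^ Suc n + (r + s - t) ^ Suc n \<le> 2 * r ^ Suc n + k * s * (r + s) ^ n"
    using symmetric_power_sum[of n] by metis
  define m1 :: real where "m1 = 8 * 2 ^ DIM('d)"
  \<comment> \<open>The surplus powers of \<open>\<gamma>\<close> in the high moment are bounded by
    powers of \<open>gb\<close>; the absolute value makes the constant nonnegative for every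
    \<open>gb\<close>.\<close>
  define mn :: real where "mn = fact (Suc n) * 8 ^ Suc n * \<bar>gb\<bar> ^ n * 2 ^ DIM('d)"
  define h where "h = k / 2 * 2 ^ n"
  have h0: "h \<ge> 0" using k by (simp add: h_def)
  have m0: "m1 \<ge> 0" "mn \<ge> 0" by (auto simp: m1_def mn_def)
  have main: "(\<integral>\<^sup>+y. ennreal (norm y ^ (2 * Suc n)) \<partial>gaussian u (2 * \<gamma>))
      \<le> ennreal (((norm u)\<^sup>2) ^ Suc n + \<gamma> * (h * (m1 + mn) * (1 + ((norm u)\<^sup>2) ^ n)))"
    if g: "0 < \<gamma>" "\<gamma> \<le> gb" for u :: 'd and \<gamma>
  proof -
    interpret prob_space "gaussian (0::'d) (2 * \<gamma>)" by (rule prob_space_gaussian) (use g in simp)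
    define F where "F w = ennreal (norm (u + w) ^ (2 * Suc n))" for w
    define r where "r = (norm u)\<^sup>2"
    have r: "r \<ge> 0" by (simp add: r_def)
    have Fm[measurable]: "F \<in> borel_measurable borel" unfolding F_def by measurable
    have pw: "F w + F (- w) \<le> 2 * (ennreal (r ^ Suc n) + (ennreal (h * r ^ n) * ennreal (norm w ^ (2 * 1)) + ennreal h * ennreal (norm w ^ (2 * Suc n))))" for w
    proof -
      define s where "s = (norm w)\<^sup>2"
      define t where "t = 2 * (u \<bullet> w)"
      have s: "s \<ge> 0" by (simp add: s_def)
      have t2: "t\<^sup>2 \<le> 4 * r * s"
        using Cauchy_Schwarz_ineq[of u w] by (simp add: t_def r_def s_def power_mult_distrib power2_norm_eq_inner)
      have p: "(norm (u + w))\<^sup>2 = r + s + t" "(norm (u - w))\<^sup>2 = r + s - t"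
        unfolding r_def s_def t_def power2_norm_eq_inner
        by (simp_all add: inner_add_left inner_add_right inner_diff_left inner_diff_right inner_commute)
      have "norm (u + w) ^ (2 * Suc n) + norm (u - w) ^ (2 * Suc n) = (r + s + t) ^ Suc n + (r + s - t) ^ Suc n"
        unfolding power_mult p ..
      also have "\<dots> \<le> 2 * r ^ Suc n + k * s * (r + s) ^ n" by (rule sym[OF r s t2])
      also have "k * s * (r + s) ^ n \<le> k * s * (2 ^ n * (r ^ n + s ^ n))"
        using k s by (intro mult_left_mono power_sum_le r) auto
      also have "2 * r ^ Suc n + k * s * (2 ^ n * (r ^ n + s ^ n)) = 2 * (r ^ Suc n + (h * r ^ n * norm w ^ (2 * 1) + h * norm w ^ (2 * Suc n)))"
        unfolding power_mult s_def[symmetric] by (simp add: h_def algebra_simps)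
      finally have le: "norm (u + w) ^ (2 * Suc n) + norm (u - w) ^ (2 * Suc n)
        \<le> 2 * (r ^ Suc n + (h * r ^ n * norm w ^ (2 * 1) + h * norm w ^ (2 * Suc n)))" by simp
      have "F w + F (- w) = ennreal (norm (u + w) ^ (2 * Suc n) + norm (u - w) ^ (2 * Suc n))"
        by (simp add: F_def ennreal_plus del: power_Suc)
      also have "\<dots> \<le> ennreal (2 * (r ^ Suc n + (h * r ^ n * norm w ^ (2 * 1) + h * norm w ^ (2 * Suc n))))"
        by (rule ennreal_leI[OF le])
      also have "\<dots> = 2 * (ennreal (r ^ Suc n) + (ennreal (h * r ^ n) * ennreal (norm w ^ (2 * 1)) + ennreal h * ennreal (norm w ^ (2 * Suc n))))"
        using h0 r by (simp add: ennreal_mult ennreal_plus del: power_Suc)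
      finally show ?thesis .
    qed
    have mom: "(\<integral>\<^sup>+w. ennreal (norm (w::'d) ^ (2 * 1)) \<partial>gaussian 0 (2 * \<gamma>)) \<le> ennreal (\<gamma> * m1)"
      "(\<integral>\<^sup>+w. ennreal (norm (w::'d) ^ (2 * Suc n)) \<partial>gaussian 0 (2 * \<gamma>)) \<le> ennreal (\<gamma> * mn)"
    proof -
      have "2 * \<gamma> > 0" using g by simp
      note gm = gaussian_even_moment[OF this, where 'd='d]
      show "(\<integral>\<^sup>+w. ennreal (norm (w::'d) ^ (2 * 1)) \<partial>gaussian 0 (2 * \<gamma>)) \<le> ennreal (\<gamma> * m1)"
        using gm[of 1] by (simp add: m1_def mult_ac)
      have "fact (Suc n) * (4 * (2 * \<gamma>)) ^ Suc n * 2 ^ DIM('d) = (fact (Suc n) * 8 ^ Suc n * 2 ^ DIM('d) * \<gamma>) * \<gamma> ^ n"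
        by (simp add: power_mult_distrib)
      also have "\<dots> \<le> (fact (Suc n) * 8 ^ Suc n * 2 ^ DIM('d) * \<gamma>) * \<bar>gb\<bar> ^ n"
        using g by (intro mult_left_mono power_mono) auto
      finally have "fact (Suc n) * (4 * (2 * \<gamma>)) ^ Suc n * 2 ^ DIM('d) \<le> \<gamma> * mn"
        by (simp add: mn_def mult_ac)
      then show "(\<integral>\<^sup>+w. ennreal (norm (w::'d) ^ (2 * Suc n)) \<partial>gaussian 0 (2 * \<gamma>)) \<le> ennreal (\<gamma> * mn)"
        by (intro order_trans[OF gm[of "Suc n"] ennreal_leI])
    qed
    have I: "(\<integral>\<^sup>+y. ennreal (norm y ^ (2 * Suc n)) \<partial>gaussian u (2 * \<gamma>)) = (\<integral>\<^sup>+w. F w \<partial>gaussian 0 (2 * \<gamma>))"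
      unfolding F_def by (rule nn_integral_gaussian_translate) simp
    have "2 * (\<integral>\<^sup>+w. F w \<partial>gaussian 0 (2 * \<gamma>)) = (\<integral>\<^sup>+w. F w \<partial>gaussian 0 (2 * \<gamma>)) + (\<integral>\<^sup>+w. F (- w) \<partial>gaussian 0 (2 * \<gamma>))"
      by (simp only: mult_2 nn_integral_gaussian_symm[OF Fm, symmetric])
    also have "\<dots> = (\<integral>\<^sup>+w. F w + F (- w) \<partial>gaussian 0 (2 * \<gamma>))"
      by (subst nn_integral_add) auto
    also have "\<dots> \<le> (\<integral>\<^sup>+w. 2 * (ennreal (r ^ Suc n) + (ennreal (h * r ^ n) * ennreal (norm (w::'d) ^ (2 * 1)) + ennreal h * ennreal (norm w ^ (2 * Suc n)))) \<partial>gaussian 0 (2 * \<gamma>))"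
      by (intro nn_integral_mono pw)
    also have "\<dots> = 2 * (ennreal (r ^ Suc n) + (ennreal (h * r ^ n) * (\<integral>\<^sup>+w. ennreal (norm (w::'d) ^ (2 * 1)) \<partial>gaussian 0 (2 * \<gamma>))
        + ennreal h * (\<integral>\<^sup>+w. ennreal (norm (w::'d) ^ (2 * Suc n)) \<partial>gaussian 0 (2 * \<gamma>))))"
      using emeasure_space_1 by (simp add: nn_integral_add nn_integral_cmult del: power_Suc mult_Suc_right)
    also have "\<dots> \<le> 2 * (ennreal (r ^ Suc n) + (ennreal (h * r ^ n) * ennreal (\<gamma> * m1) + ennreal h * ennreal (\<gamma> * mn)))"
      by (intro mult_left_mono add_left_mono add_mono mom) auto
    also have "\<dots> = 2 * ennreal (r ^ Suc n + (h * r ^ n * (\<gamma> * m1) + h * (\<gamma> * mn)))"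
      using h0 r g m0 by (simp add: ennreal_mult ennreal_plus del: power_Suc)
    finally have "(\<integral>\<^sup>+w. F w \<partial>gaussian 0 (2 * \<gamma>)) \<le> ennreal (r ^ Suc n + (h * r ^ n * (\<gamma> * m1) + h * (\<gamma> * mn)))"
      by (subst (asm) ennreal_mult_le_mult_iff) auto
    also have "\<dots> \<le> ennreal (r ^ Suc n + \<gamma> * (h * (m1 + mn) * (1 + r ^ n)))"
    proof (intro ennreal_leI add_left_mono)
      have "0 \<le> \<gamma> * h * (m1 + mn * r ^ n)" using g h0 m0 r by simp
      then show "h * r ^ n * (\<gamma> * m1) + h * (\<gamma> * mn) \<le> \<gamma> * (h * (m1 + mn) * (1 + r ^ n))"
        by (simp add: algebra_simps)
    qed
    finally show ?thesis unfolding I r_def .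
  qed
  have "h * (m1 + mn) \<ge> 0" using h0 m0 by simp
  then show ?thesis using main by blast
qed

text \<open>The crossover is at \<open>X = p / e\<close>: above it the leading term dominates, below
  it the left side is bounded.\<close>

lemma power_absorb:
  fixes p e :: real
  assumes "e > 0" "p \<ge> 0" shows "\<exists>b\<ge>0. \<forall>X\<ge>0. p * X ^ n \<le> e * X ^ Suc n + b"
proof (intro exI[of _ "p * (p / e) ^ n"] conjI allI impI)
  fix X :: real assume X: "X \<ge> 0"
  show "p * X ^ n \<le> e * X ^ Suc n + p * (p / e) ^ n"
  proof (cases "X \<ge> p / e")
    case True
    then have "p \<le> e * X" using assms by (simp add: field_simps)
    then have "p * X ^ n \<le> (e * X) * X ^ n" using X by (intro mult_right_mono) auto
    moreover have "0 \<le> p * (p / e) ^ n" using assms by simp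
    ultimately show ?thesis by simp
  next
    case False
    then have "p * X ^ n \<le> p * (p / e) ^ n" using assms X by (intro mult_left_mono power_mono) auto
    moreover have "0 \<le> e * X ^ Suc n" using assms X by simp
    ultimately show ?thesis by simp
  qed
qed (use assms in simp)

text \<open>The increment is factored out explicitly, so that \<open>h = \<gamma> * C\<close>
  produces growth of order \<open>\<gamma>\<close>.\<close>

lemma power_add_le:
  fixes x h :: real assumes "x \<ge> 0" "h \<ge> 0"
  shows "(x + h) ^ Suc n \<le> x ^ Suc n + h * (real (Suc n) * (x + h) ^ n)"
proof (induction n)
  case (Suc n)
  have "(x + h) ^ Suc (Suc n) = (x + h) ^ Suc n * x + h * (x + h) ^ Suc n" by (simp add: algebra_simps)
  also have "(x + h) ^ Suc n * x \<le> (x ^ Suc n + h * (real (Suc n) * (x + h) ^ n)) * x"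
    using Suc assms by (intro mult_right_mono) auto
  also have "\<dots> = x ^ Suc (Suc n) + h * (real (Suc n) * ((x + h) ^ n * x))" by (simp add: algebra_simps)
  also have "(x + h) ^ n * x \<le> (x + h) ^ n * (x + h)" using assms by (intro mult_left_mono) auto
  finally have "(x + h) ^ Suc (Suc n) \<le> x ^ Suc (Suc n) + h * (real (Suc n) * ((x + h) ^ n * (x + h))) + h * (x + h) ^ Suc n"
    using assms by (auto simp: mult_left_mono)
  also have "\<dots> = x ^ Suc (Suc n) + h * (real (Suc (Suc n)) * (x + h) ^ Suc n)" by (simp add: algebra_simps)
  finally show ?case .
qed simp

text \<open>Raising the growth bound to the power \<open>q\<close> keeps half of the rate
  \<open>c1\<close>; the noise adds a power of lower order, absorbed at the cost of another quarter.
  The rate \<open>c1 / 4\<close> remains.\<close>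

lemma Wq_drift:
  fixes c1 C gb :: real
  assumes q: "q \<ge> 1" and c1: "c1 > 0" "c1 * gb \<le> 1" and C: "C \<ge> 0" and gb: "gb > 0"
  shows "\<exists>c>0. \<exists>b\<ge>0. c * gb \<le> 1 \<and> (\<forall>(u::'d::euclidean_space) (x::'d) \<gamma>. 0 < \<gamma> \<longrightarrow> \<gamma> \<le> gb \<longrightarrow>
      (norm u)\<^sup>2 \<le> (1 - c1 * \<gamma>) * (norm x)\<^sup>2 + \<gamma> * C \<longrightarrow>
      (\<integral>\<^sup>+y. ennreal (Wq q y) \<partial>gaussian u (2 * \<gamma>)) \<le> ennreal ((1 - c * \<gamma>) * Wq q x + b * \<gamma>))"
proof -
  obtain n where n: "q = Suc n" using q by (cases q) auto
  obtain k where k: "k \<ge> 0" and mom: "\<And>(u::'d) \<gamma>. 0 < \<gamma> \<Longrightarrow> \<gamma> \<le> gb \<Longrightarrow>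
    (\<integral>\<^sup>+y. ennreal (norm y ^ (2 * Suc n)) \<partial>gaussian u (2 * \<gamma>))
      \<le> ennreal (((norm u)\<^sup>2) ^ Suc n + \<gamma> * (k * (1 + ((norm u)\<^sup>2) ^ n)))"
    using gaussian_shifted_even_moment[of gb n] by blast
  obtain b2 where b2: "b2 \<ge> 0" "\<And>X. X \<ge> 0 \<Longrightarrow> k * 2 ^ n * X ^ n \<le> c1 / 4 * X ^ Suc n + b2"
    using power_absorb[of "c1 / 4" "k * 2 ^ n" n] c1 k by auto
  define X0 where "X0 = 2 * C / c1"
  define b1 where "b1 = C * (real (Suc n) * (X0 + gb * C) ^ n) + c1 / 2 * X0 ^ Suc n"
  define b3 where "b3 = b1 + k * (1 + 2 ^ n * (gb * C) ^ n) + b2"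
  define c where "c = c1 / 4"
  \<comment> \<open>The summand \<open>c\<close> compensates the decay factor acting on the constant
    1 in \<open>Wq\<close>.\<close>
  define b where "b = b3 + c"
  have X0: "X0 \<ge> 0" using C c1 by (simp add: X0_def)
  have b1: "b1 \<ge> 0" using C c1 X0 gb by (simp add: b1_def)
  have b3: "b3 \<ge> 0" using b1 b2 k gb C by (simp add: b3_def)
  have c: "c > 0" "c * gb \<le> 1" using c1 gb by (auto simp: c_def)
  have b: "b \<ge> 0" using b3 c by (simp add: b_def)
  have main: "(\<integral>\<^sup>+y. ennreal (Wq q y) \<partial>gaussian u (2 * \<gamma>)) \<le> ennreal ((1 - c * \<gamma>) * Wq q x + b * \<gamma>)"
    if g: "0 < \<gamma>" "\<gamma> \<le> gb" and u: "(norm u)\<^sup>2 \<le> (1 - c1 * \<gamma>) * (norm x)\<^sup>2 + \<gamma> * C" for u x :: 'd and \<gamma>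
  proof -
    interpret prob_space "gaussian u (2 * \<gamma>)" by (rule prob_space_gaussian) (use g in simp)
    define X where "X = (norm x)\<^sup>2"
    define Y where "Y = (norm u)\<^sup>2"
    have XY: "X \<ge> 0" "Y \<ge> 0" by (auto simp: X_def Y_def)
    have Y: "Y \<le> (1 - c1 * \<gamma>) * X + \<gamma> * C" using u by (simp add: X_def Y_def)
    have cg: "c1 * \<gamma> \<le> 1" using c1 g mult_left_mono[of \<gamma> gb c1] by linarith
    have "0 \<le> c1 * \<gamma> * X" using c1 g XY by simp
    then have Y1: "Y \<le> X + \<gamma> * C" using Y by (simp add: left_diff_distrib)
    have gC: "\<gamma> * C \<le> gb * C" using g C by (intro mult_right_mono) auto
    have Yn: "Y ^ Suc n \<le> (1 - \<gamma> * (c1 / 2)) * X ^ Suc n + \<gamma> * b1"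
    \<comment> \<open>Either half of the contraction beats the constant \<open>C\<close>, and a
      power of a factor below 1 is no larger, or \<open>X\<close> is bounded by \<open>X0\<close>
      and the growth is at most a constant times \<open>\<gamma>\<close>.\<close>
    proof (cases "C \<le> c1 / 2 * X")
      case True
      then have "\<gamma> * C \<le> \<gamma> * (c1 / 2 * X)" using g by (intro mult_left_mono) auto
      then have "Y \<le> (1 - \<gamma> * (c1 / 2)) * X" using Y by (simp add: algebra_simps)
      then have "Y ^ Suc n \<le> (1 - \<gamma> * (c1 / 2)) ^ Suc n * X ^ Suc n"
        using XY by (subst power_mult_distrib[symmetric]) (intro power_mono)
      also have "\<dots> \<le> (1 - \<gamma> * (c1 / 2)) * X ^ Suc n"
      proof (rule mult_right_mono)
        have "0 \<le> 1 - \<gamma> * (c1 / 2)" "1 - \<gamma> * (c1 / 2) \<le> 1" using cg g c1 by (auto simp: mult.commute)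
        then show "(1 - \<gamma> * (c1 / 2)) ^ Suc n \<le> 1 - \<gamma> * (c1 / 2)"
          by (simp add: mult_left_le power_le_one)
      qed (use XY in simp)
      finally show ?thesis using b1 g mult_nonneg_nonneg[of \<gamma> b1] by linarith
    next
      case False
      then have XX: "X \<le> X0" using c1 by (simp add: X0_def field_simps)
      have "Y ^ Suc n \<le> (X + \<gamma> * C) ^ Suc n" using Y1 XY by (intro power_mono) auto
      also have "\<dots> \<le> X ^ Suc n + (\<gamma> * C) * (real (Suc n) * (X + \<gamma> * C) ^ n)"
        using XY g C by (intro power_add_le) auto
      also have "(\<gamma> * C) * (real (Suc n) * (X + \<gamma> * C) ^ n) \<le> (\<gamma> * C) * (real (Suc n) * (X0 + gb * C) ^ n)"
        using XY g C XX gC by (intro mult_left_mono power_mono add_mono) auto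
      finally have 1: "Y ^ Suc n \<le> X ^ Suc n + \<gamma> * (C * (real (Suc n) * (X0 + gb * C) ^ n))" by (simp add: mult.assoc)
      have "X ^ Suc n \<le> X0 ^ Suc n" using XX XY by (intro power_mono) auto
      then have "\<gamma> * (c1 / 2) * X ^ Suc n \<le> \<gamma> * (c1 / 2) * X0 ^ Suc n" using g c1 by (intro mult_left_mono) auto
      then show ?thesis using 1 unfolding b1_def distrib_left left_diff_distrib by (simp only: mult.assoc)
    qed
    have "k * (1 + Y ^ n) \<le> k * (1 + 2 ^ n * (X ^ n + (gb * C) ^ n))"
    proof -
      have "Y ^ n \<le> (X + gb * C) ^ n" using Y1 gC XY by (intro power_mono) auto
      also have "\<dots> \<le> 2 ^ n * (X ^ n + (gb * C) ^ n)" using XY gb C by (intro power_sum_le) auto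
      finally show ?thesis using k by (intro mult_left_mono) auto
    qed
    also have "\<dots> = k * (1 + 2 ^ n * (gb * C) ^ n) + k * 2 ^ n * X ^ n" by (simp add: algebra_simps)
    also have "\<dots> \<le> k * (1 + 2 ^ n * (gb * C) ^ n) + (c1 / 4 * X ^ Suc n + b2)" using b2(2)[OF XY(1)] by simp
    finally have "\<gamma> * (k * (1 + Y ^ n)) \<le> \<gamma> * (k * (1 + 2 ^ n * (gb * C) ^ n) + (c1 / 4 * X ^ Suc n + b2))"
      using g by (intro mult_left_mono) auto
    then have "Y ^ Suc n + \<gamma> * (k * (1 + Y ^ n)) \<le> (1 - c * \<gamma>) * X ^ Suc n + b3 * \<gamma>"
      using Yn by (simp add: b3_def c_def algebra_simps)
    then have le: "1 + (Y ^ Suc n + \<gamma> * (k * (1 + Y ^ n))) \<le> (1 - c * \<gamma>) * (1 + X ^ Suc n) + b * \<gamma>"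
      by (simp add: b_def algebra_simps)
    have "(\<integral>\<^sup>+y. ennreal (Wq q y) \<partial>gaussian u (2 * \<gamma>)) = (\<integral>\<^sup>+y. 1 + ennreal (norm y ^ (2 * Suc n)) \<partial>gaussian u (2 * \<gamma>))"
      by (simp add: Wq_def n ennreal_plus del: power_Suc mult_Suc_right)
    also have "\<dots> = 1 + (\<integral>\<^sup>+y. ennreal (norm y ^ (2 * Suc n)) \<partial>gaussian u (2 * \<gamma>))"
      using emeasure_space_1 by (subst nn_integral_add) auto
    also have "\<dots> \<le> 1 + ennreal (Y ^ Suc n + \<gamma> * (k * (1 + Y ^ n)))"
      using mom[OF g, of u] unfolding Y_def by (rule add_left_mono)
    also have "\<dots> = ennreal (1 + (Y ^ Suc n + \<gamma> * (k * (1 + Y ^ n))))"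
      using XY g k by (subst ennreal_plus) auto
    also have "\<dots> \<le> ennreal ((1 - c * \<gamma>) * Wq q x + b * \<gamma>)"
      using le by (intro ennreal_leI) (simp add: Wq_def n X_def power_mult del: power_Suc mult_Suc_right)
    finally show ?thesis .
  qed
  show ?thesis by (rule exI[of _ c], rule conjI[OF c(1)], rule exI[of _ b], intro conjI allI impI b c(2) main)
qed

text \<open>Drift passes to fractional powers by the tangent line to the concave map \<open>z \<mapsto> z powr a\<close> at \<open>w\<close>.\<close>
lemma drift_powr:
  assumes M: "prob_space M" "sets M = sets borel"
    and W[measurable]: "W \<in> borel_measurable borel" and W1: "\<And>y. W y \<ge> (1::real)"
    and drift: "(\<integral>\<^sup>+y. ennreal (W y) \<partial>M) \<le> ennreal ((1 - t) * w + s)"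
    and w: "w \<ge> 1" and t: "t \<le> 1" and s: "s \<ge> 0" and a: "0 < a" "a \<le> 1"
  shows "(\<integral>\<^sup>+y. ennreal (W y powr a) \<partial>M) \<le> ennreal ((1 - a * t) * w powr a + a * s)"
proof -
  interpret prob_space M by fact
  note [measurable_cong] = M(2)
  define h where "h = w powr (a - 1)"
  have h: "0 < h" "h \<le> 1" using w a powr_mono[of "a - 1" 0 w] by (auto simp: h_def)
  have hw: "h * w = w powr a" using w by (simp add: h_def powr_diff)
  have pw: "W y powr a \<le> (h * a) * W y + h * ((1 - a) * w)" for y
  proof -
    \<comment> \<open>Young's inequality with weights \<open>a\<close> and \<open>1 - a\<close>;
      multiplied by \<open>h\<close> it is the tangent-line bound.\<close>
    have "W y powr a * w powr (1 - a) \<le> a * W y + (1 - a) * w"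
      using W1[of y] w a by (intro Youngs_inequality_0) auto
    then have "h * (W y powr a * w powr (1 - a)) \<le> h * (a * W y + (1 - a) * w)"
      using h by (intro mult_left_mono) auto
    moreover have "h * w powr (1 - a) = 1" using w by (simp add: h_def powr_add[symmetric])
    then have "h * (W y powr a * w powr (1 - a)) = W y powr a" by (metis mult.left_commute mult.right_neutral)
    ultimately show ?thesis by (simp add: distrib_left)
  qed
  have D: "(1 - t) * w + s \<ge> 0" using t w s by simp
  have "(\<integral>\<^sup>+y. ennreal (W y powr a) \<partial>M) \<le> (\<integral>\<^sup>+y. ennreal (h * a) * ennreal (W y) + ennreal (h * ((1 - a) * w)) \<partial>M)"
  proof (rule nn_integral_mono)
    fix y
    have "0 \<le> W y" using W1[of y] by linarith
    then have "ennreal (h * a) * ennreal (W y) + ennreal (h * ((1 - a) * w)) = ennreal ((h * a) * W y + h * ((1 - a) * w))"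
      using h a w by (simp add: ennreal_mult ennreal_plus)
    then show "ennreal (W y powr a) \<le> ennreal (h * a) * ennreal (W y) + ennreal (h * ((1 - a) * w))"
      using pw[of y] by (simp only: ennreal_leI)
  qed
  also have "\<dots> = ennreal (h * a) * (\<integral>\<^sup>+y. ennreal (W y) \<partial>M) + ennreal (h * ((1 - a) * w))"
    by (subst nn_integral_add) (auto simp: nn_integral_cmult emeasure_space_1)
  also have "\<dots> \<le> ennreal (h * a) * ennreal ((1 - t) * w + s) + ennreal (h * ((1 - a) * w))"
    using drift by (intro add_right_mono mult_left_mono) auto
  also have "\<dots> = ennreal ((h * a) * ((1 - t) * w + s) + h * ((1 - a) * w))"
    using h a w D by (simp add: ennreal_mult ennreal_plus)
  also have "\<dots> \<le> ennreal ((1 - a * t) * w powr a + a * s)"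
  proof (rule ennreal_leI)
    have "(h * a) * ((1 - t) * w + s) + h * ((1 - a) * w) = (1 - a * t) * (h * w) + h * (a * s)"
      by (simp add: algebra_simps)
    \<comment> \<open>Because \<open>w >= 1\<close>, the slope factor \<open>h\<close> is at most 1,
      so the additive constant does not grow.\<close>
    also have "h * (a * s) \<le> 1 * (a * s)" using h a s by (intro mult_right_mono) auto
    finally show "(h * a) * ((1 - t) * w + s) + h * ((1 - a) * w) \<le> (1 - a * t) * w powr a + a * s"
      by (simp add: hw)
  qed
  finally show ?thesis .
qed

subsection \<open>MYULA kernels\<close>

lemma Wq_ge_1: "Wq q x \<ge> 1"
  by (simp add: Wq_def)

lemma Walpha_ge_1: "\<alpha> > 0 \<Longrightarrow> Walpha \<alpha> x \<ge> 1"
  by (simp add: Walpha_def)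

lemma Wq_level: "q \<ge> 1 \<Longrightarrow> \<exists>r. \<forall>x. Wq q x \<le> R \<longrightarrow> norm x \<le> r"
proof (intro exI[of _ "max 1 R"] allI impI)
  fix x :: 'a assume q: "q \<ge> 1" and x: "Wq q x \<le> R"
  show "norm x \<le> max 1 R"
  proof (cases "norm x \<le> 1")
    case False
    then have "norm x ^ 1 \<le> norm x ^ (2 * q)" using q by (intro power_increasing) auto
    then show ?thesis using x by (simp add: Wq_def)
  qed simp
qed

lemma Walpha_level: "\<alpha> > 0 \<Longrightarrow> \<exists>r. \<forall>x. Walpha \<alpha> x \<le> R \<longrightarrow> norm x \<le> r"
proof (intro exI[of _ "R / \<alpha>"] allI impI)
  fix x :: 'a assume a: "\<alpha> > 0" and x: "Walpha \<alpha> x \<le> R"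
  have "norm x \<le> sqrt (1 + (norm x)\<^sup>2)" by (rule real_le_rsqrt) simp
  then have "\<alpha> * norm x \<le> \<alpha> * sqrt (1 + (norm x)\<^sup>2)" using a by (intro mult_left_mono) auto
  also have "\<dots> \<le> Walpha \<alpha> x"
    using exp_ge_add_one_self[of "\<alpha> * sqrt (1 + (norm x)\<^sup>2)"] unfolding Walpha_def by linarith
  finally have "\<alpha> * norm x \<le> R" using x by linarith
  then show "norm x \<le> R / \<alpha>" using a by (simp add: field_simps)
qed

lemma myula_eq: "myula gV U \<kappa> \<gamma> = (\<lambda>x. gaussian (myula_mean gV U \<kappa> \<gamma> x) (2 * \<gamma>))"
  by (simp add: myula_def myula_mean_def fun_eq_iff)

text \<open>The drift stays a hypothesis so that both Lyapunov families share this lemma. It is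
  first transferred to \<open>W powr a\<close>, with constants \<open>a * c\<close> and
  \<open>a * b\<close>, since contraction is wanted in that weight; sublevel sets of
  \<open>W powr a\<close> are sublevel sets of \<open>W\<close>.\<close>

lemma myula_ergodic_of_drift:
  fixes W :: "'d::euclidean_space \<Rightarrow> real"
  assumes W[measurable]: "W \<in> borel_measurable borel" and W1: "\<And>x. W x \<ge> 1"
    and level: "\<And>R. \<exists>r. \<forall>x. W x \<le> R \<longrightarrow> norm x \<le> r"
    and c: "c > 0" "c * gb \<le> 1" and b: "b \<ge> 0" and gb: "gb > 0" and a: "0 < a" "a \<le> 1"
  shows "\<exists>A\<ge>0. \<exists>\<rho>\<in>{0<..<1::real}. \<forall>V U gV L M R1 u0 \<kappa> \<gamma>. myula_potential V U gV L M R1 u0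
      \<and> 0 < \<gamma> \<and> \<gamma> \<le> gb \<and> \<kappa> > 0 \<and> \<gamma> * L + 1 / \<kappa> \<le> 2
      \<and> (\<forall>x. (\<integral>\<^sup>+y. ennreal (W y) \<partial>gaussian (myula_mean gV U \<kappa> \<gamma> x) (2 * \<gamma>)) \<le> ennreal ((1 - c * \<gamma>) * W x + b * \<gamma>))
    \<longrightarrow> geom_ergodic (\<lambda>z. W z powr a) A (\<rho> powr \<gamma>) (myula gV U \<kappa> \<gamma>)"
proof -
  have Wa1: "W x powr a \<ge> 1" for x using W1[of x] a by (simp add: ge_one_powr_ge_zero)
  have Wa_level: "\<exists>r. \<forall>x. W x powr a \<le> R \<longrightarrow> norm x \<le> r" for R
  proof -
    obtain r where r: "\<And>x. W x \<le> R powr (1 / a) \<Longrightarrow> norm x \<le> r" using level by blast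
    have "norm x \<le> r" if "W x powr a \<le> R" for x
    proof (rule r)
      have "(W x powr a) powr (1 / a) \<le> R powr (1 / a)" using that a by (intro powr_mono2) auto
      then show "W x \<le> R powr (1 / a)" using W1[of x] a by (simp add: powr_powr)
    qed
    then show ?thesis by blast
  qed
  have "a * c * gb \<le> 1 * 1"
    using a c gb mult_mono[of a 1 "c * gb" 1] by (simp add: mult.assoc)
  then have ac: "a * c > 0" "a * c * gb \<le> 1" "a * b \<ge> 0" using a b c by auto
  obtain A \<rho> where A: "A \<ge> 0" "\<rho> \<in> {0<..<1::real}"
    and erg: "\<And>T \<gamma>. 0 < \<gamma> \<and> \<gamma> \<le> gb \<and> (\<forall>x y. norm (T x - T y) \<le> norm (x - y))
      \<and> (\<forall>x. (\<integral>\<^sup>+y. ennreal (W y powr a) \<partial>gaussian (T x) (2 * \<gamma>)) \<le> ennreal ((1 - a * c * \<gamma>) * W x powr a + a * b * \<gamma>))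
    \<Longrightarrow> geom_ergodic (\<lambda>z. W z powr a) A (\<rho> powr \<gamma>) (\<lambda>x. gaussian (T x) (2 * \<gamma>))"
    using uniform_ergodicity[of "\<lambda>z. W z powr a", OF _ Wa1 Wa_level ac gb] by auto
  show ?thesis
  proof (rule exI[of _ A], rule conjI[OF A(1)], rule bexI[OF _ A(2)], intro allI impI)
    fix V U :: "'d \<Rightarrow> real" and gV :: "'d \<Rightarrow> 'd" and L M R1 u0 \<kappa> \<gamma> :: real
    assume asm: "myula_potential V U gV L M R1 u0
      \<and> 0 < \<gamma> \<and> \<gamma> \<le> gb \<and> \<kappa> > 0 \<and> \<gamma> * L + 1 / \<kappa> \<le> 2
      \<and> (\<forall>x. (\<integral>\<^sup>+y. ennreal (W y) \<partial>gaussian (myula_mean gV U \<kappa> \<gamma> x) (2 * \<gamma>)) \<le> ennreal ((1 - c * \<gamma>) * W x + b * \<gamma>))"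
    then interpret myula_potential V U gV L M R1 u0 by simp
    show "geom_ergodic (\<lambda>z. W z powr a) A (\<rho> powr \<gamma>) (myula gV U \<kappa> \<gamma>)"
      unfolding myula_eq
    proof (rule erg, intro conjI allI)
      show "0 < \<gamma>" "\<gamma> \<le> gb" using asm by auto
      show "norm (myula_mean gV U \<kappa> \<gamma> x - myula_mean gV U \<kappa> \<gamma> y) \<le> norm (x - y)" for x y
        using asm by (intro nonexpansive) auto
      fix x
      have "c * \<gamma> \<le> 1" using asm c mult_left_mono[of \<gamma> gb c] by linarith
      then have "(\<integral>\<^sup>+y. ennreal (W y powr a) \<partial>gaussian (myula_mean gV U \<kappa> \<gamma> x) (2 * \<gamma>))
          \<le> ennreal ((1 - a * (c * \<gamma>)) * W x powr a + a * (b * \<gamma>))"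
        using asm b by (intro drift_powr W W1 a prob_space_gaussian) auto
      then show "(\<integral>\<^sup>+y. ennreal (W y powr a) \<partial>gaussian (myula_mean gV U \<kappa> \<gamma> x) (2 * \<gamma>))
          \<le> ennreal ((1 - a * c * \<gamma>) * W x powr a + a * b * \<gamma>)" by (simp add: mult.assoc)
    qed
  qed
qed

theorem theorem4:
  fixes Theta :: "'t::euclidean_space set"
    and V Vb U Ub :: "'t \<Rightarrow> 'd::euclidean_space \<Rightarrow> real"
    and gV gVb :: "'t \<Rightarrow> 'd \<Rightarrow> 'd"
    and L M m \<eta> c kl kh gbar :: real
    and W :: "'d \<Rightarrow> real"
  assumes Theta_ne: "Theta \<noteq> {}"
    \<comment> \<open>H1 (a)\<close>
    and convex: "\<forall>\<theta>\<in>Theta. convex_on UNIV (V \<theta>) \<and> convex_on UNIV (Vb \<theta>)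
                   \<and> convex_on UNIV (U \<theta>) \<and> convex_on UNIV (Ub \<theta>)"
    and nonneg: "\<forall>\<theta>\<in>Theta. \<forall>x. V \<theta> x \<ge> 0 \<and> Vb \<theta> x \<ge> 0 \<and> U \<theta> x \<ge> 0 \<and> Ub \<theta> x \<ge> 0"
    and integrable: "\<forall>\<theta>\<in>Theta. integrable lborel (\<lambda>x. exp (- V \<theta> x - U \<theta> x))
                        \<and> integrable lborel (\<lambda>x. exp (- Vb \<theta> x - Ub \<theta> x))"
    and normconst: "\<exists>C>0. \<forall>\<theta>\<in>Theta. C \<le> (\<integral>x. exp (- V \<theta> x - U \<theta> x) \<partial>lborel)
                        \<and> C \<le> (\<integral>x. exp (- Vb \<theta> x - Ub \<theta> x) \<partial>lborel)"
    \<comment> \<open>H1 (b)\<close>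
    and gradV: "\<forall>\<theta>\<in>Theta. \<forall>x. (V \<theta> has_derivative (\<lambda>h. gV \<theta> x \<bullet> h)) (at x)
                        \<and> (Vb \<theta> has_derivative (\<lambda>h. gVb \<theta> x \<bullet> h)) (at x)"
    and L_nonneg: "L \<ge> 0"
    and lipV: "\<forall>\<theta>\<in>Theta. \<forall>x y. norm (gV \<theta> x - gV \<theta> y) \<le> L * norm (x - y)
                        \<and> norm (gVb \<theta> x - gVb \<theta> y) \<le> L * norm (x - y)"
    and minV: "\<exists>R1\<ge>0. \<exists>R2\<ge>0. \<forall>\<theta>\<in>Theta.
                 (\<exists>xs. (\<forall>z. V \<theta> xs \<le> V \<theta> z) \<and> norm xs \<le> R1 \<and> \<bar>V \<theta> xs\<bar> \<le> R2)
               \<and> (\<exists>xs. (\<forall>z. Vb \<theta> xs \<le> Vb \<theta> z) \<and> norm xs \<le> R1 \<and> \<bar>Vb \<theta> xs\<bar> \<le> R2)"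
    \<comment> \<open>H1 (c)\<close>
    and M_nonneg: "M \<ge> 0"
    and lipU: "\<forall>\<theta>\<in>Theta. \<forall>x y. \<bar>U \<theta> x - U \<theta> y\<bar> \<le> M * norm (x - y)
                        \<and> \<bar>Ub \<theta> x - Ub \<theta> y\<bar> \<le> M * norm (x - y)"
    and ptU: "\<exists>R1\<ge>0. \<exists>R2\<ge>0. \<forall>\<theta>\<in>Theta.
                 (\<exists>xs. norm xs \<le> R1 \<and> \<bar>U \<theta> xs\<bar> \<le> R2)
               \<and> (\<exists>xs. norm xs \<le> R1 \<and> \<bar>Ub \<theta> xs\<bar> \<le> R2)"
    \<comment> \<open>step-size and kappa ranges\<close>
    and kappas: "kh > 1" "1 \<ge> kl" "kl > 1/2"
    \<comment> \<open>H2 with its step-size bound and W = W_q, or H3 with its step-size bound and W = W_alpha\<close>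
    and cases:
      "(m > 0 \<and> (\<forall>\<theta>\<in>Theta. mconvex m (V \<theta>) \<and> mconvex m (Vb \<theta>))
          \<and> gbar * L < 2 - 1 / kl \<and> gbar < 2 / (m + L)
          \<and> (\<exists>q::nat. q \<ge> 1 \<and> W = Wq q))
     \<or> (\<eta> > 0 \<and> c \<ge> 0 \<and> (\<forall>\<theta>\<in>Theta. \<forall>x. min (U \<theta> x) (Ub \<theta> x) \<ge> \<eta> * norm x - c)
          \<and> gbar * L < 2 - 1 / kl \<and> gbar * (2 * M * L) < \<eta>
          \<and> (\<exists>\<alpha>>0. \<alpha> < min (kl * \<eta> / 4) (\<eta> / 8) \<and> W = Walpha \<alpha>))"
  shows "\<forall>a\<in>{0<..1::real}. \<exists>A\<ge>0. \<exists>\<rho>\<in>{0<..<1::real}.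
           \<forall>\<theta>\<in>Theta. \<forall>\<kappa>\<in>{kl..kh}. \<forall>\<gamma>\<in>{0<..gbar}.
             \<exists>\<pi> \<pi>b. invariant_prob \<pi> (myula (gV \<theta>) (U \<theta>) \<kappa> \<gamma>)
                 \<and> invariant_prob \<pi>b (myula (gVb \<theta>) (Ub \<theta>) \<kappa> \<gamma>)
                 \<and> (\<forall>x y. \<forall>n::nat.
                      max (wnorm (\<lambda>z. W z powr a) (kiter (myula (gV \<theta>) (U \<theta>) \<kappa> \<gamma>) n x) \<pi>)
                          (wnorm (\<lambda>z. W z powr a) (kiter (myula (gVb \<theta>) (Ub \<theta>) \<kappa> \<gamma>) n x) \<pi>b)
                        \<le> ereal (A * \<rho> powr (\<gamma> * real n) * W x powr a)
                    \<and> max (wnorm (\<lambda>z. W z powr a) (kiter (myula (gV \<theta>) (U \<theta>) \<kappa> \<gamma>) n x)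
                                  (kiter (myula (gV \<theta>) (U \<theta>) \<kappa> \<gamma>) n y))
                          (wnorm (\<lambda>z. W z powr a) (kiter (myula (gVb \<theta>) (Ub \<theta>) \<kappa> \<gamma>) n x)
                                  (kiter (myula (gVb \<theta>) (Ub \<theta>) \<kappa> \<gamma>) n y))
                        \<le> ereal (A * \<rho> powr (\<gamma> * real n) * (W x powr a + W y powr a)))"
proof (cases "gbar > 0")
  case False
  \<comment> \<open>Without a positive upper bound the range of step sizes is empty.\<close>
  then show ?thesis by (intro ballI exI[of _ 0] conjI bexI[of _ "1/2"]) auto
next
  case True
  note gb = True
  obtain R1 R2 where R1: "R1 \<ge> 0"
    and minV': "\<And>\<theta>. \<theta> \<in> Theta \<Longrightarrow> \<exists>xs. (\<forall>z. V \<theta> xs \<le> V \<theta> z) \<and> norm xs \<le> R1"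
      "\<And>\<theta>. \<theta> \<in> Theta \<Longrightarrow> \<exists>xs. (\<forall>z. Vb \<theta> xs \<le> Vb \<theta> z) \<and> norm xs \<le> R1"
    using minV by blast
  obtain S1 S2 where S: "S1 \<ge> 0" "S2 \<ge> 0"
    and ptU': "\<And>\<theta>. \<theta> \<in> Theta \<Longrightarrow> \<exists>xs. norm xs \<le> S1 \<and> \<bar>U \<theta> xs\<bar> \<le> S2"
      "\<And>\<theta>. \<theta> \<in> Theta \<Longrightarrow> \<exists>xs. norm xs \<le> S1 \<and> \<bar>Ub \<theta> xs\<bar> \<le> S2"
    using ptU by blast
  \<comment> \<open>The reference point of H1 (c) lies within \<open>S1\<close> of the origin, so
    the Lipschitz bound carries the estimate on \<open>U\<close> to 0.\<close>
  define u0 where "u0 = S2 + M * S1"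
  have u0: "u0 \<ge> 0" using S M_nonneg by (simp add: u0_def)
  have U0: "f 0 \<le> u0" if lip: "\<And>x y. \<bar>f x - f y\<bar> \<le> M * norm (x - y)"
    and xs: "norm xs \<le> S1" "\<bar>f xs\<bar> \<le> S2" for f :: "'d \<Rightarrow> real" and xs
  proof -
    have "f 0 - f xs \<le> M * norm xs" using lip[of 0 xs] by simp
    also have "\<dots> \<le> M * S1" using xs M_nonneg by (intro mult_left_mono) auto
    finally show ?thesis using xs by (simp add: u0_def)
  qed
  have pot: "myula_potential (V \<theta>) (U \<theta>) (gV \<theta>) L M R1 u0" "myula_potential (Vb \<theta>) (Ub \<theta>) (gVb \<theta>) L M R1 u0"
    if t: "\<theta> \<in> Theta" for \<theta>
  proof -
    obtain x1 x2 where "norm x1 \<le> S1" "\<bar>U \<theta> x1\<bar> \<le> S2" "norm x2 \<le> S1" "\<bar>Ub \<theta> x2\<bar> \<le> S2"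
      using ptU'[OF t] by blast
    then have "U \<theta> 0 \<le> u0" "Ub \<theta> 0 \<le> u0" using lipU t U0[of "U \<theta>" x1] U0[of "Ub \<theta>" x2] by auto
    then show "myula_potential (V \<theta>) (U \<theta>) (gV \<theta>) L M R1 u0" "myula_potential (Vb \<theta>) (Ub \<theta>) (gVb \<theta>) L M R1 u0"
      using convex nonneg gradV lipV lipU t L_nonneg M_nonneg R1 minV'[OF t]
      by (auto intro!: myula_potential.intro)
  qed
  have gL: "gbar * L < 2 - 1 / kl" using cases by blast
  have step: "0 < \<kappa>" "\<gamma> * L + 1 / \<kappa> \<le> 2" "\<gamma> * L \<le> 1" if "\<kappa> \<in> {kl..kh}" "\<gamma> \<in> {0<..gbar}" for \<kappa> \<gamma>
  proof -
    show k: "0 < \<kappa>" using that kappas by auto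
    have "\<gamma> * L \<le> gbar * L" using that L_nonneg by (intro mult_right_mono) auto
    moreover have "1 / \<kappa> \<le> 1 / kl" using that kappas by (intro divide_left_mono) auto
    \<comment> \<open>From \<open>kl <= 1\<close> the bound on \<open>gbar * L\<close> drops below
      1, which the growth estimates require in addition to nonexpansiveness.\<close>
    moreover have "1 \<le> 1 / kl" using kappas by (simp add: field_simps)
    ultimately show "\<gamma> * L + 1 / \<kappa> \<le> 2" "\<gamma> * L \<le> 1" using gL by linarith+
  qed
  define drift where "drift cc bb gV U \<kappa> \<gamma> \<longleftrightarrow>
      (\<forall>x. (\<integral>\<^sup>+y. ennreal (W y) \<partial>gaussian (myula_mean gV U \<kappa> \<gamma> x) (2 * \<gamma>)) \<le> ennreal ((1 - cc * \<gamma>) * W x + bb * \<gamma>))"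
    for cc bb and gV :: "'d \<Rightarrow> 'd" and U :: "'d \<Rightarrow> real" and \<kappa> \<gamma> :: real
  \<comment> \<open>H2 and H3 are reduced here to one statement: a weight with bounded sublevel sets
    and a drift with constants uniform in all parameters.\<close>
  obtain cc bb where W: "W \<in> borel_measurable borel" "\<And>x. W x \<ge> 1" "\<And>R. \<exists>r. \<forall>x. W x \<le> R \<longrightarrow> norm x \<le> r"
    and cc: "cc > 0" "cc * gbar \<le> 1" and bb: "bb \<ge> 0"
    and dr: "\<And>\<theta> \<kappa> \<gamma>. \<theta> \<in> Theta \<Longrightarrow> \<kappa> \<in> {kl..kh} \<Longrightarrow> \<gamma> \<in> {0<..gbar} \<Longrightarrow>
      drift cc bb (gV \<theta>) (U \<theta>) \<kappa> \<gamma> \<and> drift cc bb (gVb \<theta>) (Ub \<theta>) \<kappa> \<gamma>"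
    using cases
  proof (elim disjE conjE exE)
    fix q :: nat
    assume m: "m > 0" "\<forall>\<theta>\<in>Theta. mconvex m (V \<theta>) \<and> mconvex m (Vb \<theta>)" "gbar < 2 / (m + L)"
      and q: "1 \<le> q" "W = Wq q"
    define C where "C = 8 * M\<^sup>2 / m + m * R1\<^sup>2 / 2 + 2 * (R1 + gbar * M)\<^sup>2 * L + gbar * M\<^sup>2"
    have C: "C \<ge> 0" using m L_nonneg gb by (simp add: C_def)
    \<comment> \<open>The second step-size bound keeps the contraction factor
      \<open>1 - m / 8 * \<gamma>\<close> nonnegative.\<close>
    have "gbar * (m + L) < 2" using m L_nonneg by (simp add: field_simps)
    moreover have "0 \<le> gbar * L" using gb L_nonneg by simp
    ultimately have mg: "m / 8 * gbar \<le> 1" by (simp add: algebra_simps)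
    have m8: "m / 8 > 0" using m by simp
    obtain cc bb where cc: "cc > 0" "bb \<ge> 0" "cc * gbar \<le> 1"
      and dr: "\<And>(u::'d) (x::'d) \<gamma>. 0 < \<gamma> \<Longrightarrow> \<gamma> \<le> gbar \<Longrightarrow> (norm u)\<^sup>2 \<le> (1 - m / 8 * \<gamma>) * (norm x)\<^sup>2 + \<gamma> * C \<Longrightarrow>
        (\<integral>\<^sup>+y. ennreal (Wq q y) \<partial>gaussian u (2 * \<gamma>)) \<le> ennreal ((1 - cc * \<gamma>) * Wq q x + bb * \<gamma>)"
      using Wq_drift[OF q(1) m8 mg C gb] by blast
    show thesis
    proof (rule that[of cc bb])
      fix \<theta> \<kappa> \<gamma> assume t: "\<theta> \<in> Theta" "\<kappa> \<in> {kl..kh}" "\<gamma> \<in> {0<..gbar}"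
      have g: "0 < \<gamma>" "\<gamma> \<le> gbar" using t by auto
      have mc: "mconvex m (V \<theta>)" "mconvex m (Vb \<theta>)" using m(2) t by auto
      show "drift cc bb (gV \<theta>) (U \<theta>) \<kappa> \<gamma> \<and> drift cc bb (gVb \<theta>) (Ub \<theta>) \<kappa> \<gamma>"
        unfolding drift_def q(2)
        using dr[OF g myula_potential.growth_quadratic[OF pot(1)[OF t(1)] g step(1,3)[OF t(2,3)] m(1) mc(1), folded C_def]]
          dr[OF g myula_potential.growth_quadratic[OF pot(2)[OF t(1)] g step(1,3)[OF t(2,3)] m(1) mc(2), folded C_def]]
        by blast
    qed (use cc q in \<open>auto simp: Wq_ge_1 intro: Wq_level\<close>)
  next
    fix \<alpha>
    assume eta: "\<eta> > 0" "\<forall>\<theta>\<in>Theta. \<forall>x. min (U \<theta> x) (Ub \<theta> x) \<ge> \<eta> * norm x - c"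
      and al: "0 < \<alpha>" "\<alpha> < min (kl * \<eta> / 4) (\<eta> / 8)" "W = Walpha \<alpha>"
    define C where "C = 2 * (\<eta> * (gbar * kh * M) + \<bar>c\<bar> + u0) + 2 * (R1 + gbar * M)\<^sup>2 * L + gbar * M\<^sup>2"
    have C: "C \<ge> 0" using eta L_nonneg M_nonneg gb u0 kappas by (simp add: C_def)
    have a8: "8 * \<alpha> < \<eta>" using al by simp
    obtain cc bb where cc: "cc > 0" "bb \<ge> 0" "cc * gbar \<le> 1"
      and dr: "\<And>(u::'d) (x::'d) \<gamma>. 0 < \<gamma> \<Longrightarrow> \<gamma> \<le> gbar \<Longrightarrow> (norm u)\<^sup>2 \<le> (norm x)\<^sup>2 - 2 * \<gamma> * \<eta> * norm x + \<gamma> * C \<Longrightarrow>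
        (\<integral>\<^sup>+y. ennreal (Walpha \<alpha> y) \<partial>gaussian u (2 * \<gamma>)) \<le> ennreal ((1 - cc * \<gamma>) * Walpha \<alpha> x + bb * \<gamma>)"
      using Walpha_drift[OF al(1) a8 C gb] by blast
    show thesis
    proof (rule that[of cc bb])
      fix \<theta> \<kappa> \<gamma> assume t: "\<theta> \<in> Theta" "\<kappa> \<in> {kl..kh}" "\<gamma> \<in> {0<..gbar}"
      have g: "0 < \<gamma>" "\<gamma> \<le> gbar" and k: "\<kappa> \<le> kh" using t by auto
      have U: "U \<theta> x \<ge> \<eta> * norm x - c" "Ub \<theta> x \<ge> \<eta> * norm x - c" for x
        using eta(2) t(1) by auto
      show "drift cc bb (gV \<theta>) (U \<theta>) \<kappa> \<gamma> \<and> drift cc bb (gVb \<theta>) (Ub \<theta>) \<kappa> \<gamma>"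
        unfolding drift_def al(3)
        using dr[OF g myula_potential.growth_linear[OF pot(1)[OF t(1)] g step(1)[OF t(2,3)] k step(3)[OF t(2,3)] eta(1) U(1), folded C_def]]
          dr[OF g myula_potential.growth_linear[OF pot(2)[OF t(1)] g step(1)[OF t(2,3)] k step(3)[OF t(2,3)] eta(1) U(2), folded C_def]]
        by blast
    qed (use cc al in \<open>auto simp: Walpha_ge_1 intro: Walpha_level\<close>)
  qed
  show ?thesis
  proof
    fix a :: real assume "a \<in> {0<..1}"
    then have a: "0 < a" "a \<le> 1" by auto
    obtain A \<rho> where A: "A \<ge> 0" "\<rho> \<in> {0<..<1::real}"
      and erg: "\<And>V U gV L M R1 u0 \<kappa> \<gamma>. myula_potential V U gV L M R1 u0 \<Longrightarrow>
        0 < \<gamma> \<Longrightarrow> \<gamma> \<le> gbar \<Longrightarrow> \<kappa> > 0 \<Longrightarrow> \<gamma> * L + 1 / \<kappa> \<le> 2 \<Longrightarrow> drift cc bb gV U \<kappa> \<gamma>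
        \<Longrightarrow> geom_ergodic (\<lambda>z. W z powr a) A (\<rho> powr \<gamma>) (myula gV U \<kappa> \<gamma>)"
      using myula_ergodic_of_drift[OF W cc bb gb a] unfolding drift_def[symmetric] by auto
    have pw: "(\<rho> powr \<gamma>) ^ n = \<rho> powr (\<gamma> * real n)" for \<gamma> n
      using A(2) by (simp add: powr_powr[symmetric] powr_realpow)
    show "\<exists>A\<ge>0. \<exists>\<rho>\<in>{0<..<1::real}.
           \<forall>\<theta>\<in>Theta. \<forall>\<kappa>\<in>{kl..kh}. \<forall>\<gamma>\<in>{0<..gbar}.
             \<exists>\<pi> \<pi>b. invariant_prob \<pi> (myula (gV \<theta>) (U \<theta>) \<kappa> \<gamma>)
                 \<and> invariant_prob \<pi>b (myula (gVb \<theta>) (Ub \<theta>) \<kappa> \<gamma>)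
                 \<and> (\<forall>x y. \<forall>n::nat.
                      max (wnorm (\<lambda>z. W z powr a) (kiter (myula (gV \<theta>) (U \<theta>) \<kappa> \<gamma>) n x) \<pi>)
                          (wnorm (\<lambda>z. W z powr a) (kiter (myula (gVb \<theta>) (Ub \<theta>) \<kappa> \<gamma>) n x) \<pi>b)
                        \<le> ereal (A * \<rho> powr (\<gamma> * real n) * W x powr a)
                    \<and> max (wnorm (\<lambda>z. W z powr a) (kiter (myula (gV \<theta>) (U \<theta>) \<kappa> \<gamma>) n x)
                                  (kiter (myula (gV \<theta>) (U \<theta>) \<kappa> \<gamma>) n y))
                          (wnorm (\<lambda>z. W z powr a) (kiter (myula (gVb \<theta>) (Ub \<theta>) \<kappa> \<gamma>) n x)
                                  (kiter (myula (gVb \<theta>) (Ub \<theta>) \<kappa> \<gamma>) n y))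
                        \<le> ereal (A * \<rho> powr (\<gamma> * real n) * (W x powr a + W y powr a)))"
    proof (rule exI[of _ A], rule conjI[OF A(1)], rule bexI[OF _ A(2)], intro ballI)
      fix \<theta> \<kappa> \<gamma> assume t: "\<theta> \<in> Theta" "\<kappa> \<in> {kl..kh}" "\<gamma> \<in> {0<..gbar}"
      then have g: "0 < \<gamma>" "\<gamma> \<le> gbar" by auto
      note d = conjunct1[OF dr[OF t]] conjunct2[OF dr[OF t]]
      obtain \<pi> where \<pi>: "invariant_prob \<pi> (myula (gV \<theta>) (U \<theta>) \<kappa> \<gamma>)"
        "\<And>x n. wnorm (\<lambda>z. W z powr a) (kiter (myula (gV \<theta>) (U \<theta>) \<kappa> \<gamma>) n x) \<pi> \<le> ereal (A * \<rho> powr (\<gamma> * real n) * W x powr a)"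
        "\<And>x y n. wnorm (\<lambda>z. W z powr a) (kiter (myula (gV \<theta>) (U \<theta>) \<kappa> \<gamma>) n x) (kiter (myula (gV \<theta>) (U \<theta>) \<kappa> \<gamma>) n y)
          \<le> ereal (A * \<rho> powr (\<gamma> * real n) * (W x powr a + W y powr a))"
        using erg[OF pot(1)[OF t(1)] g step(1,2)[OF t(2,3)] d(1)] unfolding geom_ergodic_def pw by metis
      obtain \<pi>b where \<pi>b: "invariant_prob \<pi>b (myula (gVb \<theta>) (Ub \<theta>) \<kappa> \<gamma>)"
        "\<And>x n. wnorm (\<lambda>z. W z powr a) (kiter (myula (gVb \<theta>) (Ub \<theta>) \<kappa> \<gamma>) n x) \<pi>b \<le> ereal (A * \<rho> powr (\<gamma> * real n) * W x powr a)"
        "\<And>x y n. wnorm (\<lambda>z. W z powr a) (kiter (myula (gVb \<theta>) (Ub \<theta>) \<kappa> \<gamma>) n x) (kiter (myula (gVb \<theta>) (Ub \<theta>) \<kappa> \<gamma>) n y)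
          \<le> ereal (A * \<rho> powr (\<gamma> * real n) * (W x powr a + W y powr a))"
        using erg[OF pot(2)[OF t(1)] g step(1,2)[OF t(2,3)] d(2)] unfolding geom_ergodic_def pw by metis
      show "\<exists>\<pi> \<pi>b. invariant_prob \<pi> (myula (gV \<theta>) (U \<theta>) \<kappa> \<gamma>)
                 \<and> invariant_prob \<pi>b (myula (gVb \<theta>) (Ub \<theta>) \<kappa> \<gamma>)
                 \<and> (\<forall>x y. \<forall>n::nat.
                      max (wnorm (\<lambda>z. W z powr a) (kiter (myula (gV \<theta>) (U \<theta>) \<kappa> \<gamma>) n x) \<pi>)
                          (wnorm (\<lambda>z. W z powr a) (kiter (myula (gVb \<theta>) (Ub \<theta>) \<kappa> \<gamma>) n x) \<pi>b)
                        \<le> ereal (A * \<rho> powr (\<gamma> * real n) * W x powr a)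
                    \<and> max (wnorm (\<lambda>z. W z powr a) (kiter (myula (gV \<theta>) (U \<theta>) \<kappa> \<gamma>) n x)
                                  (kiter (myula (gV \<theta>) (U \<theta>) \<kappa> \<gamma>) n y))
                          (wnorm (\<lambda>z. W z powr a) (kiter (myula (gVb \<theta>) (Ub \<theta>) \<kappa> \<gamma>) n x)
                                  (kiter (myula (gVb \<theta>) (Ub \<theta>) \<kappa> \<gamma>) n y))
                        \<le> ereal (A * \<rho> powr (\<gamma> * real n) * (W x powr a + W y powr a)))"
        by (intro exI[of _ \<pi>] exI[of _ \<pi>b] conjI allI max.boundedI \<pi> \<pi>b)
    qed
  qed
qed

end
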